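(* Let $(M,\mathcal{O})$ be a formal manifold, let $\mathcal{F}$ be a sheaf of $\mathcal{O}$-modules, and let $\{U_\gamma\}_{\gamma\in\Gamma}$ be an open cover of $M$. Then the linear map $$\bigoplus_{\gamma\in\Gamma}\mathcal{F}_c(U_\gamma)\to\mathcal{F}_c(M),\qquad\{u_\gamma\}_{\gamma\in\Gamma}\mapsto\sum_{\gamma\in\Gamma}\mathrm{ext}_{M,U_\gamma}(u_\gamma)$$ is continuous, open and surjective.
   Context: Formal manifolds. For a smooth manifold $N$ and $k\in\mathbb{N}$, $N^{(k)}$ is the locally ringed space $(N,\mathcal{O}_N^{(k)})$ over $\mathrm{Spec}(\mathbb{C})$ with $\mathcal{O}_N^{(k)}(U)=\mathrm{C}^\infty(U)[[y_1,\dots,y_k]]$ (complex-valued smooth functions). A formal manifold is a locally ringed space $(M,\mathcal{O})$ over $\mathrm{Spec}(\mathbb{C})$ with $M$ paracompact Hausdorff such that every point has an open neighborhood $U$ with $(U,\mathcal{O}|_U)\cong(\mathbb{R}^n)^{(k)}$ for some $n,k\in\mathbb{N}$. For $f\in\mathcal{O}(U)$, $f(a)\in\mathbb{C}$ is the residue of the germ of $f$ at $a$; $\underline{\mathcal{O}}$ is the quotient of $\mathcal{O}$ by the ideal sheaf of sections $f$ with $f(a)=0$ for all $a$, and $(M,\underline{\mathcal{O}})$ is a smooth manifold with its sheaf of complex-valued smooth functions. Smooth topology. A $\mathbb{C}$-linear sheaf homomorphism $D:\mathcal{F}|_U\to\underline{\mathcal{O}}|_U$ has order $\le r$ if for every open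 $W\subset U$ and $f_0,\dots,f_r\in\mathcal{O}(W)$, $[\cdots[[D|_W,f_0],f_1],\dots,f_r]=0$, where $[D,f]=D\circ f-f\circ D$; it is a differential operator if it is locally of finite order. $\mathrm{Diff}_c(\mathcal{F}|_U,\underline{\mathcal{O}}|_U)$ is the space of differential operators with compact support (complement of the largest open set on which $D$ is zero). $\mathcal{F}(U)$ has the topology defined by the seminorms $|u|_D=\sup_{a\in U}|(D(u))(a)|$, $D\in\mathrm{Diff}_c(\mathcal{F}|_U,\underline{\mathcal{O}}|_U)$. Compactly supported sections. For $K\subset U$ compact, $\mathcal{F}_K(U)\subset\mathcal{F}(U)$ is the subspace of sections supported in $K$ (subspace topology); $\mathcal{F}_c(U)=\varinjlim_K\mathcal{F}_K(U)$ with the inductive limit topology in the category of (possibly non-Hausdorff) locally convex spaces over $\mathbb{C}$. $\mathrm{ext}_{M,U}:\mathcal{F}_c(U)\to\mathcal{F}_c(M)$ is extension by zero. Direct sums carry the locally convex direct sum topology. *)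

theory Defs
  imports "HOL-Analysis.Analysis" "HOL-Algebra.Algebraic_Closure_Type"
begin

section \<open>Sheaves of algebras and of modules\<close>

text \<open>
  A space is an abstract topology \<open>M\<close> with underlying set \<open>topspace M\<close>. The sections over each
  open set form a record of HOL-Algebra, and \<open>restr S U V\<close> is the restriction from \<open>U\<close> to \<open>V\<close>.
  Nothing is assumed about the values at sets that are not open, so the restriction of a sheaf to
  an open subset \<open>U\<close> is the same record, considered over \<open>subtopology M U\<close>.
\<close>

record ('a, 'k, 's) sheaf_data =
  sections :: "'a set \<Rightarrow> ('k, 's) module"
  restr :: "'a set \<Rightarrow> 'a set \<Rightarrow> 's \<Rightarrow> 's"

locale set_sheaf =
  fixes M :: "'a topology" and S :: "('a, 'k, 's) sheaf_data"
  assumes restr_closed: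
      "\<lbrakk>openin M U; openin M V; V \<subseteq> U; s \<in> carrier (sections S U)\<rbrakk>
        \<Longrightarrow> restr S U V s \<in> carrier (sections S V)"
    and restr_self:
      "\<lbrakk>openin M U; s \<in> carrier (sections S U)\<rbrakk> \<Longrightarrow> restr S U U s = s"
    and restr_restr:
      "\<lbrakk>openin M U; openin M V; openin M W; W \<subseteq> V; V \<subseteq> U; s \<in> carrier (sections S U)\<rbrakk>
        \<Longrightarrow> restr S V W (restr S U V s) = restr S U W s"
    and glue:
      "\<lbrakk>\<And>V. V \<in> \<V> \<Longrightarrow> openin M V;
        \<And>V. V \<in> \<V> \<Longrightarrow> \<sigma> V \<in> carrier (sections S V);
        \<And>V W. \<lbrakk>V \<in> \<V>; W \<in> \<V>\<rbrakk> \<Longrightarrow> restr S V (V \<inter> W) (\<sigma> V) = restr S W (V \<inter> W) (\<sigma> W)\<rbrakk>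
        \<Longrightarrow> \<exists>!t. t \<in> carrier (sections S (\<Union>\<V>)) \<and> (\<forall>V\<in>\<V>. restr S (\<Union>\<V>) V t = \<sigma> V)"

abbreviation complex_ring :: "complex ring"
  where "complex_ring \<equiv> ring_of_type_algebra"

locale algebra_sheaf = set_sheaf M \<O>
  for M :: "'a topology" and \<O> :: "('a, complex, 'r) sheaf_data" +
  assumes algebra_sections: "openin M U \<Longrightarrow> algebra complex_ring (sections \<O> U)"
    and restr_ring_hom:
      "\<lbrakk>openin M U; openin M V; V \<subseteq> U\<rbrakk>
        \<Longrightarrow> restr \<O> U V \<in> ring_hom (sections \<O> U) (sections \<O> V)"
    and restr_scalar:
      "\<lbrakk>openin M U; openin M V; V \<subseteq> U; s \<in> carrier (sections \<O> U)\<rbrakk>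
        \<Longrightarrow> restr \<O> U V (c \<odot>\<^bsub>sections \<O> U\<^esub> s) = c \<odot>\<^bsub>sections \<O> V\<^esub> restr \<O> U V s"

text \<open>
  In a sheaf of \<open>\<O>\<close>-modules the ring operations \<open>mult\<close> and \<open>one\<close> of the records are irrelevant.
\<close>

locale module_sheaf = set_sheaf M \<F>
  for M :: "'a topology" and \<O> :: "('a, complex, 'r) sheaf_data"
    and \<F> :: "('a, 'r, 'f) sheaf_data" +
  assumes module_sections: "openin M U \<Longrightarrow> module (sections \<O> U) (sections \<F> U)"
    and restr_add:
      "\<lbrakk>openin M U; openin M V; V \<subseteq> U; u \<in> carrier (sections \<F> U); v \<in> carrier (sections \<F> U)\<rbrakk>
        \<Longrightarrow> restr \<F> U V (u \<oplus>\<^bsub>sections \<F> U\<^esub> v) = restr \<F> U V u \<oplus>\<^bsub>sections \<F> V\<^esub> restr \<F> U V v"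
    and restr_smult:
      "\<lbrakk>openin M U; openin M V; V \<subseteq> U; f \<in> carrier (sections \<O> U); u \<in> carrier (sections \<F> U)\<rbrakk>
        \<Longrightarrow> restr \<F> U V (f \<odot>\<^bsub>sections \<F> U\<^esub> u) = restr \<O> U V f \<odot>\<^bsub>sections \<F> V\<^esub> restr \<F> U V u"


section \<open>Stalks, locally ringed spaces and values of sections\<close>

definition germ ::
  "'a topology \<Rightarrow> ('a, 'k, 's) sheaf_data \<Rightarrow> 'a \<Rightarrow> 'a set \<Rightarrow> 's \<Rightarrow> ('a set \<times> 's) set"
  where "germ M S a U s =
    {(V, t). openin M V \<and> a \<in> V \<and> t \<in> carrier (sections S V) \<and>
       (\<exists>W. openin M W \<and> a \<in> W \<and> W \<subseteq> U \<inter> V \<and> restr S U W s = restr S V W t)}"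

text \<open>
  The operations on germs are computed on all representatives; the unions below are unions of
  equal sets.
\<close>

definition germ_op ::
  "'a topology \<Rightarrow> ('a, 'k, 's) sheaf_data \<Rightarrow> 'a \<Rightarrow> ('a set \<Rightarrow> 's \<Rightarrow> 's \<Rightarrow> 's)
    \<Rightarrow> ('a set \<times> 's) set \<Rightarrow> ('a set \<times> 's) set \<Rightarrow> ('a set \<times> 's) set"
  where "germ_op M S a f g h =
    (\<Union>(U, s)\<in>g. \<Union>(V, t)\<in>h.
       germ M S a (U \<inter> V) (f (U \<inter> V) (restr S U (U \<inter> V) s) (restr S V (U \<inter> V) t)))"

definition stalk ::
  "'a topology \<Rightarrow> ('a, 'k, 's) sheaf_data \<Rightarrow> 'a \<Rightarrow> ('k, ('a set \<times> 's) set) module"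
  where "stalk M S a =
    \<lparr>carrier = {germ M S a U s | U s. openin M U \<and> a \<in> U \<and> s \<in> carrier (sections S U)},
     mult = germ_op M S a (\<lambda>W s t. s \<otimes>\<^bsub>sections S W\<^esub> t),
     one = germ M S a (topspace M) \<one>\<^bsub>sections S (topspace M)\<^esub>,
     zero = germ M S a (topspace M) \<zero>\<^bsub>sections S (topspace M)\<^esub>,
     add = germ_op M S a (\<lambda>W s t. s \<oplus>\<^bsub>sections S W\<^esub> t),
     smult = (\<lambda>c g. \<Union>(U, s)\<in>g. germ M S a U (c \<odot>\<^bsub>sections S U\<^esub> s))\<rparr>"

definition local_ring :: "('r, 'm) ring_scheme \<Rightarrow> bool"
  where "local_ring R \<longleftrightarrow> cring R \<and> (\<exists>!m. maximalideal m R)"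

locale locally_ringed_space = algebra_sheaf M \<O>
  for M :: "'a topology" and \<O> :: "('a, complex, 'r) sheaf_data" +
  assumes local_stalk: "a \<in> topspace M \<Longrightarrow> local_ring (stalk M \<O> a)"

text \<open>
  The residue of a germ \<open>g\<close> at \<open>a\<close>, for stalks whose residue field is \<open>\<complex>\<close>: the complex number
  having the same class as \<open>g\<close> modulo the maximal ideal.
\<close>

definition residue_at ::
  "'a topology \<Rightarrow> ('a, complex, 'r) sheaf_data \<Rightarrow> 'a \<Rightarrow> ('a set \<times> 'r) set \<Rightarrow> complex"
  where "residue_at M \<O> a g =
    (THE c. g \<ominus>\<^bsub>stalk M \<O> a\<^esub> (c \<odot>\<^bsub>stalk M \<O> a\<^esub> \<one>\<^bsub>stalk M \<O> a\<^esub>)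
              \<in> (THE m. maximalideal m (stalk M \<O> a)))"

definition sec_value ::
  "'a topology \<Rightarrow> ('a, complex, 'r) sheaf_data \<Rightarrow> 'a set \<Rightarrow> 'r \<Rightarrow> 'a \<Rightarrow> complex"
  where "sec_value M \<O> U f a = residue_at M \<O> a (germ M \<O> a U f)"


section \<open>Formal manifolds\<close>

text \<open>
  A point of \<open>\<real>\<^sup>n\<close> is a real sequence that vanishes from index \<open>n\<close> on, as in
  \<^const>\<open>Euclidean_space\<close>. All partial derivatives of order at most \<open>r\<close> exist and are
  continuous:
\<close>

primrec C_on :: "nat \<Rightarrow> nat \<Rightarrow> (nat \<Rightarrow> real) set \<Rightarrow> ((nat \<Rightarrow> real) \<Rightarrow> complex) \<Rightarrow> bool"
  where
    "C_on n 0 U f \<longleftrightarrow> continuous_map (subtopology (Euclidean_space n) U) euclidean f"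
  | "C_on n (Suc r) U f \<longleftrightarrow>
       continuous_map (subtopology (Euclidean_space n) U) euclidean f \<and>
       (\<forall>i<n. \<exists>g. C_on n r U g \<and>
          (\<forall>x\<in>U. ((\<lambda>t. f (x(i := t))) has_vector_derivative g x) (at (x i))))"

definition smooth_on :: "nat \<Rightarrow> (nat \<Rightarrow> real) set \<Rightarrow> ((nat \<Rightarrow> real) \<Rightarrow> complex) \<Rightarrow> bool"
  where "smooth_on n U f \<longleftrightarrow> (\<forall>r. C_on n r U f)"

text \<open>
  The sheaf of \<open>(\<real>\<^sup>n)\<^sup>(\<^sup>k\<^sup>)\<close>. A power series in \<open>k\<close> variables over \<open>C\<^sup>\<infinity>(U)\<close> maps every multi-index
  \<open>\<alpha>\<close> (a sequence vanishing from index \<open>k\<close> on) to its coefficient. Coefficients at other \<open>\<alpha>\<close> and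
  values outside \<open>U\<close> are set to zero, so that sections are determined as functions. The
  multiplication is the Cauchy product.
\<close>

definition power_series_sections ::
  "nat \<Rightarrow> nat \<Rightarrow> (nat \<Rightarrow> real) set
    \<Rightarrow> (complex, (nat \<Rightarrow> nat) \<Rightarrow> (nat \<Rightarrow> real) \<Rightarrow> complex) module"
  where "power_series_sections n k U =
    \<lparr>carrier = {s. \<forall>\<alpha>. smooth_on n U (s \<alpha>) \<and> (\<forall>x. x \<notin> U \<longrightarrow> s \<alpha> x = 0) \<and>
                      ((\<exists>i\<ge>k. \<alpha> i \<noteq> 0) \<longrightarrow> s \<alpha> = (\<lambda>x. 0))},
     mult = (\<lambda>s t \<alpha> x. if \<exists>i\<ge>k. \<alpha> i \<noteq> 0 then 0
                        else \<Sum>\<beta> | (\<forall>i. \<beta> i \<le> \<alpha> i). s \<beta> x * t (\<lambda>i. \<alpha> i - \<beta> i) x),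
     one = (\<lambda>\<alpha> x. if \<alpha> = (\<lambda>i. 0) \<and> x \<in> U then 1 else 0),
     zero = (\<lambda>\<alpha> x. 0),
     add = (\<lambda>s t \<alpha> x. s \<alpha> x + t \<alpha> x),
     smult = (\<lambda>c s \<alpha> x. c * s \<alpha> x)\<rparr>"

definition euclidean_formal_sheaf ::
  "nat \<Rightarrow> nat \<Rightarrow> (nat \<Rightarrow> real, complex, (nat \<Rightarrow> nat) \<Rightarrow> (nat \<Rightarrow> real) \<Rightarrow> complex) sheaf_data"
  where "euclidean_formal_sheaf n k =
    \<lparr>sections = power_series_sections n k,
     restr = (\<lambda>U V s \<alpha> x. if x \<in> V then s \<alpha> x else 0)\<rparr>"

text \<open>
  Isomorphism of ringed spaces over \<open>Spec \<complex>\<close>: a homeomorphism together with an isomorphism of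
  sheaves of \<open>\<complex>\<close>-algebras \<open>\<P> \<rightarrow> \<phi>\<^sub>*\<O>\<close>. The maps induced on stalks are isomorphisms, hence local.
\<close>

definition ringed_space_iso ::
  "'a topology \<Rightarrow> ('a, complex, 'r) sheaf_data
    \<Rightarrow> 'b topology \<Rightarrow> ('b, complex, 's) sheaf_data \<Rightarrow> bool"
  where "ringed_space_iso M \<O> Y \<P> \<longleftrightarrow>
    (\<exists>\<phi> h. homeomorphic_map M Y \<phi> \<and>
      (let pre = (\<lambda>V. {x \<in> topspace M. \<phi> x \<in> V}) in
        (\<forall>V. openin Y V \<longrightarrow>
           h V \<in> ring_iso (sections \<P> V) (sections \<O> (pre V)) \<and>
           (\<forall>c. \<forall>s\<in>carrier (sections \<P> V).
              h V (c \<odot>\<^bsub>sections \<P> V\<^esub> s) = c \<odot>\<^bsub>sections \<O> (pre V)\<^esub> h V s)) \<and>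
        (\<forall>V W. openin Y V \<and> openin Y W \<and> W \<subseteq> V \<longrightarrow>
           (\<forall>s\<in>carrier (sections \<P> V).
              h W (restr \<P> V W s) = restr \<O> (pre V) (pre W) (h V s)))))"

definition paracompact_space :: "'a topology \<Rightarrow> bool"
  where "paracompact_space M \<longleftrightarrow>
    (\<forall>\<U>. (\<forall>U\<in>\<U>. openin M U) \<and> \<Union>\<U> = topspace M \<longrightarrow>
       (\<exists>\<V>. (\<forall>V\<in>\<V>. openin M V \<and> (\<exists>U\<in>\<U>. V \<subseteq> U)) \<and> \<Union>\<V> = topspace M \<and>
             locally_finite_in M \<V>))"

locale formal_manifold = locally_ringed_space M \<O>
  for M :: "'a topology" and \<O> :: "('a, complex, 'r) sheaf_data" +
  assumes Hausdorff: "Hausdorff_space M"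
    and paracompact: "paracompact_space M"
    and chart: "a \<in> topspace M \<Longrightarrow>
      \<exists>U n k. openin M U \<and> a \<in> U \<and>
        ringed_space_iso (subtopology M U) \<O> (Euclidean_space n) (euclidean_formal_sheaf n k)"


section \<open>The reduction\<close>

text \<open>
  The quotient sheaf by an ideal sheaf, as the sheafification of \<open>U \<mapsto> \<O>(U) / \<I>(U)\<close>: a section
  over \<open>U\<close> is a family of elements of the rings \<open>\<O>\<^sub>a / \<I>\<^sub>a\<close>, for \<open>a \<in> U\<close>, that is locally induced by
  sections of \<open>\<O>\<close>. It is a sheaf of \<open>\<O>\<close>-modules.
\<close>

definition stalk_ideal ::
  "'a topology \<Rightarrow> ('a, 'k, 'r) sheaf_data \<Rightarrow> ('a set \<Rightarrow> 'r set) \<Rightarrow> 'a \<Rightarrow> ('a set \<times> 'r) set set"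
  where "stalk_ideal M \<O> I a = {germ M \<O> a U f | U f. openin M U \<and> a \<in> U \<and> f \<in> I U}"

definition stalk_class ::
  "'a topology \<Rightarrow> ('a, 'k, 'r) sheaf_data \<Rightarrow> ('a set \<Rightarrow> 'r set) \<Rightarrow> 'a set \<Rightarrow> 'r \<Rightarrow> 'a
    \<Rightarrow> ('a set \<times> 'r) set set"
  where "stalk_class M \<O> I U f a = stalk_ideal M \<O> I a +>\<^bsub>stalk M \<O> a\<^esub> germ M \<O> a U f"

definition quotient_sheaf ::
  "'a topology \<Rightarrow> ('a, 'k, 'r) sheaf_data \<Rightarrow> ('a set \<Rightarrow> 'r set)
    \<Rightarrow> ('a, 'r, 'a \<Rightarrow> ('a set \<times> 'r) set set) sheaf_data"
  where "quotient_sheaf M \<O> I = (let Q = (\<lambda>a. stalk M \<O> a Quot stalk_ideal M \<O> I a) in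
    \<lparr>sections = (\<lambda>U.
       \<lparr>carrier = {s \<in> extensional U. \<forall>a\<in>U. \<exists>V f. openin M V \<and> a \<in> V \<and> V \<subseteq> U \<and>
                    f \<in> carrier (sections \<O> V) \<and> (\<forall>b\<in>V. s b = stalk_class M \<O> I V f b)},
        mult = (\<lambda>s t. \<lambda>a\<in>U. s a \<otimes>\<^bsub>Q a\<^esub> t a),
        one = (\<lambda>a\<in>U. \<one>\<^bsub>Q a\<^esub>),
        zero = (\<lambda>a\<in>U. \<zero>\<^bsub>Q a\<^esub>),
        add = (\<lambda>s t. \<lambda>a\<in>U. s a \<oplus>\<^bsub>Q a\<^esub> t a),
        smult = (\<lambda>f s. \<lambda>a\<in>U. stalk_class M \<O> I U f a \<otimes>\<^bsub>Q a\<^esub> s a)\<rparr>),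
     restr = (\<lambda>U V s. restrict s V)\<rparr>)"

definition vanishing_ideal ::
  "'a topology \<Rightarrow> ('a, complex, 'r) sheaf_data \<Rightarrow> 'a set \<Rightarrow> 'r set"
  where "vanishing_ideal M \<O> U =
    {f \<in> carrier (sections \<O> U). \<forall>a\<in>U. sec_value M \<O> U f a = 0}"

definition reduction ::
  "'a topology \<Rightarrow> ('a, complex, 'r) sheaf_data
    \<Rightarrow> ('a, 'r, 'a \<Rightarrow> ('a set \<times> 'r) set set) sheaf_data"
  where "reduction M \<O> = quotient_sheaf M \<O> (vanishing_ideal M \<O>)"

text \<open>
  The smooth function on \<open>U\<close> given by a section of the reduction: the common residue of the
  representatives in \<open>\<O>\<^sub>a\<close>.
\<close>

definition reduced_value ::
  "'a topology \<Rightarrow> ('a, complex, 'r) sheaf_data \<Rightarrow> ('a \<Rightarrow> ('a set \<times> 'r) set set) \<Rightarrow> 'a \<Rightarrow> complex"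
  where "reduced_value M \<O> s a = (THE c. \<forall>g\<in>s a. residue_at M \<O> a g = c)"


section \<open>Differential operators\<close>

definition linear_between ::
  "(complex, 'v) module \<Rightarrow> (complex, 'w) module \<Rightarrow> ('v \<Rightarrow> 'w) \<Rightarrow> bool"
  where "linear_between V W L \<longleftrightarrow>
    L \<in> carrier V \<rightarrow> carrier W \<and>
    (\<forall>u\<in>carrier V. \<forall>v\<in>carrier V. L (u \<oplus>\<^bsub>V\<^esub> v) = L u \<oplus>\<^bsub>W\<^esub> L v) \<and>
    (\<forall>c. \<forall>u\<in>carrier V. L (c \<odot>\<^bsub>V\<^esub> u) = c \<odot>\<^bsub>W\<^esub> L u)"

text \<open>\<open>\<F>(U)\<close> as a complex vector space, by restriction of scalars along \<open>\<complex> \<rightarrow> \<O>(U)\<close>.\<close>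

definition sections_vs ::
  "('a, complex, 'r) sheaf_data \<Rightarrow> ('a, 'r, 'f) sheaf_data \<Rightarrow> 'a set \<Rightarrow> (complex, 'f) module"
  where "sections_vs \<O> \<F> U =
    \<lparr>carrier = carrier (sections \<F> U), mult = mult (sections \<F> U), one = one (sections \<F> U),
     zero = zero (sections \<F> U), add = add (sections \<F> U),
     smult = (\<lambda>c u. (c \<odot>\<^bsub>sections \<O> U\<^esub> \<one>\<^bsub>sections \<O> U\<^esub>) \<odot>\<^bsub>sections \<F> U\<^esub> u)\<rparr>"

text \<open>A \<open>\<complex>\<close>-linear homomorphism \<open>\<F>|\<^sub>U \<rightarrow> \<G>|\<^sub>U\<close> is the family of its components \<open>D V\<close>, for \<open>V \<subseteq> U\<close>.\<close>

definition sheaf_hom ::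
  "'a topology \<Rightarrow> ('a, complex, 'r) sheaf_data \<Rightarrow> ('a, 'r, 'f) sheaf_data \<Rightarrow> ('a, 'r, 'g) sheaf_data
    \<Rightarrow> 'a set \<Rightarrow> ('a set \<Rightarrow> 'f \<Rightarrow> 'g) \<Rightarrow> bool"
  where "sheaf_hom M \<O> \<F> \<G> U D \<longleftrightarrow>
    (\<forall>V. openin M V \<and> V \<subseteq> U \<longrightarrow>
       linear_between (sections_vs \<O> \<F> V) (sections_vs \<O> \<G> V) (D V)) \<and>
    (\<forall>V W. openin M V \<and> openin M W \<and> W \<subseteq> V \<and> V \<subseteq> U \<longrightarrow>
       (\<forall>u\<in>carrier (sections \<F> V). D W (restr \<F> V W u) = restr \<G> V W (D V u)))"

definition sheaf_commutator ::
  "('a, complex, 'r) sheaf_data \<Rightarrow> ('a, 'r, 'f) sheaf_data \<Rightarrow> ('a, 'r, 'g) sheaf_data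
    \<Rightarrow> 'a set \<Rightarrow> ('a set \<Rightarrow> 'f \<Rightarrow> 'g) \<Rightarrow> 'r \<Rightarrow> ('a set \<Rightarrow> 'f \<Rightarrow> 'g)"
  where "sheaf_commutator \<O> \<F> \<G> W D f = (\<lambda>V u.
    D V (restr \<O> W V f \<odot>\<^bsub>sections \<F> V\<^esub> u) \<ominus>\<^bsub>sections \<G> V\<^esub>
      (restr \<O> W V f \<odot>\<^bsub>sections \<G> V\<^esub> D V u))"

definition zero_on ::
  "'a topology \<Rightarrow> ('a, 'r, 'f) sheaf_data \<Rightarrow> ('a, 'r, 'g) sheaf_data
    \<Rightarrow> 'a set \<Rightarrow> ('a set \<Rightarrow> 'f \<Rightarrow> 'g) \<Rightarrow> bool"
  where "zero_on M \<F> \<G> W D \<longleftrightarrow>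
    (\<forall>V. openin M V \<and> V \<subseteq> W \<longrightarrow> (\<forall>u\<in>carrier (sections \<F> V). D V u = \<zero>\<^bsub>sections \<G> V\<^esub>))"

definition order_le ::
  "'a topology \<Rightarrow> ('a, complex, 'r) sheaf_data \<Rightarrow> ('a, 'r, 'f) sheaf_data \<Rightarrow> ('a, 'r, 'g) sheaf_data
    \<Rightarrow> 'a set \<Rightarrow> ('a set \<Rightarrow> 'f \<Rightarrow> 'g) \<Rightarrow> nat \<Rightarrow> bool"
  where "order_le M \<O> \<F> \<G> U D r \<longleftrightarrow>
    (\<forall>W fs. openin M W \<and> W \<subseteq> U \<and> length fs = Suc r \<and> set fs \<subseteq> carrier (sections \<O> W) \<longrightarrow>
       zero_on M \<F> \<G> W (foldl (sheaf_commutator \<O> \<F> \<G> W) D fs))"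

definition diff_op ::
  "'a topology \<Rightarrow> ('a, complex, 'r) sheaf_data \<Rightarrow> ('a, 'r, 'f) sheaf_data \<Rightarrow> ('a, 'r, 'g) sheaf_data
    \<Rightarrow> 'a set \<Rightarrow> ('a set \<Rightarrow> 'f \<Rightarrow> 'g) \<Rightarrow> bool"
  where "diff_op M \<O> \<F> \<G> U D \<longleftrightarrow> sheaf_hom M \<O> \<F> \<G> U D \<and>
    (\<forall>a\<in>U. \<exists>V r. openin M V \<and> a \<in> V \<and> V \<subseteq> U \<and> order_le M \<O> \<F> \<G> V D r)"

definition op_support ::
  "'a topology \<Rightarrow> ('a, 'r, 'f) sheaf_data \<Rightarrow> ('a, 'r, 'g) sheaf_data
    \<Rightarrow> 'a set \<Rightarrow> ('a set \<Rightarrow> 'f \<Rightarrow> 'g) \<Rightarrow> 'a set"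
  where "op_support M \<F> \<G> U D = U - \<Union>{V. openin M V \<and> V \<subseteq> U \<and> zero_on M \<F> \<G> V D}"

definition Diff_c ::
  "'a topology \<Rightarrow> ('a, complex, 'r) sheaf_data \<Rightarrow> ('a, 'r, 'f) sheaf_data \<Rightarrow> ('a, 'r, 'g) sheaf_data
    \<Rightarrow> 'a set \<Rightarrow> ('a set \<Rightarrow> 'f \<Rightarrow> 'g) set"
  where "Diff_c M \<O> \<F> \<G> U =
    {D. diff_op M \<O> \<F> \<G> U D \<and> compactin M (op_support M \<F> \<G> U D)}"


section \<open>Locally convex topologies\<close>

definition seminorm_topology :: "(complex, 'v) module \<Rightarrow> ('v \<Rightarrow> real) set \<Rightarrow> 'v topology"
  where "seminorm_topology V P = topology_generated_by
    (insert (carrier V)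
      {{v \<in> carrier V. p (v \<ominus>\<^bsub>V\<^esub> u) < \<epsilon>} | p u \<epsilon>. p \<in> P \<and> u \<in> carrier V \<and> 0 < \<epsilon>})"

text \<open>Locally convex vector space topologies, not necessarily Hausdorff.\<close>

definition lc_topology :: "(complex, 'v) module \<Rightarrow> 'v topology \<Rightarrow> bool"
  where "lc_topology V T \<longleftrightarrow>
    topspace T = carrier V \<and>
    continuous_map (prod_topology T T) T (\<lambda>(u, v). u \<oplus>\<^bsub>V\<^esub> v) \<and>
    continuous_map (prod_topology euclidean T) T (\<lambda>(c, u). c \<odot>\<^bsub>V\<^esub> u) \<and>
    (\<forall>N. openin T N \<and> \<zero>\<^bsub>V\<^esub> \<in> N \<longrightarrow>
       (\<exists>C W. openin T W \<and> \<zero>\<^bsub>V\<^esub> \<in> W \<and> W \<subseteq> C \<and> C \<subseteq> N \<and>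
          (\<forall>u\<in>C. \<forall>v\<in>C. \<forall>t::real. 0 \<le> t \<and> t \<le> 1 \<longrightarrow>
             (complex_of_real (1 - t) \<odot>\<^bsub>V\<^esub> u) \<oplus>\<^bsub>V\<^esub> (complex_of_real t \<odot>\<^bsub>V\<^esub> v) \<in> C)))"

text \<open>
  The finest locally convex topology on \<open>V\<close> for which all the maps \<open>j : S \<rightarrow> V\<close> with \<open>(S, j) \<in> J\<close>
  are continuous, that is, the supremum of all locally convex topologies with this property.
\<close>

definition final_lc_topology ::
  "(complex, 'v) module \<Rightarrow> ('w topology \<times> ('w \<Rightarrow> 'v)) set \<Rightarrow> 'v topology"
  where "final_lc_topology V J = topology_generated_by
    {W. \<exists>T. lc_topology V T \<and> (\<forall>(S, j)\<in>J. continuous_map S T j) \<and> openin T W}"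

definition direct_sum :: "'i set \<Rightarrow> ('i \<Rightarrow> (complex, 'v) module) \<Rightarrow> (complex, 'i \<Rightarrow> 'v) module"
  where "direct_sum \<Gamma> V =
    \<lparr>carrier = {u \<in> Pi\<^sub>E \<Gamma> (\<lambda>\<gamma>. carrier (V \<gamma>)). finite {\<gamma> \<in> \<Gamma>. u \<gamma> \<noteq> \<zero>\<^bsub>V \<gamma>\<^esub>}},
     mult = (\<lambda>u v. \<lambda>\<gamma>\<in>\<Gamma>. u \<gamma> \<otimes>\<^bsub>V \<gamma>\<^esub> v \<gamma>),
     one = (\<lambda>\<gamma>\<in>\<Gamma>. \<one>\<^bsub>V \<gamma>\<^esub>),
     zero = (\<lambda>\<gamma>\<in>\<Gamma>. \<zero>\<^bsub>V \<gamma>\<^esub>),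
     add = (\<lambda>u v. \<lambda>\<gamma>\<in>\<Gamma>. u \<gamma> \<oplus>\<^bsub>V \<gamma>\<^esub> v \<gamma>),
     smult = (\<lambda>c u. \<lambda>\<gamma>\<in>\<Gamma>. c \<odot>\<^bsub>V \<gamma>\<^esub> u \<gamma>)\<rparr>"

definition direct_sum_incl ::
  "'i set \<Rightarrow> ('i \<Rightarrow> (complex, 'v) module) \<Rightarrow> 'i \<Rightarrow> 'v \<Rightarrow> ('i \<Rightarrow> 'v)"
  where "direct_sum_incl \<Gamma> V \<gamma> v = (\<lambda>\<delta>\<in>\<Gamma>. if \<delta> = \<gamma> then v else \<zero>\<^bsub>V \<delta>\<^esub>)"

definition direct_sum_topology ::
  "'i set \<Rightarrow> ('i \<Rightarrow> (complex, 'v) module) \<Rightarrow> ('i \<Rightarrow> 'v topology) \<Rightarrow> ('i \<Rightarrow> 'v) topology"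
  where "direct_sum_topology \<Gamma> V T =
    final_lc_topology (direct_sum \<Gamma> V) {(T \<gamma>, direct_sum_incl \<Gamma> V \<gamma>) | \<gamma>. \<gamma> \<in> \<Gamma>}"


section \<open>The smooth topology and compactly supported sections\<close>

text \<open>The element \<open>0\<close> is inserted so that the supremum over the empty set is \<open>0\<close>.\<close>

definition diff_seminorm ::
  "'a topology \<Rightarrow> ('a, complex, 'r) sheaf_data \<Rightarrow> 'a set
    \<Rightarrow> ('a set \<Rightarrow> 'f \<Rightarrow> 'a \<Rightarrow> ('a set \<times> 'r) set set) \<Rightarrow> 'f \<Rightarrow> real"
  where "diff_seminorm M \<O> U D u =
    Sup (insert 0 ((\<lambda>a. cmod (reduced_value M \<O> (D U u) a)) ` U))"

definition smooth_topology ::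
  "'a topology \<Rightarrow> ('a, complex, 'r) sheaf_data \<Rightarrow> ('a, 'r, 'f) sheaf_data \<Rightarrow> 'a set \<Rightarrow> 'f topology"
  where "smooth_topology M \<O> \<F> U =
    seminorm_topology (sections_vs \<O> \<F> U)
      (diff_seminorm M \<O> U ` Diff_c M \<O> \<F> (reduction M \<O>) U)"

definition sec_support ::
  "'a topology \<Rightarrow> ('a, 'r, 'f) sheaf_data \<Rightarrow> 'a set \<Rightarrow> 'f \<Rightarrow> 'a set"
  where "sec_support M \<F> U u =
    U - \<Union>{V. openin M V \<and> V \<subseteq> U \<and> restr \<F> U V u = \<zero>\<^bsub>sections \<F> V\<^esub>}"

definition sections_supp_in ::
  "'a topology \<Rightarrow> ('a, 'r, 'f) sheaf_data \<Rightarrow> 'a set \<Rightarrow> 'a set \<Rightarrow> 'f set"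
  where "sections_supp_in M \<F> U K = {u \<in> carrier (sections \<F> U). sec_support M \<F> U u \<subseteq> K}"

definition Fc ::
  "'a topology \<Rightarrow> ('a, complex, 'r) sheaf_data \<Rightarrow> ('a, 'r, 'f) sheaf_data \<Rightarrow> 'a set
    \<Rightarrow> (complex, 'f) module"
  where "Fc M \<O> \<F> U = (sections_vs \<O> \<F> U)
    \<lparr>carrier := \<Union>{sections_supp_in M \<F> U K | K. compactin M K \<and> K \<subseteq> U}\<rparr>"

definition Fc_topology ::
  "'a topology \<Rightarrow> ('a, complex, 'r) sheaf_data \<Rightarrow> ('a, 'r, 'f) sheaf_data \<Rightarrow> 'a set \<Rightarrow> 'f topology"
  where "Fc_topology M \<O> \<F> U =
    final_lc_topology (Fc M \<O> \<F> U)
      {(subtopology (smooth_topology M \<O> \<F> U) (sections_supp_in M \<F> U K), \<lambda>u. u) | K.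
         compactin M K \<and> K \<subseteq> U}"

text \<open>Extension by zero to the whole space.\<close>

definition ext_zero ::
  "'a topology \<Rightarrow> ('a, 'r, 'f) sheaf_data \<Rightarrow> 'a set \<Rightarrow> 'f \<Rightarrow> 'f"
  where "ext_zero M \<F> U u =
    (let A = topspace M; N = A - sec_support M \<F> U u in
      THE v. v \<in> carrier (sections \<F> A) \<and> restr \<F> A U v = u \<and> restr \<F> A N v = \<zero>\<^bsub>sections \<F> N\<^esub>)"

text \<open>The sum is taken over the support of the family, since \<^const>\<open>finsum\<close> needs a finite set.\<close>

definition ext_sum ::
  "'a topology \<Rightarrow> ('a, 'r, 'f) sheaf_data \<Rightarrow> 'i set \<Rightarrow> ('i \<Rightarrow> 'a set) \<Rightarrow> ('i \<Rightarrow> 'f) \<Rightarrow> 'f"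
  where "ext_sum M \<F> \<Gamma> U u =
    finsum (sections \<F> (topspace M)) (\<lambda>\<gamma>. ext_zero M \<F> (U \<gamma>) (u \<gamma>))
      {\<gamma> \<in> \<Gamma>. u \<gamma> \<noteq> \<zero>\<^bsub>sections \<F> (U \<gamma>)\<^esub>}"

end

theory Submission
  imports Defs
begin

text \<open>
  Let \<open>L\<close> be the sum map. It is continuous because each extension by zero is: near a compact
  \<open>K \<subseteq> U\<close> one may replace a differential operator \<open>D\<close> on \<open>M\<close> by \<open>D \<circ> \<phi>\<close>, where \<open>\<phi> \<in> \<O>(M)\<close> is \<open>1\<close>
  near \<open>K\<close> and has compact support in \<open>U\<close>, so that \<open>D \<circ> \<phi>\<close> is compactly supported in \<open>U\<close> and defines the
  same seminorm on sections supported in \<open>K\<close>.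

  For surjectivity and openness, consider the sections \<open>f \<in> \<O>(M)\<close> for which \<open>u \<mapsto> f u\<close> maps
  \<open>\<F>\<^sub>c(M)\<close> into the image of \<open>L\<close>, or is continuous from every \<open>\<F>\<^sub>K(M)\<close> to the image topology of \<open>L\<close>,
  which is locally convex. They form an ideal, and it contains every \<open>f\<close> with compact support in
  some \<open>U\<^sub>\<gamma>\<close>, since then \<open>f u\<close> is the extension by zero of its restriction to \<open>U\<^sub>\<gamma>\<close>. Such an ideal
  contains, for each compact \<open>K\<close>, a section that is \<open>1\<close> near \<open>K\<close>, and this section acts as the identity
  on \<open>\<F>\<^sub>K(M)\<close>. Hence \<open>L\<close> is surjective, and it is open because the topology of \<open>\<F>\<^sub>c(M)\<close> is finer than
  the image topology.
\<close>

section \<open>Locally convex topologies\<close>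

text \<open>Nothing is known about \<open>\<F>\<close> beyond its module structure, so continuity is
  always proved by turning an operator on the target side into an operator on the source side that
  defines the same seminorm. Cutting off moves operators from the whole space to \<open>U\<close>
  and keeps their order because multiplications by sections of \<open>\<O>\<close> commute. The
  opposite direction, needed for restriction to \<open>U\<close>, extends a compactly supported
  operator by zero. The seminorms are real suprema, which obey the triangle inequality only if the
  functions are bounded. This forces the study of stalks: a section minus the constant coefficient
  of its power series is a nonunit, so its residue is that coefficient, which is continuous and
  hence bounded on the compact support of an operator. Surjectivity has to precede openness: the
  image topology lives on the image of the sum map, and it competes in the supremum
  \<open>final_lc_topology\<close> only if that image consists of all compactly supported
  sections.\<close>

lemma complex_ring_simps [simp]:
  "carrier complex_ring = UNIV" "x \<oplus>\<^bsub>complex_ring\<^esub> y = x + y" "x \<otimes>\<^bsub>complex_ring\<^esub> y = x * y"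
  "\<one>\<^bsub>complex_ring\<^esub> = 1" "\<zero>\<^bsub>complex_ring\<^esub> = 0"
  by (simp_all add: ring_of_type_algebra_def)

lemma complex_ring_minus [simp]: "\<ominus>\<^bsub>complex_ring\<^esub> x = - x"
proof -
  interpret cring complex_ring by (rule cring_from_type_algebra)
  show ?thesis
    using minus_equality[of "- x" x] by simp
qed

lemma linear_between_closed:
  "linear_between V W L \<Longrightarrow> u \<in> carrier V \<Longrightarrow> L u \<in> carrier W"
  by (auto simp: linear_between_def)

lemma linear_between_add:
  "linear_between V W L \<Longrightarrow> u \<in> carrier V \<Longrightarrow> v \<in> carrier V \<Longrightarrow> L (u \<oplus>\<^bsub>V\<^esub> v) = L u \<oplus>\<^bsub>W\<^esub> L v"
  by (auto simp: linear_between_def)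

lemma linear_between_smult:
  "linear_between V W L \<Longrightarrow> u \<in> carrier V \<Longrightarrow> L (c \<odot>\<^bsub>V\<^esub> u) = c \<odot>\<^bsub>W\<^esub> L u"
  by (auto simp: linear_between_def)

lemma linear_between_zero:
  assumes "module complex_ring V" "module complex_ring W" "linear_between V W L"
  shows "L \<zero>\<^bsub>V\<^esub> = \<zero>\<^bsub>W\<^esub>"
proof -
  interpret V: module complex_ring V by fact
  interpret W: module complex_ring W by fact
  have "L (0 \<odot>\<^bsub>V\<^esub> \<zero>\<^bsub>V\<^esub>) = 0 \<odot>\<^bsub>W\<^esub> L \<zero>\<^bsub>V\<^esub>"
    using assms(3) by (intro linear_between_smult) auto
  moreover have "0 \<odot>\<^bsub>V\<^esub> \<zero>\<^bsub>V\<^esub> = \<zero>\<^bsub>V\<^esub>" "0 \<odot>\<^bsub>W\<^esub> L \<zero>\<^bsub>V\<^esub> = \<zero>\<^bsub>W\<^esub>"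
    using V.smult_l_null[of "\<zero>\<^bsub>V\<^esub>"] W.smult_l_null[of "L \<zero>\<^bsub>V\<^esub>"]
      linear_between_closed[OF assms(3)] by simp_all
  ultimately show ?thesis by simp
qed

text \<open>\<open>linear_between\<close> speaks of sums and complex multiples only, so negation is
  handled as multiplication by -1.\<close>

lemma linear_between_minus:
  assumes V: "module complex_ring V" and W: "module complex_ring W" and L: "linear_between V W L"
    and u: "u \<in> carrier V" and v: "v \<in> carrier V"
  shows "L (u \<ominus>\<^bsub>V\<^esub> v) = L u \<ominus>\<^bsub>W\<^esub> L v"
proof -
  interpret V: module complex_ring V by fact
  interpret W: module complex_ring W by fact
  have "\<ominus>\<^bsub>V\<^esub> v = (-1) \<odot>\<^bsub>V\<^esub> v"
    using V.smult_l_minus[of 1 v] V.smult_one[of v] v by simp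
  then have "L (\<ominus>\<^bsub>V\<^esub> v) = (-1) \<odot>\<^bsub>W\<^esub> L v"
    using linear_between_smult[OF L v] by simp
  also have "\<dots> = \<ominus>\<^bsub>W\<^esub> L v"
    using W.smult_l_minus[of 1 "L v"] W.smult_one[of "L v"] linear_between_closed[OF L v] by simp
  finally show ?thesis
    using linear_between_add[OF L u] v by (simp add: a_minus_def)
qed

lemma linear_between_compose:
  assumes "linear_between U V K" "linear_between V W L"
  shows "linear_between U W (L \<circ> K)"
  using assms unfolding linear_between_def by (auto simp: Pi_iff)

lemma lc_topspace: "lc_topology V T \<Longrightarrow> topspace T = carrier V"
  by (simp add: lc_topology_def)

lemma lc_add:
  "lc_topology V T \<Longrightarrow> continuous_map (prod_topology T T) T (\<lambda>(u, v). u \<oplus>\<^bsub>V\<^esub> v)"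
  unfolding lc_topology_def by (elim conjE)

lemma lc_smult:
  "lc_topology V T \<Longrightarrow> continuous_map (prod_topology euclidean T) T (\<lambda>(c, u). c \<odot>\<^bsub>V\<^esub> u)"
  unfolding lc_topology_def by (elim conjE)

lemma lc_continuous_add:
  assumes "lc_topology V T" "continuous_map S T f" "continuous_map S T g"
  shows "continuous_map S T (\<lambda>x. f x \<oplus>\<^bsub>V\<^esub> g x)"
proof -
  have "continuous_map S T ((\<lambda>(u, v). u \<oplus>\<^bsub>V\<^esub> v) \<circ> (\<lambda>x. (f x, g x)))"
    using assms unfolding lc_topology_def
    by (intro continuous_map_compose[OF continuous_map_pairedI]) auto
  then show ?thesis by (simp add: comp_def)
qed

text \<open>Every condition on the pullback is a condition on the composite with \<open>L\<close>,
  which linearity turns into the corresponding one on \<open>T\<close>; convex neighbourhoods are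
  preimages of convex ones. This provides the competing topology behind the universal property of
  \<open>final_lc_topology\<close>.\<close>

lemma lc_pullback:
  assumes V: "module complex_ring V" and W: "module complex_ring W"
    and L: "linear_between V W L" and T: "lc_topology W T"
  shows "lc_topology V (pullback_topology (carrier V) L T)"
    (is "lc_topology V ?P")
proof -
  interpret V: module complex_ring V by fact
  interpret W: module complex_ring W by fact
  have cl: "\<And>u. u \<in> carrier V \<Longrightarrow> L u \<in> carrier W"
    using L by (rule linear_between_closed)
  have top: "topspace ?P = carrier V"
    using cl lc_topspace[OF T] by (auto simp: topspace_pullback_topology)
  have contL: "continuous_map ?P T L"
    using continuous_map_pullback[of T T id "carrier V" L] by simp
  have add: "continuous_map (prod_topology ?P ?P) ?P (\<lambda>(u, v). u \<oplus>\<^bsub>V\<^esub> v)"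
  proof (rule continuous_map_pullback')
    have "continuous_map (prod_topology ?P ?P) T (\<lambda>x. L (fst x) \<oplus>\<^bsub>W\<^esub> L (snd x))"
      by (intro lc_continuous_add[OF T] continuous_map_compose[OF _ contL, unfolded comp_def]
          continuous_map_fst continuous_map_snd)
    then show "continuous_map (prod_topology ?P ?P) T (L \<circ> (\<lambda>(u, v). u \<oplus>\<^bsub>V\<^esub> v))"
      by (rule continuous_map_eq) (auto simp: top linear_between_add[OF L])
    show "topspace (prod_topology ?P ?P) \<subseteq> (\<lambda>(u, v). u \<oplus>\<^bsub>V\<^esub> v) -` carrier V"
      by (auto simp: top)
  qed
  have smult: "continuous_map (prod_topology euclidean ?P) ?P (\<lambda>(c, u). c \<odot>\<^bsub>V\<^esub> u)"
  proof (rule continuous_map_pullback')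
    have "continuous_map (prod_topology euclidean ?P) (prod_topology euclidean T)
        (\<lambda>x. (fst x, L (snd x)))"
      by (intro continuous_map_pairedI continuous_map_fst
          continuous_map_compose[OF continuous_map_snd contL, unfolded comp_def])
    then have "continuous_map (prod_topology euclidean ?P) T
        ((\<lambda>(c, u). c \<odot>\<^bsub>W\<^esub> u) \<circ> (\<lambda>x. (fst x, L (snd x))))"
      by (rule continuous_map_compose[OF _ lc_smult[OF T]])
    then show "continuous_map (prod_topology euclidean ?P) T (L \<circ> (\<lambda>(c, u). c \<odot>\<^bsub>V\<^esub> u))"
      by (rule continuous_map_eq) (auto simp: top linear_between_smult[OF L])
    show "topspace (prod_topology euclidean ?P) \<subseteq> (\<lambda>(c, u). c \<odot>\<^bsub>V\<^esub> u) -` carrier V"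
      by (auto simp: top)
  qed
  have "\<exists>C W. openin ?P W \<and> \<zero>\<^bsub>V\<^esub> \<in> W \<and> W \<subseteq> C \<and> C \<subseteq> N \<and>
          (\<forall>u\<in>C. \<forall>v\<in>C. \<forall>t::real. 0 \<le> t \<and> t \<le> 1 \<longrightarrow>
             (complex_of_real (1 - t) \<odot>\<^bsub>V\<^esub> u) \<oplus>\<^bsub>V\<^esub> (complex_of_real t \<odot>\<^bsub>V\<^esub> v) \<in> C)"
    if N: "openin ?P N" "\<zero>\<^bsub>V\<^esub> \<in> N" for N
  proof -
    obtain N' where N': "openin T N'" "N = L -` N' \<inter> carrier V"
      using N(1) by (auto simp: openin_pullback_topology)
    have "\<zero>\<^bsub>W\<^esub> \<in> N'"
      using N' N(2) linear_between_zero[OF V W L] by auto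
    then obtain C W' where C: "openin T W'" "\<zero>\<^bsub>W\<^esub> \<in> W'" "W' \<subseteq> C" "C \<subseteq> N'"
      and conv: "\<And>u v t. u \<in> C \<Longrightarrow> v \<in> C \<Longrightarrow> 0 \<le> t \<and> t \<le> (1::real) \<Longrightarrow>
             (complex_of_real (1 - t) \<odot>\<^bsub>W\<^esub> u) \<oplus>\<^bsub>W\<^esub> (complex_of_real t \<odot>\<^bsub>W\<^esub> v) \<in> C"
      using T N'(1) unfolding lc_topology_def by meson
    show ?thesis
    proof (intro exI conjI ballI allI impI)
      show "openin ?P (L -` W' \<inter> carrier V)"
        using C(1) by (auto simp: openin_pullback_topology)
      show "\<zero>\<^bsub>V\<^esub> \<in> L -` W' \<inter> carrier V"
        using C(2) linear_between_zero[OF V W L] by auto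
      show "L -` W' \<inter> carrier V \<subseteq> L -` C \<inter> carrier V" "L -` C \<inter> carrier V \<subseteq> N"
        using C N' by auto
      fix u v t assume "u \<in> L -` C \<inter> carrier V" "v \<in> L -` C \<inter> carrier V" "0 \<le> t \<and> t \<le> (1::real)"
      then show "complex_of_real (1 - t) \<odot>\<^bsub>V\<^esub> u \<oplus>\<^bsub>V\<^esub> complex_of_real t \<odot>\<^bsub>V\<^esub> v \<in> L -` C \<inter> carrier V"
        using conv[of "L u" "L v" t] by (simp add: linear_between_add[OF L] linear_between_smult[OF L])
    qed
  qed
  then show ?thesis
    unfolding lc_topology_def using top add smult by blast
qed

section \<open>Final locally convex topologies\<close>

lemma openin_indiscrete: "openin (topology (\<lambda>A. A = {} \<or> A = S)) A \<longleftrightarrow> A = {} \<or> A = S"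
proof -
  have "istopology (\<lambda>A. A = {} \<or> A = S)"
    unfolding istopology_def by (auto; blast)
  then show ?thesis by (simp add: topology_inverse')
qed

lemma topspace_indiscrete: "topspace (topology (\<lambda>A. A = {} \<or> A = S)) = S"
  unfolding topspace_def openin_indiscrete by auto

lemma continuous_map_indiscrete:
  assumes "f ` topspace Y \<subseteq> S"
  shows "continuous_map Y (topology (\<lambda>A. A = {} \<or> A = S)) f"
proof -
  have "{x \<in> topspace Y. f x \<in> S} = topspace Y"
    using assms by auto
  then show ?thesis
    unfolding continuous_map_def topspace_indiscrete openin_indiscrete using assms by (auto simp: Pi_iff)
qed

text \<open>The indiscrete topology makes every map into \<open>carrier V\<close> continuous, so it
  always takes part in the supremum defining \<open>final_lc_topology\<close>; it guarantees that
  the generating sets cover the whole carrier.\<close>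

lemma lc_indiscrete:
  assumes "module complex_ring V"
  shows "lc_topology V (topology (\<lambda>A. A = {} \<or> A = carrier V))"
proof -
  interpret V: module complex_ring V by fact
  show ?thesis
    unfolding lc_topology_def topspace_indiscrete openin_indiscrete
    by (intro conjI continuous_map_indiscrete allI impI exI[of _ "carrier V"]) (auto simp: topspace_indiscrete)
qed

lemma topspace_final_lc:
  assumes "module complex_ring V"
    and "\<And>S j. (S, j) \<in> J \<Longrightarrow> j ` topspace S \<subseteq> carrier V"
  shows "topspace (final_lc_topology V J) = carrier V"
proof -
  let ?T = "topology (\<lambda>A. A = {} \<or> A = carrier V)"
  have "continuous_map S ?T j" if "(S, j) \<in> J" for S j
    by (rule continuous_map_indiscrete[OF assms(2)[OF that]])
  then have "carrier V \<in> {W. \<exists>T. lc_topology V T \<and> (\<forall>(S, j)\<in>J. continuous_map S T j) \<and> openin T W}"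
    using lc_indiscrete[OF assms(1)] openin_indiscrete[of "carrier V" "carrier V"] by blast
  moreover have "\<Union>{W. \<exists>T. lc_topology V T \<and> (\<forall>(S, j)\<in>J. continuous_map S T j) \<and> openin T W}
      \<subseteq> carrier V"
    using lc_topspace openin_subset by fastforce
  ultimately show ?thesis
    unfolding final_lc_topology_def topology_generated_by_topspace by blast
qed

text \<open>A generating set is open in some topology \<open>T\<close> for which \<open>j\<close> is
  continuous, so its preimage is open; continuity has only to be tested on generators.\<close>

lemma continuous_map_into_final_lc:
  assumes "module complex_ring V"
    and J: "\<And>S j. (S, j) \<in> J \<Longrightarrow> j ` topspace S \<subseteq> carrier V"
    and "(S, j) \<in> J"
  shows "continuous_map S (final_lc_topology V J) j"
proof -
  have UB: "\<Union>{W. \<exists>T. lc_topology V T \<and> (\<forall>(S, j)\<in>J. continuous_map S T j) \<and> openin T W} = carrier V"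
    using topspace_final_lc[OF assms(1,2)]
    unfolding final_lc_topology_def topology_generated_by_topspace .
  show ?thesis
    unfolding final_lc_topology_def
  proof (rule continuous_on_generated_topo)
    fix A assume "A \<in> {W. \<exists>T. lc_topology V T \<and> (\<forall>(S, j)\<in>J. continuous_map S T j) \<and> openin T W}"
    then obtain T where "continuous_map S T j" "openin T A"
      using assms(3) by blast
    then show "openin S (j -` A \<inter> topspace S)"
      by (simp add: continuous_map_alt)
  qed (use J[OF assms(3)] UB in simp)
qed

text \<open>Open sets of a competing topology are themselves generators. This maximality is what
  later makes the sum map open.\<close>

lemma continuous_map_final_lc_finer:
  assumes "lc_topology V T" "\<And>S j. (S, j) \<in> J \<Longrightarrow> continuous_map S T j"
  shows "openin T A \<Longrightarrow> openin (final_lc_topology V J) A"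
  unfolding final_lc_topology_def
  using assms by (intro topology_generated_by_Basis) blast

text \<open>The pullback of \<open>T\<close> along \<open>L\<close> is locally convex and, by
  \<open>cont\<close>, makes every \<open>j\<close> continuous; hence it is coarser than the final
  topology.\<close>

lemma continuous_map_from_final_lc:
  assumes V: "module complex_ring V" and W: "module complex_ring W"
    and L: "linear_between V W L" and T: "lc_topology W T"
    and J: "\<And>S j. (S, j) \<in> J \<Longrightarrow> j ` topspace S \<subseteq> carrier V"
    and cont: "\<And>S j. (S, j) \<in> J \<Longrightarrow> continuous_map S T (L \<circ> j)"
  shows "continuous_map (final_lc_topology V J) T L"
proof -
  let ?P = "pullback_topology (carrier V) L T"
  have "continuous_map S ?P j" if "(S, j) \<in> J" for S j
    using cont[OF that] J[OF that] by (intro continuous_map_pullback') auto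
  then have fin: "openin ?P A \<Longrightarrow> openin (final_lc_topology V J) A" for A
    using continuous_map_final_lc_finer[OF lc_pullback[OF V W L T]] by blast
  show ?thesis
    unfolding continuous_map_alt
  proof (intro conjI allI impI)
    fix O' assume "openin T O'"
    then have "openin ?P (L -` O' \<inter> carrier V)"
      by (auto simp: openin_pullback_topology)
    then show "openin (final_lc_topology V J) (L -` O' \<inter> topspace (final_lc_topology V J))"
      using fin topspace_final_lc[OF V J] by simp
  next
    show "L \<in> topspace (final_lc_topology V J) \<rightarrow> topspace T"
      using topspace_final_lc[OF V J] linear_between_closed[OF L] lc_topspace[OF T] by auto
  qed
qed

lemma prod_topology_mono:
  assumes "topspace S = topspace S'" "topspace T = topspace T'"
    and S: "\<And>A. openin S A \<Longrightarrow> openin S' A" and T: "\<And>A. openin T A \<Longrightarrow> openin T' A"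
    and "openin (prod_topology S T) Y"
  shows "openin (prod_topology S' T') Y"
  using assms unfolding openin_prod_topology_alt by meson

text \<open>The operations are tested on generators, and each generator comes from one competing
  topology, coarser than \<open>?F\<close>. Convex neighbourhoods survive because finite
  intersections of convex sets are convex.\<close>

lemma lc_final:
  assumes V: "module complex_ring V"
    and J: "\<And>S j. (S, j) \<in> J \<Longrightarrow> j ` topspace S \<subseteq> carrier V"
  shows "lc_topology V (final_lc_topology V J)" (is "lc_topology V ?F")
proof -
  interpret V: module complex_ring V by fact
  let ?B = "{W. \<exists>T. lc_topology V T \<and> (\<forall>(S, j)\<in>J. continuous_map S T j) \<and> openin T W}"
  have top: "topspace ?F = carrier V"
    using V J by (rule topspace_final_lc)
  have UB: "\<Union>?B = carrier V"
    using top unfolding final_lc_topology_def topology_generated_by_topspace .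
  have contF: "continuous_map S ?F f"
    if "f ` topspace S \<subseteq> carrier V" "\<And>A. A \<in> ?B \<Longrightarrow> openin S (f -` A \<inter> topspace S)"
    for S :: "'s topology" and f
    unfolding final_lc_topology_def using that UB by (intro continuous_on_generated_topo) simp_all
  have finer: "openin ?F A"
    if "lc_topology V T" "\<forall>(S, j)\<in>J. continuous_map S T j" "openin T A" for T A
    using that by (intro continuous_map_final_lc_finer[of V T]) auto
  have add: "continuous_map (prod_topology ?F ?F) ?F (\<lambda>(u, v). u \<oplus>\<^bsub>V\<^esub> v)"
  proof (rule contF)
    show "(\<lambda>(u, v). u \<oplus>\<^bsub>V\<^esub> v) ` topspace (prod_topology ?F ?F) \<subseteq> carrier V"
      by (auto simp: top)
    fix A assume "A \<in> ?B"
    then obtain T where T: "lc_topology V T" "\<forall>(S, j)\<in>J. continuous_map S T j" "openin T A" by blast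
    then have "openin (prod_topology T T) ((\<lambda>(u, v). u \<oplus>\<^bsub>V\<^esub> v) -` A \<inter> topspace (prod_topology T T))"
      using lc_add[OF T(1)] by (simp add: continuous_map_alt)
    \<comment> \<open>Replacing \<open>T\<close> by the finer \<open>?F\<close> in both factors
      enlarges the product topology.\<close>
    then have "openin (prod_topology ?F ?F) ((\<lambda>(u, v). u \<oplus>\<^bsub>V\<^esub> v) -` A \<inter> topspace (prod_topology T T))"
      by (rule prod_topology_mono[of T ?F T ?F, rotated 4])
        (use T finer[OF T(1,2)] in \<open>simp_all add: top lc_topspace\<close>)
    then show "openin (prod_topology ?F ?F) ((\<lambda>(u, v). u \<oplus>\<^bsub>V\<^esub> v) -` A \<inter> topspace (prod_topology ?F ?F))"
      using T by (simp add: top lc_topspace)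
  qed
  have smult: "continuous_map (prod_topology euclidean ?F) ?F (\<lambda>(c, u). c \<odot>\<^bsub>V\<^esub> u)"
  proof (rule contF)
    show "(\<lambda>(c, u). c \<odot>\<^bsub>V\<^esub> u) ` topspace (prod_topology euclidean ?F) \<subseteq> carrier V"
      by (auto simp: top)
    fix A assume "A \<in> ?B"
    then obtain T where T: "lc_topology V T" "\<forall>(S, j)\<in>J. continuous_map S T j" "openin T A" by blast
    then have "openin (prod_topology euclidean T)
        ((\<lambda>(c, u). c \<odot>\<^bsub>V\<^esub> u) -` A \<inter> topspace (prod_topology euclidean T))"
      using lc_smult[OF T(1)] by (simp add: continuous_map_alt)
    then have "openin (prod_topology euclidean ?F)
        ((\<lambda>(c, u). c \<odot>\<^bsub>V\<^esub> u) -` A \<inter> topspace (prod_topology euclidean T))"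
      by (rule prod_topology_mono[of euclidean euclidean T ?F, rotated 4])
        (use T finer[OF T(1,2)] in \<open>simp_all add: top lc_topspace\<close>)
    then show "openin (prod_topology euclidean ?F)
        ((\<lambda>(c, u). c \<odot>\<^bsub>V\<^esub> u) -` A \<inter> topspace (prod_topology euclidean ?F))"
      using T by (simp add: top lc_topspace)
  qed
  \<comment> \<open>Convexity is carried by an intermediate set, as in \<open>lc_topology\<close>.
    The induction below runs over generators, intersections and unions; for a union one member
    containing zero suffices.\<close>
  define conv where "conv C \<longleftrightarrow> (\<forall>u\<in>C. \<forall>v\<in>C. \<forall>t::real. 0 \<le> t \<and> t \<le> 1 \<longrightarrow>
      (complex_of_real (1 - t) \<odot>\<^bsub>V\<^esub> u) \<oplus>\<^bsub>V\<^esub> (complex_of_real t \<odot>\<^bsub>V\<^esub> v) \<in> C)" for C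
  have conv_Int: "conv (C \<inter> C')" if "conv C" "conv C'" for C C'
    using that unfolding conv_def by blast
  have "\<zero>\<^bsub>V\<^esub> \<in> N \<Longrightarrow> \<exists>C W. openin ?F W \<and> \<zero>\<^bsub>V\<^esub> \<in> W \<and> W \<subseteq> C \<and> C \<subseteq> N \<and> conv C"
    if "generate_topology_on ?B N" for N
    using that
  proof induction
    case (Int a b)
    then have "\<zero>\<^bsub>V\<^esub> \<in> a" "\<zero>\<^bsub>V\<^esub> \<in> b" by auto
    from Int.IH(1)[OF this(1)] Int.IH(2)[OF this(2)]
    obtain C W C' W' where C: "openin ?F W" "\<zero>\<^bsub>V\<^esub> \<in> W" "W \<subseteq> C" "C \<subseteq> a" "conv C"
      and C': "openin ?F W'" "\<zero>\<^bsub>V\<^esub> \<in> W'" "W' \<subseteq> C'" "C' \<subseteq> b" "conv C'" by metis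
    have "openin ?F (W \<inter> W')" "conv (C \<inter> C')" "\<zero>\<^bsub>V\<^esub> \<in> W \<inter> W'" "W \<inter> W' \<subseteq> C \<inter> C'" "C \<inter> C' \<subseteq> a \<inter> b"
      using C C' conv_Int by auto
    then show ?case by blast
  next
    case (UN K)
    then obtain k where "k \<in> K" "\<zero>\<^bsub>V\<^esub> \<in> k" by blast
    with UN.IH[of k] obtain C W where
      "openin ?F W" "\<zero>\<^bsub>V\<^esub> \<in> W" "W \<subseteq> C" "C \<subseteq> k" "conv C" by metis
    moreover have "C \<subseteq> \<Union>K"
      using \<open>k \<in> K\<close> \<open>C \<subseteq> k\<close> by blast
    ultimately show ?case by blast
  next
    case (Basis s)
    then obtain T where T: "lc_topology V T" "\<forall>(S, j)\<in>J. continuous_map S T j" "openin T s" by blast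
    then obtain C W where "openin T W" "\<zero>\<^bsub>V\<^esub> \<in> W" "W \<subseteq> C" "C \<subseteq> s" "conv C"
      using Basis.prems unfolding lc_topology_def conv_def by meson
    moreover have "openin ?F W"
      using finer[OF T(1,2)] \<open>openin T W\<close> .
    ultimately show ?case by blast
  qed simp
  note nbhd = this
  have "generate_topology_on ?B N" if "openin ?F N" for N
    using that unfolding final_lc_topology_def openin_topology_generated_by_iff .
  note nbhd' = nbhd[OF this]
  show ?thesis
    unfolding lc_topology_def
  proof (intro conjI allI impI)
    fix N assume "openin ?F N \<and> \<zero>\<^bsub>V\<^esub> \<in> N"
    then show "\<exists>C W. openin ?F W \<and> \<zero>\<^bsub>V\<^esub> \<in> W \<and> W \<subseteq> C \<and> C \<subseteq> N \<and>
        (\<forall>u\<in>C. \<forall>v\<in>C. \<forall>t::real. 0 \<le> t \<and> t \<le> 1 \<longrightarrow>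
          (complex_of_real (1 - t) \<odot>\<^bsub>V\<^esub> u) \<oplus>\<^bsub>V\<^esub> (complex_of_real t \<odot>\<^bsub>V\<^esub> v) \<in> C)"
      using nbhd'[of N, unfolded conv_def] by (elim conjE) assumption
  qed (rule top add smult)+
qed

text \<open>A product of quotient maps need not be a quotient map, whereas open continuous
  surjections are stable under products. This yields continuity of addition and scalar
  multiplication for an image topology.\<close>

lemma quotient_map_prod_open:
  assumes f: "continuous_map S S' f" "open_map S S' f" "f ` topspace S = topspace S'"
    and g: "continuous_map T T' g" "open_map T T' g" "g ` topspace T = topspace T'"
  shows "quotient_map (prod_topology S T) (prod_topology S' T') (\<lambda>(x, y). (f x, g y))"
proof (rule continuous_open_imp_quotient_map)
  show "continuous_map (prod_topology S T) (prod_topology S' T') (\<lambda>(x, y). (f x, g y))"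
    unfolding case_prod_beta
    by (intro continuous_map_pairedI
        continuous_map_compose[OF continuous_map_fst f(1), unfolded comp_def]
        continuous_map_compose[OF continuous_map_snd g(1), unfolded comp_def])
  show "open_map (prod_topology S T) (prod_topology S' T') (\<lambda>(x, y). (f x, g y))"
    unfolding open_map_def
  proof (intro allI impI)
    fix Z assume Z: "openin (prod_topology S T) Z"
    show "openin (prod_topology S' T') ((\<lambda>(x, y). (f x, g y)) ` Z)"
      unfolding openin_prod_topology_alt
    proof (intro allI impI)
      fix x' y' assume "(x', y') \<in> (\<lambda>(x, y). (f x, g y)) ` Z"
      then obtain x y where xy: "(x, y) \<in> Z" "x' = f x" "y' = g y" by auto
      then obtain A B where AB: "openin S A" "openin T B" "x \<in> A" "y \<in> B" "A \<times> B \<subseteq> Z"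
        using Z unfolding openin_prod_topology_alt by meson
      have "f ` A \<times> g ` B \<subseteq> (\<lambda>(x, y). (f x, g y)) ` Z"
        using AB(5) by force
      moreover have "openin S' (f ` A)" "openin T' (g ` B)"
        using f(2) g(2) AB(1,2) by (auto simp: open_map_def)
      ultimately show "\<exists>A' B'. openin S' A' \<and> openin T' B' \<and> x' \<in> A' \<and> y' \<in> B' \<and>
          A' \<times> B' \<subseteq> (\<lambda>(x, y). (f x, g y)) ` Z"
        using AB(3,4) xy(2,3) by blast
    qed
  qed
  have "(\<lambda>(x, y). (f x, g y)) ` (topspace S \<times> topspace T) = f ` topspace S \<times> g ` topspace T"
    by force
  then show "(\<lambda>(x, y). (f x, g y)) ` topspace (prod_topology S T) = topspace (prod_topology S' T')"
    using f(3) g(3) by simp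
qed

text \<open>The target gets the quotient topology. \<open>L\<close> is open because the saturation
  of an open set \<open>A\<close> is the union of its translates by the kernel; openness then lets
  the vector space operations and the convex neighbourhoods descend.\<close>

lemma lc_image_topology:
  assumes V: "module complex_ring V" and W: "module complex_ring W"
    and L: "linear_between V W L" and surj: "L ` carrier V = carrier W" and T: "lc_topology V T"
  obtains T' where "lc_topology W T'" "continuous_map T T' L" "open_map T T' L"
proof -
  interpret V: module complex_ring V by fact
  interpret W: module complex_ring W by fact
  have top: "topspace T = carrier V" by (rule lc_topspace[OF T])
  have cl: "\<And>u. u \<in> carrier V \<Longrightarrow> L u \<in> carrier W"
    using L by (rule linear_between_closed)
  let ?o = "\<lambda>B. B \<subseteq> carrier W \<and> openin T (L -` B \<inter> carrier V)"
  define T' where "T' = topology ?o"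
  have "istopology ?o"
    unfolding istopology_def
  proof (intro conjI allI impI)
    fix A B assume "?o A" "?o B"
    moreover have "L -` (A \<inter> B) \<inter> carrier V = (L -` A \<inter> carrier V) \<inter> (L -` B \<inter> carrier V)" by auto
    ultimately show "A \<inter> B \<subseteq> carrier W" "openin T (L -` (A \<inter> B) \<inter> carrier V)"
      by (auto simp del: vimage_Int)
  next
    fix \<K> assume *: "\<forall>K\<in>\<K>. ?o K"
    then show "\<Union>\<K> \<subseteq> carrier W" by auto
    have eq: "L -` (\<Union>\<K>) \<inter> carrier V = (\<Union>K\<in>\<K>. L -` K \<inter> carrier V)" by auto
    show "openin T (L -` (\<Union>\<K>) \<inter> carrier V)" unfolding eq using * by (intro openin_Union) blast
  qed
  then have op: "openin T' B \<longleftrightarrow> ?o B" for B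
    unfolding T'_def by (simp add: topology_inverse')
  have "L -` carrier W \<inter> carrier V = topspace T" using cl top by auto
  then have "openin T' (carrier W)" using op by auto
  then have top': "topspace T' = carrier W"
    using op openin_subset by (metis openin_topspace subset_antisym)
  have contL: "continuous_map T T' L"
    unfolding continuous_map_alt top top' using op cl by auto
  have openL: "openin T' (L ` A)" if A: "openin T A" for A
  proof -
    have Asub: "A \<subseteq> carrier V" using openin_subset[OF A] top by simp
    \<comment> \<open>Saturation of \<open>A\<close>: if \<open>L v = L a\<close> then adding the
      kernel element \<open>?k\<close>, which is \<open>a\<close> minus \<open>v\<close>, moves
      \<open>v\<close> into \<open>A\<close>. In this form openness follows from continuity of
      translations.\<close>
    have eq: "L -` (L ` A) \<inter> carrier V =
      (\<Union>k\<in>{k \<in> carrier V. L k = \<zero>\<^bsub>W\<^esub>}. {v \<in> topspace T. v \<oplus>\<^bsub>V\<^esub> k \<in> A})" (is "?l = ?r")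
    proof (intro equalityI subsetI)
      fix v assume "v \<in> ?l"
      then obtain a where a: "a \<in> A" "L v = L a" "v \<in> carrier V" by auto
      let ?k = "(-1) \<odot>\<^bsub>V\<^esub> v \<oplus>\<^bsub>V\<^esub> a"
      have av: "a \<in> carrier V" using a Asub by auto
      have m1: "(-1) \<odot>\<^bsub>V\<^esub> v = \<ominus>\<^bsub>V\<^esub> v"
        using V.smult_l_minus[of 1 v] V.smult_one[of v] a(3) by simp
      have "L ?k = (-1) \<odot>\<^bsub>W\<^esub> L a \<oplus>\<^bsub>W\<^esub> L a"
        using a av linear_between_add[OF L] linear_between_smult[OF L, of v "-1"] by simp
      also have "(-1) \<odot>\<^bsub>W\<^esub> L a = \<ominus>\<^bsub>W\<^esub> L a"
        using W.smult_l_minus[of 1 "L a"] W.smult_one[of "L a"] cl[OF av] by simp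
      finally have "L ?k = \<zero>\<^bsub>W\<^esub>" using cl[OF av] by (simp add: W.l_neg)
      moreover have "v \<oplus>\<^bsub>V\<^esub> ?k = a"
        unfolding m1 using a av by (metis V.add.inv_closed V.add.m_assoc V.l_zero V.r_neg)
      ultimately show "v \<in> ?r"
        using a av top by (intro UN_I[of ?k]) simp_all
    next
      fix v assume "v \<in> ?r"
      then obtain k where k: "k \<in> carrier V" "L k = \<zero>\<^bsub>W\<^esub>" "v \<in> carrier V" "v \<oplus>\<^bsub>V\<^esub> k \<in> A"
        using top by auto
      then have "L (v \<oplus>\<^bsub>V\<^esub> k) = L v"
        using linear_between_add[OF L] cl by simp
      with k have "L v \<in> L ` A" by (metis imageI)
      with k show "v \<in> ?l" by simp
    qed
    have "openin T {v \<in> topspace T. v \<oplus>\<^bsub>V\<^esub> k \<in> A}" if "k \<in> carrier V" for k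
    proof -
      have "continuous_map T T (\<lambda>v. v \<oplus>\<^bsub>V\<^esub> k)"
        using lc_continuous_add[OF T, of T "\<lambda>v. v" "\<lambda>v. k"] that top by simp
      then show ?thesis
        using A by (rule openin_continuous_map_preimage)
    qed
    then have "openin T ?r"
      by (blast intro: openin_Union)
    then have "openin T ?l" unfolding eq .
    moreover have "L ` A \<subseteq> carrier W"
      using Asub cl by blast
    ultimately show ?thesis
      by (intro op[THEN iffD2] conjI)
  qed
  have LT: "continuous_map T T' L" "open_map T T' L" "L ` topspace T = topspace T'"
    using contL openL surj by (simp_all add: open_map_def top top')
  have add: "continuous_map (prod_topology T' T') T' (\<lambda>(u, v). u \<oplus>\<^bsub>W\<^esub> v)"
  proof (rule continuous_compose_quotient_map[OF quotient_map_prod_open[OF LT LT]])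
    show "continuous_map (prod_topology T T) T' ((\<lambda>(u, v). u \<oplus>\<^bsub>W\<^esub> v) \<circ> (\<lambda>(u, v). (L u, L v)))"
      by (rule continuous_map_eq[OF continuous_map_compose[OF lc_add[OF T] contL]])
        (auto simp: top linear_between_add[OF L])
  qed
  have id: "continuous_map euclidean euclidean (\<lambda>c::complex. c)" "open_map euclidean euclidean (\<lambda>c::complex. c)"
    "(\<lambda>c::complex. c) ` topspace euclidean = topspace euclidean"
    by (simp_all add: open_map_def)
  have smult: "continuous_map (prod_topology euclidean T') T' (\<lambda>(c, u). c \<odot>\<^bsub>W\<^esub> u)"
  proof (rule continuous_compose_quotient_map[OF quotient_map_prod_open[OF id LT]])
    show "continuous_map (prod_topology euclidean T) T' ((\<lambda>(c, u). c \<odot>\<^bsub>W\<^esub> u) \<circ> (\<lambda>(c, u). (c, L u)))"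
      by (rule continuous_map_eq[OF continuous_map_compose[OF lc_smult[OF T] contL]])
        (auto simp: top linear_between_smult[OF L])
  qed
  have "\<exists>C N'. openin T' N' \<and> \<zero>\<^bsub>W\<^esub> \<in> N' \<and> N' \<subseteq> C \<and> C \<subseteq> N \<and>
          (\<forall>u\<in>C. \<forall>v\<in>C. \<forall>t::real. 0 \<le> t \<and> t \<le> 1 \<longrightarrow>
             (complex_of_real (1 - t) \<odot>\<^bsub>W\<^esub> u) \<oplus>\<^bsub>W\<^esub> (complex_of_real t \<odot>\<^bsub>W\<^esub> v) \<in> C)"
    if N: "openin T' N" "\<zero>\<^bsub>W\<^esub> \<in> N" for N
  proof -
    have "openin T (L -` N \<inter> carrier V)" "\<zero>\<^bsub>V\<^esub> \<in> L -` N \<inter> carrier V"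
      using N op linear_between_zero[OF V W L] by auto
    then obtain C N' where C: "openin T N'" "\<zero>\<^bsub>V\<^esub> \<in> N'" "N' \<subseteq> C" "C \<subseteq> L -` N \<inter> carrier V"
      and conv: "\<And>u v t. u \<in> C \<Longrightarrow> v \<in> C \<Longrightarrow> 0 \<le> t \<and> t \<le> (1::real) \<Longrightarrow>
             (complex_of_real (1 - t) \<odot>\<^bsub>V\<^esub> u) \<oplus>\<^bsub>V\<^esub> (complex_of_real t \<odot>\<^bsub>V\<^esub> v) \<in> C"
      using T unfolding lc_topology_def by meson
    show ?thesis
    proof (intro exI conjI ballI allI impI)
      show "openin T' (L ` N')" using C openL by blast
      show "\<zero>\<^bsub>W\<^esub> \<in> L ` N'" using C(2) linear_between_zero[OF V W L] by force
      show "L ` N' \<subseteq> L ` C" "L ` C \<subseteq> N" using C by auto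
      fix u v t assume "u \<in> L ` C" "v \<in> L ` C" and t: "0 \<le> t \<and> t \<le> (1::real)"
      then obtain u' v' where uv: "u' \<in> C" "u = L u'" "v' \<in> C" "v = L v'" by auto
      then have "L ((complex_of_real (1 - t) \<odot>\<^bsub>V\<^esub> u') \<oplus>\<^bsub>V\<^esub> (complex_of_real t \<odot>\<^bsub>V\<^esub> v')) \<in> L ` C"
        using conv t by blast
      moreover have "u' \<in> carrier V" "v' \<in> carrier V" using uv C(4) by auto
      ultimately show "complex_of_real (1 - t) \<odot>\<^bsub>W\<^esub> u \<oplus>\<^bsub>W\<^esub> complex_of_real t \<odot>\<^bsub>W\<^esub> v \<in> L ` C"
        using uv by (simp add: linear_between_add[OF L] linear_between_smult[OF L])
    qed
  qed
  note nbhd = this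
  have "lc_topology W T'"
    unfolding lc_topology_def
  proof (intro conjI allI impI)
    fix N assume "openin T' N \<and> \<zero>\<^bsub>W\<^esub> \<in> N"
    then show "\<exists>C N'. openin T' N' \<and> \<zero>\<^bsub>W\<^esub> \<in> N' \<and> N' \<subseteq> C \<and> C \<subseteq> N \<and>
          (\<forall>u\<in>C. \<forall>v\<in>C. \<forall>t::real. 0 \<le> t \<and> t \<le> 1 \<longrightarrow>
             (complex_of_real (1 - t) \<odot>\<^bsub>W\<^esub> u) \<oplus>\<^bsub>W\<^esub> (complex_of_real t \<odot>\<^bsub>W\<^esub> v) \<in> C)"
      by (elim conjE) (rule nbhd)
  qed (rule top' add smult)+
  then show ?thesis
    using that contL openL by (auto simp: open_map_def)
qed

section \<open>Sheaves of modules\<close>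

lemma abelian_group_cong:
  assumes "abelian_group A" "carrier B = carrier A" "add B = add A" "zero B = zero A"
  shows "abelian_group B"
proof -
  interpret A: abelian_group A by fact
  show ?thesis
    by (rule abelian_groupI; unfold assms(2-4))
      (auto simp: A.a_ac intro: A.l_neg bexI[of _ "\<ominus>\<^bsub>A\<^esub> _"])
qed

text \<open>\<open>a_inv\<close> is a description that mentions only carrier, addition and zero, so
  changing the scalars as \<open>sections_vs\<close> does leaves subtraction unchanged.\<close>

lemma a_minus_cong:
  assumes "carrier B = carrier A" "add B = add A" "zero B = zero A"
  shows "a_minus B = a_minus A"
  by (intro ext) (simp add: a_minus_def a_inv_def m_inv_def assms)

text \<open>Used to obtain preservation of zero from additivity alone.\<close>

lemma (in abelian_group) add_idem_zero:
  "x \<in> carrier G \<Longrightarrow> x = x \<oplus> x \<Longrightarrow> x = \<zero>"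
  by (metis r_neg add.inv_closed add.m_assoc r_zero)

context set_sheaf
begin

text \<open>The uniqueness half of \<open>glue\<close>, applied to the family of restrictions of
  \<open>s\<close>: both \<open>s\<close> and \<open>t\<close> glue this family.\<close>

lemma locality:
  assumes op: "\<And>V. V \<in> \<V> \<Longrightarrow> openin M V"
    and s: "s \<in> carrier (sections S (\<Union>\<V>))" and t: "t \<in> carrier (sections S (\<Union>\<V>))"
    and eq: "\<And>V. V \<in> \<V> \<Longrightarrow> restr S (\<Union>\<V>) V s = restr S (\<Union>\<V>) V t"
  shows "s = t"
proof -
  have op': "openin M (\<Union>\<V>)" using op by blast
  have "\<exists>!r. r \<in> carrier (sections S (\<Union>\<V>)) \<and> (\<forall>V\<in>\<V>. restr S (\<Union>\<V>) V r = restr S (\<Union>\<V>) V s)"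
  proof (rule glue)
    fix V W assume "V \<in> \<V>" "W \<in> \<V>"
    then have *: "openin M V" "openin M W" "V \<subseteq> \<Union>\<V>" "W \<subseteq> \<Union>\<V>"
      using op by auto
    have "restr S V (V \<inter> W) (restr S (\<Union>\<V>) V s) = restr S (\<Union>\<V>) (V \<inter> W) s"
      by (rule restr_restr) (use * op' s in auto)
    moreover have "restr S W (V \<inter> W) (restr S (\<Union>\<V>) W s) = restr S (\<Union>\<V>) (V \<inter> W) s"
      by (rule restr_restr) (use * op' s in auto)
    ultimately show "restr S V (V \<inter> W) (restr S (\<Union>\<V>) V s) = restr S W (V \<inter> W) (restr S (\<Union>\<V>) W s)"
      by simp
  next
    fix V assume "V \<in> \<V>"
    then show "restr S (\<Union>\<V>) V s \<in> carrier (sections S V)"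
      by (intro restr_closed[OF op' op _ s]) auto
  qed (use op in auto)
  then show ?thesis
    using s t eq by metis
qed

lemma locality2:
  assumes "openin M U" "openin M V" "U \<union> V = W"
    and "s \<in> carrier (sections S W)" "t \<in> carrier (sections S W)"
    and "restr S W U s = restr S W U t" "restr S W V s = restr S W V t"
  shows "s = t"
  by (rule locality[of "{U, V}"]) (use assms in auto)

lemma glue2:
  assumes U: "openin M U" and V: "openin M V" and W: "U \<union> V = W"
    and s: "s \<in> carrier (sections S U)" and t: "t \<in> carrier (sections S V)"
    and eq: "restr S U (U \<inter> V) s = restr S V (U \<inter> V) t"
  obtains r where "r \<in> carrier (sections S W)" "restr S W U r = s" "restr S W V r = t"
proof -
  \<comment> \<open>\<open>glue\<close> indexes the sections by the open sets themselves, so the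
    degenerate case \<open>U = V\<close> must be consistent; there \<open>s = t\<close> by
    \<open>st\<close>.\<close>
  let ?\<sigma> = "\<lambda>Z. if Z = U then s else t"
  have st: "U = V \<Longrightarrow> s = t"
    using eq U V s t by (simp add: restr_self)
  have "\<exists>!r. r \<in> carrier (sections S (\<Union>{U, V})) \<and> (\<forall>Z\<in>{U, V}. restr S (\<Union>{U, V}) Z r = ?\<sigma> Z)"
    by (rule glue) (use U V s t eq st in \<open>auto simp: Int_commute\<close>)
  then obtain r where "r \<in> carrier (sections S W)" "restr S W U r = s" "restr S W V r = (if V = U then s else t)"
    using W by auto
  then show ?thesis using that st by auto
qed

end

context algebra_sheaf
begin

lemma cring_sections: "openin M U \<Longrightarrow> cring (sections \<O> U)"
  by (rule algebra.M_cring[OF algebra_sections])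

lemma restr_add:
  "\<lbrakk>openin M U; openin M V; V \<subseteq> U; s \<in> carrier (sections \<O> U); t \<in> carrier (sections \<O> U)\<rbrakk>
    \<Longrightarrow> restr \<O> U V (s \<oplus>\<^bsub>sections \<O> U\<^esub> t) = restr \<O> U V s \<oplus>\<^bsub>sections \<O> V\<^esub> restr \<O> U V t"
  by (rule ring_hom_add[OF restr_ring_hom])

lemma restr_mult:
  "\<lbrakk>openin M U; openin M V; V \<subseteq> U; s \<in> carrier (sections \<O> U); t \<in> carrier (sections \<O> U)\<rbrakk>
    \<Longrightarrow> restr \<O> U V (s \<otimes>\<^bsub>sections \<O> U\<^esub> t) = restr \<O> U V s \<otimes>\<^bsub>sections \<O> V\<^esub> restr \<O> U V t"
  by (rule ring_hom_mult[OF restr_ring_hom])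

lemma restr_one:
  "\<lbrakk>openin M U; openin M V; V \<subseteq> U\<rbrakk> \<Longrightarrow> restr \<O> U V \<one>\<^bsub>sections \<O> U\<^esub> = \<one>\<^bsub>sections \<O> V\<^esub>"
  by (rule ring_hom_one[OF restr_ring_hom])

lemma restr_zero:
  "\<lbrakk>openin M U; openin M V; V \<subseteq> U\<rbrakk> \<Longrightarrow> restr \<O> U V \<zero>\<^bsub>sections \<O> U\<^esub> = \<zero>\<^bsub>sections \<O> V\<^esub>"
  by (rule ring_hom_zero[OF restr_ring_hom]) (auto intro: cring.axioms(1) cring_sections)

lemma restr_minus:
  assumes "openin M U" "openin M V" "V \<subseteq> U" "s \<in> carrier (sections \<O> U)" "t \<in> carrier (sections \<O> U)"
  shows "restr \<O> U V (s \<ominus>\<^bsub>sections \<O> U\<^esub> t) = restr \<O> U V s \<ominus>\<^bsub>sections \<O> V\<^esub> restr \<O> U V t"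
proof -
  interpret U: cring "sections \<O> U" using assms by (intro cring_sections)
  interpret V: cring "sections \<O> V" using assms by (intro cring_sections)
  interpret ring_hom_cring "sections \<O> U" "sections \<O> V" "restr \<O> U V"
    by unfold_locales (rule restr_ring_hom[OF assms(1-3)])
  show ?thesis using assms(4,5) by (simp add: a_minus_def)
qed

end

locale algebra_module_sheaf = algebra_sheaf M \<O> + F: module_sheaf M \<O> \<F>
  for M :: "'a topology" and \<O> :: "('a, complex, 'r) sheaf_data" and \<F> :: "('a, 'r, 'f) sheaf_data"
begin

abbreviation "vs U \<equiv> sections_vs \<O> \<F> U"

lemma vs_simps [simp]:
  "carrier (vs U) = carrier (sections \<F> U)" "add (vs U) = add (sections \<F> U)"
  "zero (vs U) = zero (sections \<F> U)"
  "c \<odot>\<^bsub>vs U\<^esub> u = (c \<odot>\<^bsub>sections \<O> U\<^esub> \<one>\<^bsub>sections \<O> U\<^esub>) \<odot>\<^bsub>sections \<F> U\<^esub> u"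
  by (simp_all add: sections_vs_def)

lemma a_minus_vs [simp]: "a_minus (vs U) = a_minus (sections \<F> U)"
  by (rule a_minus_cong) simp_all

lemma module_vs:
  assumes "openin M U"
  shows "module complex_ring (vs U)"
proof -
  interpret F: module "sections \<O> U" "sections \<F> U" using assms by (rule F.module_sections)
  interpret O: algebra complex_ring "sections \<O> U" using assms by (rule algebra_sections)
  have 1: "c \<odot>\<^bsub>sections \<O> U\<^esub> \<one>\<^bsub>sections \<O> U\<^esub> \<in> carrier (sections \<O> U)" for c
    by (rule O.smult_closed) auto
  show ?thesis
  proof (rule moduleI)
    show "abelian_group (vs U)"
      by (rule abelian_group_cong[OF F.abelian_group_axioms]) simp_all
    fix a b x y assume xy: "x \<in> carrier (vs U)" "y \<in> carrier (vs U)"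
    show "(a \<oplus>\<^bsub>complex_ring\<^esub> b) \<odot>\<^bsub>vs U\<^esub> x = a \<odot>\<^bsub>vs U\<^esub> x \<oplus>\<^bsub>vs U\<^esub> b \<odot>\<^bsub>vs U\<^esub> x"
      using O.smult_l_distr[of a b "\<one>\<^bsub>sections \<O> U\<^esub>"] F.smult_l_distr[OF 1[of a] 1[of b]] xy by simp
    show "a \<odot>\<^bsub>vs U\<^esub> (x \<oplus>\<^bsub>vs U\<^esub> y) = a \<odot>\<^bsub>vs U\<^esub> x \<oplus>\<^bsub>vs U\<^esub> a \<odot>\<^bsub>vs U\<^esub> y"
      using F.smult_r_distr[OF 1] xy by simp
    have "(a \<odot>\<^bsub>sections \<O> U\<^esub> \<one>\<^bsub>sections \<O> U\<^esub>) \<otimes>\<^bsub>sections \<O> U\<^esub> (b \<odot>\<^bsub>sections \<O> U\<^esub> \<one>\<^bsub>sections \<O> U\<^esub>)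
        = (a * b) \<odot>\<^bsub>sections \<O> U\<^esub> \<one>\<^bsub>sections \<O> U\<^esub>"
      using O.smult_assoc2[of a "\<one>\<^bsub>sections \<O> U\<^esub>", OF _ _ 1[of b]]
        O.smult_assoc1[of a b "\<one>\<^bsub>sections \<O> U\<^esub>"] 1 by simp
    then show "(a \<otimes>\<^bsub>complex_ring\<^esub> b) \<odot>\<^bsub>vs U\<^esub> x = a \<odot>\<^bsub>vs U\<^esub> (b \<odot>\<^bsub>vs U\<^esub> x)"
      using F.smult_assoc1[OF 1[of a] 1[of b], of x] xy by simp
  next
    fix x assume "x \<in> carrier (vs U)"
    then show "\<one>\<^bsub>complex_ring\<^esub> \<odot>\<^bsub>vs U\<^esub> x = x"
      using O.smult_one[of "\<one>\<^bsub>sections \<O> U\<^esub>"] by simp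
  qed (use 1 in \<open>auto intro: cring_from_type_algebra\<close>)
qed

lemma restr_zero_F:
  assumes "openin M U" "openin M V" "V \<subseteq> U"
  shows "restr \<F> U V \<zero>\<^bsub>sections \<F> U\<^esub> = \<zero>\<^bsub>sections \<F> V\<^esub>"
proof -
  interpret U: module "sections \<O> U" "sections \<F> U" using assms by (intro F.module_sections)
  interpret V: module "sections \<O> V" "sections \<F> V" using assms by (intro F.module_sections)
  have "restr \<F> U V \<zero>\<^bsub>sections \<F> U\<^esub>
      = restr \<F> U V \<zero>\<^bsub>sections \<F> U\<^esub> \<oplus>\<^bsub>sections \<F> V\<^esub> restr \<F> U V \<zero>\<^bsub>sections \<F> U\<^esub>"
    using F.restr_add[OF assms, of "\<zero>\<^bsub>sections \<F> U\<^esub>" "\<zero>\<^bsub>sections \<F> U\<^esub>"] by simp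
  then show ?thesis
    using F.restr_closed[OF assms] by (intro V.M.add_idem_zero) auto
qed

lemma restr_vs_smult:
  assumes "openin M U" "openin M V" "V \<subseteq> U" "u \<in> carrier (sections \<F> U)"
  shows "restr \<F> U V (c \<odot>\<^bsub>vs U\<^esub> u) = c \<odot>\<^bsub>vs V\<^esub> restr \<F> U V u"
proof -
  interpret O: algebra complex_ring "sections \<O> U" using assms by (intro algebra_sections)
  have "c \<odot>\<^bsub>sections \<O> U\<^esub> \<one>\<^bsub>sections \<O> U\<^esub> \<in> carrier (sections \<O> U)"
    by (rule O.smult_closed) auto
  then show ?thesis
    using assms by (simp add: F.restr_smult restr_scalar restr_one)
qed

lemma linear_restr:
  assumes "openin M U" "openin M V" "V \<subseteq> U"
  shows "linear_between (vs U) (vs V) (restr \<F> U V)"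
  unfolding linear_between_def
  using assms F.restr_closed[OF assms] F.restr_add[OF assms] restr_vs_smult[OF assms] by simp

lemma restr_minus_F:
  assumes "openin M U" "openin M V" "V \<subseteq> U" "u \<in> carrier (sections \<F> U)" "v \<in> carrier (sections \<F> U)"
  shows "restr \<F> U V (u \<ominus>\<^bsub>sections \<F> U\<^esub> v) = restr \<F> U V u \<ominus>\<^bsub>sections \<F> V\<^esub> restr \<F> U V v"
  using linear_between_minus[OF module_vs module_vs linear_restr[OF assms(1-3)]] assms by simp

text \<open>The multiplier keeps its own domain \<open>W\<close>, so a single \<open>f\<close> acts
  compatibly on the sections over all open \<open>V \<subseteq> W\<close>. This is also the form in
  which \<open>sheaf_commutator\<close> multiplies.\<close>

definition act :: "'a set \<Rightarrow> 'r \<Rightarrow> 'a set \<Rightarrow> 'f \<Rightarrow> 'f"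
  where "act W f V u = restr \<O> W V f \<odot>\<^bsub>sections \<F> V\<^esub> u"

lemma act_closed:
  assumes "openin M W" "openin M V" "V \<subseteq> W" "f \<in> carrier (sections \<O> W)" "u \<in> carrier (sections \<F> V)"
  shows "act W f V u \<in> carrier (sections \<F> V)"
proof -
  interpret V: module "sections \<O> V" "sections \<F> V" using assms by (intro F.module_sections)
  show ?thesis
    unfolding act_def using assms restr_closed by (intro V.smult_closed)
qed

lemma linear_act:
  assumes "openin M W" "openin M V" "V \<subseteq> W" "f \<in> carrier (sections \<O> W)"
  shows "linear_between (vs V) (vs V) (act W f V)"
proof -
  interpret V: module "sections \<O> V" "sections \<F> V" using assms by (intro F.module_sections)
  interpret O: algebra complex_ring "sections \<O> V" using assms by (intro algebra_sections)
  have f: "restr \<O> W V f \<in> carrier (sections \<O> V)"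
    using assms restr_closed by blast
  have c: "c \<odot>\<^bsub>sections \<O> V\<^esub> \<one>\<^bsub>sections \<O> V\<^esub> \<in> carrier (sections \<O> V)" for c
    by (rule O.smult_closed) auto
  have "act W f V (c \<odot>\<^bsub>vs V\<^esub> u) = c \<odot>\<^bsub>vs V\<^esub> act W f V u" if "u \<in> carrier (sections \<F> V)" for c u
    unfolding act_def vs_simps
    by (simp only: V.smult_assoc1[OF f c that, symmetric] V.smult_assoc1[OF c f that, symmetric]
        V.m_comm[OF f c])
  then show ?thesis
    unfolding linear_between_def using act_closed[OF assms] V.smult_r_distr[OF f] by (simp add: act_def)
qed

lemma act_restr:
  assumes "openin M W" "openin M V" "openin M V'" "V' \<subseteq> V" "V \<subseteq> W"
    and "f \<in> carrier (sections \<O> W)" "u \<in> carrier (sections \<F> V)"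
  shows "restr \<F> V V' (act W f V u) = act W f V' (restr \<F> V V' u)"
  unfolding act_def using assms
  by (simp add: F.restr_smult restr_closed restr_restr)

lemma act_add:
  assumes "openin M W" "openin M V" "V \<subseteq> W" "f \<in> carrier (sections \<O> W)" "g \<in> carrier (sections \<O> W)"
    and "u \<in> carrier (sections \<F> V)"
  shows "act W (f \<oplus>\<^bsub>sections \<O> W\<^esub> g) V u = act W f V u \<oplus>\<^bsub>sections \<F> V\<^esub> act W g V u"
proof -
  interpret V: module "sections \<O> V" "sections \<F> V" using assms by (intro F.module_sections)
  show ?thesis
    unfolding act_def using assms restr_closed
    by (simp add: restr_add V.smult_l_distr)
qed

lemma act_mult:
  assumes "openin M W" "openin M V" "V \<subseteq> W" "f \<in> carrier (sections \<O> W)" "g \<in> carrier (sections \<O> W)"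
    and "u \<in> carrier (sections \<F> V)"
  shows "act W (f \<otimes>\<^bsub>sections \<O> W\<^esub> g) V u = act W f V (act W g V u)"
proof -
  interpret V: module "sections \<O> V" "sections \<F> V" using assms by (intro F.module_sections)
  show ?thesis
    unfolding act_def using assms restr_closed
    by (simp add: restr_mult V.smult_assoc1)
qed

lemma act_on_zero:
  assumes "openin M W" "openin M V" "V \<subseteq> W" "f \<in> carrier (sections \<O> W)"
  shows "act W f V \<zero>\<^bsub>sections \<F> V\<^esub> = \<zero>\<^bsub>sections \<F> V\<^esub>"
proof -
  interpret V: module "sections \<O> V" "sections \<F> V" using assms by (intro F.module_sections)
  show ?thesis unfolding act_def using assms restr_closed by simp
qed

lemma act_zero:
  assumes "openin M V" "restr \<O> W V f = \<zero>\<^bsub>sections \<O> V\<^esub>" "u \<in> carrier (sections \<F> V)"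
  shows "act W f V u = \<zero>\<^bsub>sections \<F> V\<^esub>"
proof -
  interpret V: module "sections \<O> V" "sections \<F> V" using assms by (intro F.module_sections)
  show ?thesis unfolding act_def using assms by simp
qed

lemma act_one:
  assumes "openin M V" "restr \<O> W V f = \<one>\<^bsub>sections \<O> V\<^esub>" "u \<in> carrier (sections \<F> V)"
  shows "act W f V u = u"
proof -
  interpret V: module "sections \<O> V" "sections \<F> V" using assms by (intro F.module_sections)
  show ?thesis unfolding act_def using assms by simp
qed

text \<open>The support is the complement of a union of open sets on which \<open>u\<close>
  vanishes; locality turns vanishing on each of them into vanishing on \<open>U - K\<close>. The
  equation is far easier to transport along restrictions than the inclusion.\<close>

lemma sec_support_subset_iff:
  assumes U: "openin M U" and UK: "openin M (U - K)" and u: "u \<in> carrier (sections \<F> U)"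
  shows "sec_support M \<F> U u \<subseteq> K \<longleftrightarrow> restr \<F> U (U - K) u = \<zero>\<^bsub>sections \<F> (U - K)\<^esub>"
proof
  interpret module "sections \<O> (U - K)" "sections \<F> (U - K)" using UK by (intro F.module_sections)
  assume supp: "sec_support M \<F> U u \<subseteq> K"
  define \<V> where "\<V> = {V \<inter> (U - K) | V. openin M V \<and> V \<subseteq> U \<and> restr \<F> U V u = \<zero>\<^bsub>sections \<F> V\<^esub>}"
  have un: "\<Union>\<V> = U - K"
  proof (intro equalityI subsetI)
    fix x assume x: "x \<in> U - K"
    then have "x \<notin> sec_support M \<F> U u" using supp by blast
    then obtain V where "x \<in> V" "openin M V" "V \<subseteq> U" "restr \<F> U V u = \<zero>\<^bsub>sections \<F> V\<^esub>"
      using x unfolding sec_support_def by blast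
    then have "V \<inter> (U - K) \<in> \<V>" unfolding \<V>_def by blast
    then show "x \<in> \<Union>\<V>" using x \<open>x \<in> V\<close> by blast
  qed (auto simp: \<V>_def)
  show "restr \<F> U (U - K) u = \<zero>\<^bsub>sections \<F> (U - K)\<^esub>"
  proof (rule F.locality[of \<V>, unfolded un])
    fix Z assume "Z \<in> \<V>"
    then obtain V where V: "Z = V \<inter> (U - K)" "openin M V" "V \<subseteq> U" "restr \<F> U V u = \<zero>\<^bsub>sections \<F> V\<^esub>"
      unfolding \<V>_def by blast
    then show Z: "openin M Z" using UK by blast
    have "restr \<F> (U - K) Z (restr \<F> U (U - K) u) = restr \<F> V Z (restr \<F> U V u)"
      using V Z UK U u by (subst (1 2) F.restr_restr) auto
    also have "\<dots> = \<zero>\<^bsub>sections \<F> Z\<^esub>"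
      using V Z by (simp add: restr_zero_F)
    also have "\<dots> = restr \<F> (U - K) Z \<zero>\<^bsub>sections \<F> (U - K)\<^esub>"
      using V(1) Z UK by (subst restr_zero_F) auto
    finally show "restr \<F> (U - K) Z (restr \<F> U (U - K) u) = restr \<F> (U - K) Z \<zero>\<^bsub>sections \<F> (U - K)\<^esub>" .
  qed (use F.restr_closed[OF U UK _ u] in auto)
next
  assume "restr \<F> U (U - K) u = \<zero>\<^bsub>sections \<F> (U - K)\<^esub>"
  then show "sec_support M \<F> U u \<subseteq> K"
    unfolding sec_support_def using UK by blast
qed

lemma openin_minus_sec_support: "openin M U \<Longrightarrow> openin M (U - sec_support M \<F> U u)"
proof -
  assume U: "openin M U"
  have "U - sec_support M \<F> U u = \<Union>{V. openin M V \<and> V \<subseteq> U \<and> restr \<F> U V u = \<zero>\<^bsub>sections \<F> V\<^esub>}"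
    unfolding sec_support_def by blast
  then show ?thesis by auto
qed

end

section \<open>Compactly supported sections\<close>

lemma (in abelian_group) abelian_group_restrict_carrier:
  assumes B: "carrier B \<subseteq> carrier G" "add B = add G" "zero B = zero G"
    and "\<zero> \<in> carrier B"
    and "\<And>x y. x \<in> carrier B \<Longrightarrow> y \<in> carrier B \<Longrightarrow> x \<oplus> y \<in> carrier B"
    and "\<And>x. x \<in> carrier B \<Longrightarrow> \<ominus> x \<in> carrier B"
  shows "abelian_group B"
proof (rule abelian_groupI; unfold B(2,3))
  show "\<And>x. x \<in> carrier B \<Longrightarrow> \<exists>y\<in>carrier B. y \<oplus> x = \<zero>"
    using assms by (meson l_neg subsetD)
qed (use assms in \<open>auto simp: a_ac subset_iff\<close>)

locale formal_module_sheaf = formal_manifold M \<O> + F: module_sheaf M \<O> \<F>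
  for M :: "'a topology" and \<O> :: "('a, complex, 'r) sheaf_data" and \<F> :: "('a, 'r, 'f) sheaf_data"
begin

sublocale algebra_module_sheaf M \<O> \<F> ..

abbreviation "A \<equiv> topspace M"
abbreviation "supp_in \<equiv> sections_supp_in M \<F>"
abbreviation "ext0 \<equiv> ext_zero M \<F>"

lemma openin_diff_compact: "openin M U \<Longrightarrow> compactin M K \<Longrightarrow> openin M (U - K)"
  using compactin_imp_closedin[OF Hausdorff] by (intro openin_diff)

text \<open>Compact sets are closed in a Hausdorff space, so \<open>U - K\<close> is open and
  membership becomes one equation between restrictions.\<close>

lemma mem_supp_in:
  "\<lbrakk>openin M U; compactin M K\<rbrakk> \<Longrightarrow>
    u \<in> supp_in U K \<longleftrightarrow> u \<in> carrier (sections \<F> U) \<and> restr \<F> U (U - K) u = \<zero>\<^bsub>sections \<F> (U - K)\<^esub>"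
  unfolding sections_supp_in_def using sec_support_subset_iff[OF _ openin_diff_compact] by blast

lemma supp_in_mono: "K \<subseteq> L \<Longrightarrow> supp_in U K \<subseteq> supp_in U L"
  unfolding sections_supp_in_def by blast

lemma supp_in_carrier: "u \<in> supp_in U K \<Longrightarrow> u \<in> carrier (sections \<F> U)"
  unfolding sections_supp_in_def by blast

lemma
  assumes U: "openin M U" and K: "compactin M K"
  shows zero_supp_in: "\<zero>\<^bsub>sections \<F> U\<^esub> \<in> supp_in U K"
    and add_supp_in: "u \<in> supp_in U K \<Longrightarrow> v \<in> supp_in U K \<Longrightarrow> u \<oplus>\<^bsub>sections \<F> U\<^esub> v \<in> supp_in U K"
    and minus_supp_in: "u \<in> supp_in U K \<Longrightarrow> v \<in> supp_in U K \<Longrightarrow> u \<ominus>\<^bsub>sections \<F> U\<^esub> v \<in> supp_in U K"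
    and act_supp_in: "openin M W \<Longrightarrow> U \<subseteq> W \<Longrightarrow> f \<in> carrier (sections \<O> W) \<Longrightarrow> u \<in> supp_in U K \<Longrightarrow>
      act W f U u \<in> supp_in U K"
    and smult_supp_in: "u \<in> supp_in U K \<Longrightarrow> c \<odot>\<^bsub>vs U\<^esub> u \<in> supp_in U K"
proof -
  have V: "openin M (U - K)" using U K by (rule openin_diff_compact)
  interpret U: module "sections \<O> U" "sections \<F> U" using U by (intro F.module_sections)
  interpret V: module "sections \<O> (U - K)" "sections \<F> (U - K)" using V by (intro F.module_sections)
  interpret Uv: module complex_ring "vs U" by (rule module_vs[OF U])
  interpret Vv: module complex_ring "vs (U - K)" by (rule module_vs[OF V])
  note m = mem_supp_in[OF U K]
  show "\<zero>\<^bsub>sections \<F> U\<^esub> \<in> supp_in U K"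
    unfolding m using U V by (simp add: restr_zero_F)
  show "u \<oplus>\<^bsub>sections \<F> U\<^esub> v \<in> supp_in U K" if "u \<in> supp_in U K" "v \<in> supp_in U K"
    using that unfolding m using U V by (simp add: F.restr_add)
  show "u \<ominus>\<^bsub>sections \<F> U\<^esub> v \<in> supp_in U K" if "u \<in> supp_in U K" "v \<in> supp_in U K"
    using that unfolding m using U V restr_minus_F[OF U V _, of u v] by (simp add: V.M.minus_eq)
  show "act W f U u \<in> supp_in U K"
    if "openin M W" "U \<subseteq> W" "f \<in> carrier (sections \<O> W)" "u \<in> supp_in U K"
  proof -
    have "act W f (U - K) \<zero>\<^bsub>sections \<F> (U - K)\<^esub> = \<zero>\<^bsub>sections \<F> (U - K)\<^esub>"
      using that V by (intro act_on_zero) auto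
    then show ?thesis
      using that unfolding m using U V by (simp add: act_closed act_restr)
  qed
  show "c \<odot>\<^bsub>vs U\<^esub> u \<in> supp_in U K" if "u \<in> supp_in U K"
  proof -
    have "restr \<F> U (U - K) (c \<odot>\<^bsub>vs U\<^esub> u) = c \<odot>\<^bsub>vs (U - K)\<^esub> \<zero>\<^bsub>sections \<F> (U - K)\<^esub>"
      using that restr_vs_smult[OF U V Diff_subset, of u c] unfolding m by simp
    also have "\<dots> = \<zero>\<^bsub>sections \<F> (U - K)\<^esub>"
      using Vv.smult_r_null[of c] by simp
    finally show ?thesis
      unfolding m using Uv.smult_closed[of c u] that m by simp
  qed
qed

lemma Fc_simps [simp]:
  "add (Fc M \<O> \<F> U) = add (sections \<F> U)" "zero (Fc M \<O> \<F> U) = zero (sections \<F> U)"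
  "smult (Fc M \<O> \<F> U) = smult (vs U)"
  by (simp_all add: Fc_def sections_vs_def)

lemma mem_Fc: "u \<in> carrier (Fc M \<O> \<F> U) \<longleftrightarrow> (\<exists>K. compactin M K \<and> K \<subseteq> U \<and> u \<in> supp_in U K)"
  by (auto simp: Fc_def)

text \<open>The spaces \<open>supp_in U K\<close> are directed by inclusion: the union of two
  compact sets serves both sections.\<close>

lemma Fc_common:
  assumes "u \<in> carrier (Fc M \<O> \<F> U)" "v \<in> carrier (Fc M \<O> \<F> U)"
  obtains K where "compactin M K" "K \<subseteq> U" "u \<in> supp_in U K" "v \<in> supp_in U K"
proof -
  obtain K L where "compactin M K" "K \<subseteq> U" "u \<in> supp_in U K" "compactin M L" "L \<subseteq> U" "v \<in> supp_in U L"
    using assms unfolding mem_Fc by blast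
  then show ?thesis
    using supp_in_mono[of K "K \<union> L" U] supp_in_mono[of L "K \<union> L" U]
    by (intro that[of "K \<union> L"]) (auto intro: compactin_Un)
qed

lemma Fc_carrier_subset: "carrier (Fc M \<O> \<F> U) \<subseteq> carrier (sections \<F> U)"
  using supp_in_carrier by (auto simp: mem_Fc)

lemma module_Fc:
  assumes U: "openin M U"
  shows "module complex_ring (Fc M \<O> \<F> U)"
proof -
  interpret Uv: module complex_ring "vs U" by (rule module_vs[OF U])
  have sm: "c \<odot>\<^bsub>vs U\<^esub> u \<in> carrier (Fc M \<O> \<F> U)" if "u \<in> carrier (Fc M \<O> \<F> U)" for c u
    using that smult_supp_in[OF U] unfolding mem_Fc by blast
  have c: "u \<in> carrier (vs U)" if "u \<in> carrier (Fc M \<O> \<F> U)" for u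
    using that Fc_carrier_subset by auto
  show ?thesis
  proof (rule moduleI)
    show "abelian_group (Fc M \<O> \<F> U)"
    proof (rule Uv.abelian_group_restrict_carrier)
      show "\<zero>\<^bsub>vs U\<^esub> \<in> carrier (Fc M \<O> \<F> U)"
        using zero_supp_in[OF U compactin_empty] unfolding mem_Fc by (auto intro!: exI[of _ "{}"])
      show "x \<oplus>\<^bsub>vs U\<^esub> y \<in> carrier (Fc M \<O> \<F> U)"
        if "x \<in> carrier (Fc M \<O> \<F> U)" "y \<in> carrier (Fc M \<O> \<F> U)" for x y
        using Fc_common[OF that] add_supp_in[OF U] unfolding mem_Fc by (metis vs_simps(2))
      show "\<ominus>\<^bsub>vs U\<^esub> x \<in> carrier (Fc M \<O> \<F> U)" if "x \<in> carrier (Fc M \<O> \<F> U)" for x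
      proof -
        have "(-1) \<odot>\<^bsub>vs U\<^esub> x = \<ominus>\<^bsub>vs U\<^esub> x"
          using Uv.smult_l_minus[of 1 x] Uv.smult_one[of x] c[OF that] by simp
        then show ?thesis using sm[OF that, of "-1"] by simp
      qed
    qed (use Fc_carrier_subset in auto)
    fix a b x y assume xy: "x \<in> carrier (Fc M \<O> \<F> U)" "y \<in> carrier (Fc M \<O> \<F> U)"
    note xy' = xy[THEN c]
    show "(a \<oplus>\<^bsub>complex_ring\<^esub> b) \<odot>\<^bsub>Fc M \<O> \<F> U\<^esub> x
        = a \<odot>\<^bsub>Fc M \<O> \<F> U\<^esub> x \<oplus>\<^bsub>Fc M \<O> \<F> U\<^esub> b \<odot>\<^bsub>Fc M \<O> \<F> U\<^esub> x"
      using Uv.smult_l_distr[of a b x] xy' by simp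
    show "a \<odot>\<^bsub>Fc M \<O> \<F> U\<^esub> (x \<oplus>\<^bsub>Fc M \<O> \<F> U\<^esub> y)
        = a \<odot>\<^bsub>Fc M \<O> \<F> U\<^esub> x \<oplus>\<^bsub>Fc M \<O> \<F> U\<^esub> a \<odot>\<^bsub>Fc M \<O> \<F> U\<^esub> y"
      using Uv.smult_r_distr[of a x y] xy' by simp
    show "(a \<otimes>\<^bsub>complex_ring\<^esub> b) \<odot>\<^bsub>Fc M \<O> \<F> U\<^esub> x = a \<odot>\<^bsub>Fc M \<O> \<F> U\<^esub> (b \<odot>\<^bsub>Fc M \<O> \<F> U\<^esub> x)"
      using Uv.smult_assoc1[of a b x] xy' by simp
  next
    fix x assume "x \<in> carrier (Fc M \<O> \<F> U)"
    then show "\<one>\<^bsub>complex_ring\<^esub> \<odot>\<^bsub>Fc M \<O> \<F> U\<^esub> x = x"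
      using Uv.smult_one[OF c, of x] by simp
  next
    fix a x assume "x \<in> carrier (Fc M \<O> \<F> U)"
    then show "a \<odot>\<^bsub>Fc M \<O> \<F> U\<^esub> x \<in> carrier (Fc M \<O> \<F> U)"
      using sm[of x a] by simp
  qed (auto intro: cring_from_type_algebra)
qed

text \<open>\<open>ext_zero\<close> prescribes vanishing off the exact support of \<open>u\<close>,
  whereas here vanishing off some compact \<open>K\<close> is enough: the complement of the support
  is covered by \<open>A - K\<close> and the part of \<open>U\<close> off the support, and locality
  applies. This criterion yields the identities for \<open>ext0\<close> below.\<close>

lemma ext_zero_unique:
  assumes U: "openin M U" and K: "compactin M K" "K \<subseteq> U" and u: "u \<in> supp_in U K"
    and v: "v \<in> carrier (sections \<F> A)" "restr \<F> A U v = u"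
      "restr \<F> A (A - K) v = \<zero>\<^bsub>sections \<F> (A - K)\<^esub>"
  shows "ext0 U u = v"
proof -
  define N where "N = A - sec_support M \<F> U u"
  have UA: "U \<subseteq> A" using openin_subset[OF U] .
  have AK: "openin M (A - K)" using K by (intro openin_diff_compact) auto
  have US: "openin M (U - sec_support M \<F> U u)" using U by (rule openin_minus_sec_support)
  have uU: "u \<in> carrier (sections \<F> U)" using supp_in_carrier[OF u] .
  have suppK: "sec_support M \<F> U u \<subseteq> K" using u by (simp add: sections_supp_in_def)
  have Nun: "(A - K) \<union> (U - sec_support M \<F> U u) = N"
    unfolding N_def using suppK UA K by blast
  then have N: "openin M N" using AK US by blast
  have NA: "N \<subseteq> A" unfolding N_def by blast
  interpret N: module "sections \<O> N" "sections \<F> N" using N by (intro F.module_sections)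
  have vN: "restr \<F> A N v = \<zero>\<^bsub>sections \<F> N\<^esub>"
  proof (rule F.locality2[OF AK US Nun])
    show "restr \<F> A N v \<in> carrier (sections \<F> N)"
      using F.restr_closed[OF _ N NA v(1)] by simp
    show "restr \<F> N (A - K) (restr \<F> A N v) = restr \<F> N (A - K) \<zero>\<^bsub>sections \<F> N\<^esub>"
      using N NA AK v Nun by (subst F.restr_restr) (auto simp: restr_zero_F)
    have "restr \<F> N (U - sec_support M \<F> U u) (restr \<F> A N v)
        = restr \<F> U (U - sec_support M \<F> U u) (restr \<F> A U v)"
      using N NA US U UA v(1) Nun by (subst (1 2) F.restr_restr) auto
    also have "\<dots> = \<zero>\<^bsub>sections \<F> (U - sec_support M \<F> U u)\<^esub>"
      using sec_support_subset_iff[OF U US uU] v(2) by simp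
    also have "\<dots> = restr \<F> N (U - sec_support M \<F> U u) \<zero>\<^bsub>sections \<F> N\<^esub>"
      using N US Nun by (subst restr_zero_F) auto
    finally show "restr \<F> N (U - sec_support M \<F> U u) (restr \<F> A N v)
        = restr \<F> N (U - sec_support M \<F> U u) \<zero>\<^bsub>sections \<F> N\<^esub>" .
  qed simp
  \<comment> \<open>\<open>N\<close> and \<open>U\<close> cover the space, so the conditions in
    \<open>ext_zero\<close> determine at most one section.\<close>
  have NUA: "N \<union> U = A"
    unfolding N_def using suppK UA K by blast
  have uniq: "w = v" if "w \<in> carrier (sections \<F> A)" "restr \<F> A U w = u"
    "restr \<F> A N w = \<zero>\<^bsub>sections \<F> N\<^esub>" for w
    by (rule F.locality2[OF N U NUA]) (use that v vN in simp_all)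
  show ?thesis
    unfolding ext_zero_def Let_def N_def[symmetric]
    by (rule the_equality, intro conjI, (fact v vN)+, elim conjE, rule uniq)
qed

text \<open>\<open>u\<close> on \<open>U\<close> and zero on \<open>A - K\<close> agree on the
  overlap \<open>U - K\<close> and glue; compactness makes \<open>A - K\<close> open.\<close>

lemma ext_zero:
  assumes U: "openin M U" and K: "compactin M K" "K \<subseteq> U" and u: "u \<in> supp_in U K"
  shows ext_zero_closed: "ext0 U u \<in> carrier (sections \<F> A)"
    and restr_ext_zero: "restr \<F> A U (ext0 U u) = u"
    and restr_ext_zero_compl: "restr \<F> A (A - K) (ext0 U u) = \<zero>\<^bsub>sections \<F> (A - K)\<^esub>"
    and ext_zero_supp_in: "ext0 U u \<in> supp_in A K"
proof -
  have UA: "U \<subseteq> A" using openin_subset[OF U] .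
  have AK: "openin M (A - K)" using K by (intro openin_diff_compact) auto
  have un: "U \<union> (A - K) = A" using K UA by blast
  interpret V: module "sections \<O> (A - K)" "sections \<F> (A - K)" using AK by (intro F.module_sections)
  have int: "U \<inter> (A - K) = U - K" using UA by blast
  have "restr \<F> U (U \<inter> (A - K)) u = restr \<F> (A - K) (U \<inter> (A - K)) \<zero>\<^bsub>sections \<F> (A - K)\<^esub>"
    unfolding int using u mem_supp_in[OF U K(1)]
      restr_zero_F[OF AK openin_diff_compact[OF U K(1)] Diff_mono[OF UA order.refl]] by simp
  then obtain v where v: "v \<in> carrier (sections \<F> A)" "restr \<F> A U v = u"
      "restr \<F> A (A - K) v = \<zero>\<^bsub>sections \<F> (A - K)\<^esub>"
    using F.glue2[OF U AK un supp_in_carrier[OF u] V.M.zero_closed] by metis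
  have e: "ext0 U u = v"
    by (rule ext_zero_unique[OF U K u v])
  show "ext0 U u \<in> carrier (sections \<F> A)" "restr \<F> A U (ext0 U u) = u"
    "restr \<F> A (A - K) (ext0 U u) = \<zero>\<^bsub>sections \<F> (A - K)\<^esub>" "ext0 U u \<in> supp_in A K"
    using v K by (auto simp: e mem_supp_in)
qed

text \<open>One compact set \<open>K\<close> serves all the sections involved, and the combination
  of their extensions passes the uniqueness test.\<close>

lemma linear_ext_zero:
  assumes U: "openin M U"
  shows "linear_between (Fc M \<O> \<F> U) (Fc M \<O> \<F> A) (ext0 U)"
  unfolding linear_between_def
proof (intro conjI ballI allI funcsetI)
  have A: "openin M A" and UA: "U \<subseteq> A" using openin_subset[OF U] by auto
  fix u assume u: "u \<in> carrier (Fc M \<O> \<F> U)"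
  then obtain K where K: "compactin M K" "K \<subseteq> U" and uK: "u \<in> supp_in U K"
    unfolding mem_Fc by blast
  have AK: "openin M (A - K)" using K by (intro openin_diff_compact) auto
  interpret AK: module complex_ring "vs (A - K)" by (rule module_vs[OF AK])
  interpret Av: module complex_ring "vs A" by (rule module_vs[OF A])
  note e = ext_zero[OF U K uK]
  show "ext0 U u \<in> carrier (Fc M \<O> \<F> A)"
    unfolding mem_Fc using K UA e(4) by blast
  fix c
  show "ext0 U (c \<odot>\<^bsub>Fc M \<O> \<F> U\<^esub> u) = c \<odot>\<^bsub>Fc M \<O> \<F> A\<^esub> ext0 U u"
  proof (rule ext_zero_unique[OF U K])
    show "c \<odot>\<^bsub>Fc M \<O> \<F> U\<^esub> u \<in> supp_in U K"
      using smult_supp_in[OF U K(1) uK, of c] by simp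
    show "c \<odot>\<^bsub>Fc M \<O> \<F> A\<^esub> ext0 U u \<in> carrier (sections \<F> A)"
      using Av.smult_closed[of c "ext0 U u"] e(1) by simp
    show "restr \<F> A U (c \<odot>\<^bsub>Fc M \<O> \<F> A\<^esub> ext0 U u) = c \<odot>\<^bsub>Fc M \<O> \<F> U\<^esub> u"
      using restr_vs_smult[OF A U UA e(1), of c] e(2) by simp
    show "restr \<F> A (A - K) (c \<odot>\<^bsub>Fc M \<O> \<F> A\<^esub> ext0 U u) = \<zero>\<^bsub>sections \<F> (A - K)\<^esub>"
      using restr_vs_smult[OF A AK Diff_subset e(1), of c] e(3) AK.smult_r_null[of c] by simp
  qed
next
  have A: "openin M A" and UA: "U \<subseteq> A" using openin_subset[OF U] by auto
  fix u v assume "u \<in> carrier (Fc M \<O> \<F> U)" "v \<in> carrier (Fc M \<O> \<F> U)"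
  then obtain K where K: "compactin M K" "K \<subseteq> U" and uK: "u \<in> supp_in U K" and vK: "v \<in> supp_in U K"
    by (rule Fc_common)
  have AK: "openin M (A - K)" using K by (intro openin_diff_compact) auto
  interpret AK: module complex_ring "vs (A - K)" by (rule module_vs[OF AK])
  interpret Av: module complex_ring "vs A" by (rule module_vs[OF A])
  note e = ext_zero[OF U K uK] and e' = ext_zero[OF U K vK]
  have "ext0 U (u \<oplus>\<^bsub>sections \<F> U\<^esub> v) = ext0 U u \<oplus>\<^bsub>sections \<F> A\<^esub> ext0 U v"
  proof (rule ext_zero_unique[OF U K add_supp_in[OF U K(1) uK vK]])
    show "ext0 U u \<oplus>\<^bsub>sections \<F> A\<^esub> ext0 U v \<in> carrier (sections \<F> A)"
      using Av.M.a_closed e(1) e'(1) by simp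
    show "restr \<F> A U (ext0 U u \<oplus>\<^bsub>sections \<F> A\<^esub> ext0 U v) = u \<oplus>\<^bsub>sections \<F> U\<^esub> v"
      using F.restr_add[OF A U UA e(1) e'(1)] e(2) e'(2) by simp
    show "restr \<F> A (A - K) (ext0 U u \<oplus>\<^bsub>sections \<F> A\<^esub> ext0 U v) = \<zero>\<^bsub>sections \<F> (A - K)\<^esub>"
      using F.restr_add[OF A AK Diff_subset e(1) e'(1)] e(3) e'(3) AK.M.l_zero[OF AK.M.zero_closed]
      by simp
  qed
  then show "ext0 U (u \<oplus>\<^bsub>Fc M \<O> \<F> U\<^esub> v) = ext0 U u \<oplus>\<^bsub>Fc M \<O> \<F> A\<^esub> ext0 U v"
    by simp
qed

lemma act_supp_in_vanishing:
  assumes U: "openin M U" and W: "openin M W" "U \<subseteq> W" and C: "compactin M C"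
    and f: "f \<in> carrier (sections \<O> W)" "restr \<O> W (W - C) f = \<zero>\<^bsub>sections \<O> (W - C)\<^esub>"
    and u: "u \<in> carrier (sections \<F> U)"
  shows "act W f U u \<in> supp_in U C"
proof -
  have V: "openin M (U - C)" "openin M (W - C)" using U W C by (auto intro: openin_diff_compact)
  have "restr \<O> W (U - C) f = restr \<O> (W - C) (U - C) (restr \<O> W (W - C) f)"
    using W V f by (subst restr_restr) auto
  also have "\<dots> = \<zero>\<^bsub>sections \<O> (U - C)\<^esub>"
    using f(2) V W by (simp add: restr_zero Diff_mono)
  finally have 0: "act W f (U - C) (restr \<F> U (U - C) u) = \<zero>\<^bsub>sections \<F> (U - C)\<^esub>"
    by (intro act_zero[OF V(1)] F.restr_closed[OF U V(1) _ u]) auto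
  have "restr \<F> U (U - C) (act W f U u) = act W f (U - C) (restr \<F> U (U - C) u)"
    by (rule act_restr) (use U W V f u in auto)
  then show ?thesis
    using mem_supp_in[OF U C] 0 act_closed[OF W(1) U W(2) f(1) u] by simp
qed

text \<open>On \<open>U \<inter> W\<close> the multiplier is one, and on \<open>U - K\<close> both
  sides are zero; these two sets cover \<open>U\<close> because
  \<open>K \<subseteq> W\<close>.\<close>

lemma act_eq_self:
  assumes U: "openin M U" and Y: "openin M Y" "U \<subseteq> Y" and K: "compactin M K" and u: "u \<in> supp_in U K"
    and f: "f \<in> carrier (sections \<O> Y)"
    and W: "openin M W" "K \<subseteq> W" "W \<subseteq> Y" "restr \<O> Y W f = \<one>\<^bsub>sections \<O> W\<^esub>"
  shows "act Y f U u = u"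
proof -
  note m = mem_supp_in[OF U K]
  have uU: "u \<in> carrier (sections \<F> U)" using supp_in_carrier[OF u] .
  have UW: "openin M (U \<inter> W)" and UK: "openin M (U - K)" using U W K by (auto intro: openin_diff_compact)
  have un: "(U \<inter> W) \<union> (U - K) = U" using W by blast
  show ?thesis
  proof (rule F.locality2[OF UW UK un])
    show "act Y f U u \<in> carrier (sections \<F> U)" "u \<in> carrier (sections \<F> U)"
      using act_closed[OF Y(1) U Y(2) f uU] uU by auto
    have "act Y f U u \<in> supp_in U K"
      using act_supp_in[OF U K Y f u] .
    then show "restr \<F> U (U - K) (act Y f U u) = restr \<F> U (U - K) u"
      using u unfolding m by simp
    have "restr \<O> Y (U \<inter> W) f = restr \<O> W (U \<inter> W) (restr \<O> Y W f)"
      using W Y UW f by (subst restr_restr) auto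
    also have "\<dots> = \<one>\<^bsub>sections \<O> (U \<inter> W)\<^esub>"
      using W UW by (simp add: restr_one)
    finally have "act Y f (U \<inter> W) (restr \<F> U (U \<inter> W) u) = restr \<F> U (U \<inter> W) u"
      by (intro act_one[OF UW] F.restr_closed[OF U UW _ uU]) auto
    moreover have "restr \<F> U (U \<inter> W) (act Y f U u) = act Y f (U \<inter> W) (restr \<F> U (U \<inter> W) u)"
      by (rule act_restr) (use U Y UW f uU in auto)
    ultimately show "restr \<F> U (U \<inter> W) (act Y f U u) = restr \<F> U (U \<inter> W) u" by simp
  qed
qed

end

section \<open>Smooth bump functions on Euclidean space\<close>

lemma Euclidean_space_eq_top_of_set: "Euclidean_space n = top_of_set {x. \<forall>i\<ge>n. x i = 0}"
  by (simp add: Euclidean_space_def euclidean_product_topology)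

lemma continuous_map_Euclidean_subtopology:
  "continuous_map (subtopology (Euclidean_space n) U) euclidean f
    \<longleftrightarrow> continuous_on ({x. \<forall>i\<ge>n. x i = 0} \<inter> U) f"
  by (simp add: Euclidean_space_eq_top_of_set subtopology_subtopology)

section \<open>Differentiability classes in several variables\<close>

lemma C_on_continuous:
  "C_on n r U f \<Longrightarrow> continuous_on ({x. \<forall>i\<ge>n. x i = 0} \<inter> U) f"
  by (cases r) (auto simp: continuous_map_Euclidean_subtopology)

lemma C_on_SucD: "C_on n (Suc r) U f \<Longrightarrow> C_on n r U f"
proof (induction r arbitrary: f)
  case (Suc r)
  have "\<exists>g. C_on n r U g \<and> (\<forall>x\<in>U. ((\<lambda>t. f (x(i := t))) has_vector_derivative g x) (at (x i)))"
    if i: "i < n" for i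
  proof -
    obtain g where "C_on n (Suc r) U g"
      "\<forall>x\<in>U. ((\<lambda>t. f (x(i := t))) has_vector_derivative g x) (at (x i))"
      using Suc.prems i unfolding C_on.simps(2)[of n "Suc r"] by blast
    with Suc.IH show ?thesis by blast
  qed
  then show ?case
    using Suc.prems unfolding C_on.simps by blast
qed simp

lemma C_on_const: "C_on n r U (\<lambda>x. c)"
  by (induction r arbitrary: c) (auto intro!: exI[of _ "\<lambda>x. 0"] derivative_intros)

lemma C_on_add:
  "C_on n r U f \<Longrightarrow> C_on n r U g \<Longrightarrow> C_on n r U (\<lambda>x. f x + g x)"
proof (induction r arbitrary: f g)
  case 0
  then show ?case by (auto simp: continuous_map_Euclidean_subtopology intro: continuous_intros)
next
  case (Suc r)
  have "\<exists>h. C_on n r U h \<and>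
      (\<forall>x\<in>U. ((\<lambda>t. f (x(i := t)) + g (x(i := t))) has_vector_derivative h x) (at (x i)))"
    if i: "i < n" for i
  proof -
    obtain f' where f': "C_on n r U f'"
      "\<And>x. x \<in> U \<Longrightarrow> ((\<lambda>t. f (x(i := t))) has_vector_derivative f' x) (at (x i))"
      using Suc.prems(1) i unfolding C_on.simps by blast
    obtain g' where g': "C_on n r U g'"
      "\<And>x. x \<in> U \<Longrightarrow> ((\<lambda>t. g (x(i := t))) has_vector_derivative g' x) (at (x i))"
      using Suc.prems(2) i unfolding C_on.simps by blast
    show ?thesis
      by (intro exI[of _ "\<lambda>x. f' x + g' x"] conjI ballI Suc.IH[OF f'(1) g'(1)]
          has_vector_derivative_add f'(2) g'(2))
  qed
  moreover have "continuous_map (subtopology (Euclidean_space n) U) euclidean (\<lambda>x. f x + g x)"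
    using C_on_continuous[OF Suc.prems(1)] C_on_continuous[OF Suc.prems(2)]
    by (auto simp: continuous_map_Euclidean_subtopology intro: continuous_intros)
  ultimately show ?case
    unfolding C_on.simps by blast
qed

lemma C_on_mult:
  "C_on n r U f \<Longrightarrow> C_on n r U g \<Longrightarrow> C_on n r U (\<lambda>x. f x * g x)"
proof (induction r arbitrary: f g)
  case 0
  then show ?case by (auto simp: continuous_map_Euclidean_subtopology intro: continuous_intros)
next
  case (Suc r)
  have "\<exists>h. C_on n r U h \<and>
      (\<forall>x\<in>U. ((\<lambda>t. f (x(i := t)) * g (x(i := t))) has_vector_derivative h x) (at (x i)))"
    if i: "i < n" for i
  proof -
    obtain f' where f': "C_on n r U f'"
      "\<And>x. x \<in> U \<Longrightarrow> ((\<lambda>t. f (x(i := t))) has_vector_derivative f' x) (at (x i))"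
      using Suc.prems(1) i unfolding C_on.simps by blast
    obtain g' where g': "C_on n r U g'"
      "\<And>x. x \<in> U \<Longrightarrow> ((\<lambda>t. g (x(i := t))) has_vector_derivative g' x) (at (x i))"
      using Suc.prems(2) i unfolding C_on.simps by blast
    have "((\<lambda>t. f (x(i := t)) * g (x(i := t))) has_vector_derivative (f x * g' x + f' x * g x)) (at (x i))"
      if "x \<in> U" for x
      using has_vector_derivative_mult[OF f'(2)[OF that] g'(2)[OF that]] by simp
    moreover have "C_on n r U (\<lambda>x. f x * g' x + f' x * g x)"
      using Suc.prems[THEN C_on_SucD] f' g' by (intro C_on_add Suc.IH)
    ultimately show ?thesis by blast
  qed
  moreover have "continuous_map (subtopology (Euclidean_space n) U) euclidean (\<lambda>x. f x * g x)"
    using C_on_continuous[OF Suc.prems(1)] C_on_continuous[OF Suc.prems(2)]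
    by (auto simp: continuous_map_Euclidean_subtopology intro: continuous_intros)
  ultimately show ?case
    unfolding C_on.simps by blast
qed

lemma C_on_sum: "(\<And>a. a \<in> I \<Longrightarrow> C_on n r U (f a)) \<Longrightarrow> C_on n r U (\<lambda>x. \<Sum>a\<in>I. f a x)"
  by (induction I rule: infinite_finite_induct) (auto intro: C_on_const C_on_add)

text \<open>The derivative at a point of the open set \<open>V\<close> depends only on nearby
  values, and the coordinate line through the point stays in \<open>V\<close> for nearby parameters.
  The lemma covers both shrinking the domain and changing the function outside it.\<close>

lemma C_on_cong_subset:
  "openin (Euclidean_space n) V \<Longrightarrow> V \<subseteq> U \<Longrightarrow> C_on n r U f \<Longrightarrow> (\<And>x. x \<in> V \<Longrightarrow> g x = f x)
    \<Longrightarrow> C_on n r V g"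
proof (induction r arbitrary: f g)
  case 0
  then show ?case
    unfolding C_on.simps continuous_map_Euclidean_subtopology
    by (subst continuous_on_cong[OF refl, of _ _ f]) (auto intro: continuous_on_subset)
next
  case (Suc r)
  let ?E = "{x. \<forall>i\<ge>n. x i = (0::real)}"
  obtain T where T: "open T" "V = ?E \<inter> T"
    using Suc.prems(1) unfolding Euclidean_space_eq_top_of_set openin_open by blast
  have "\<exists>h. C_on n r V h \<and>
      (\<forall>x\<in>V. ((\<lambda>t. g (x(i := t))) has_vector_derivative h x) (at (x i)))"
    if i: "i < n" for i
  proof -
    obtain f' where f': "C_on n r U f'"
      "\<And>x. x \<in> U \<Longrightarrow> ((\<lambda>t. f (x(i := t))) has_vector_derivative f' x) (at (x i))"
      using Suc.prems(3) i unfolding C_on.simps by blast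
    have "((\<lambda>t. g (x(i := t))) has_vector_derivative f' x) (at (x i))" if x: "x \<in> V" for x
    proof (rule has_vector_derivative_transform_within_open)
      show "((\<lambda>t. f (x(i := t))) has_vector_derivative f' x) (at (x i))"
        using f' x Suc.prems by blast
      have "continuous_on UNIV (\<lambda>t. (x(i := t)) j)" for j
        by (cases "j = i") simp_all
      then have "continuous_on UNIV (\<lambda>t. x(i := t))"
        by (rule continuous_on_coordinatewise_then_product)
      then show "open ((\<lambda>t. x(i := t)) -` T)"
        using T(1) by (rule open_vimage[rotated])
      show "x i \<in> (\<lambda>t. x(i := t)) -` T" using x T by simp
      show "f (x(i := t)) = g (x(i := t))" if "t \<in> (\<lambda>t. x(i := t)) -` T" for t
      proof -
        \<comment> \<open>\<open>i < n\<close> keeps the point in the Euclidean space, whose points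
          vanish from index \<open>n\<close> on.\<close>
        have "x(i := t) \<in> V" using that x i T by auto
        then show ?thesis by (rule Suc.prems(4)[symmetric])
      qed
    qed
    moreover have "C_on n r V f'"
      using Suc.IH[OF Suc.prems(1,2) f'(1)] by simp
    ultimately show ?thesis by blast
  qed
  moreover have "continuous_on (?E \<inter> V) g"
    using C_on_continuous[OF Suc.prems(3)] Suc.prems(2,4)
    by (subst continuous_on_cong[OF refl, of _ _ f]) (auto intro: continuous_on_subset)
  ultimately show ?case
    unfolding C_on.simps continuous_map_Euclidean_subtopology by blast
qed

section \<open>Smooth functions of one real variable\<close>

primrec diff_times :: "nat \<Rightarrow> (real \<Rightarrow> real) \<Rightarrow> bool"
  where
    "diff_times 0 f \<longleftrightarrow> continuous_on UNIV f"
  | "diff_times (Suc r) f \<longleftrightarrow> (\<exists>g. diff_times r g \<and> (\<forall>t. (f has_real_derivative g t) (at t)))"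

lemma diff_times_SucD: "diff_times (Suc r) f \<Longrightarrow> diff_times r f"
proof (induction r arbitrary: f)
  case 0
  then have "\<forall>t. isCont f t" by (auto intro: DERIV_isCont)
  then show ?case by (simp add: continuous_on_eq_continuous_at)
next
  case (Suc r)
  then show ?case using diff_times.simps(2) by blast
qed

lemma diff_times_const: "diff_times r (\<lambda>t. c)"
  by (induction r arbitrary: c) (auto intro!: exI[of _ "\<lambda>x. 0"] derivative_intros)

lemma diff_times_add: "diff_times r f \<Longrightarrow> diff_times r g \<Longrightarrow> diff_times r (\<lambda>t. f t + g t)"
proof (induction r arbitrary: f g)
  case (Suc r)
  then obtain f' g' where "diff_times r f'" "\<And>t. (f has_real_derivative f' t) (at t)"
    "diff_times r g'" "\<And>t. (g has_real_derivative g' t) (at t)" by auto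
  with Suc.IH show ?case
    by (auto intro!: exI[of _ "\<lambda>t. f' t + g' t"] derivative_intros)
qed (auto intro: continuous_intros)

lemma diff_times_mult: "diff_times r f \<Longrightarrow> diff_times r g \<Longrightarrow> diff_times r (\<lambda>t. f t * g t)"
proof (induction r arbitrary: f g)
  case (Suc r)
  then obtain f' g' where *: "diff_times r f'" "\<And>t. (f has_real_derivative f' t) (at t)"
    "diff_times r g'" "\<And>t. (g has_real_derivative g' t) (at t)" by auto
  have "diff_times r (\<lambda>t. f' t * g t + g' t * f t)"
    using * Suc.prems[THEN diff_times_SucD] by (intro diff_times_add Suc.IH)
  moreover have "((\<lambda>t. f t * g t) has_real_derivative f' t * g t + g' t * f t) (at t)" for t
    using DERIV_mult[OF *(2) *(4)] .
  ultimately show ?case by auto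
qed (auto intro: continuous_intros)

text \<open>The derivative involves \<open>f'\<close> and the square of
  \<open>inverse (f t)\<close>, so the induction hypothesis is applied to \<open>f\<close> itself,
  one order lower.\<close>

lemma diff_times_inverse: "diff_times r f \<Longrightarrow> (\<And>t. f t \<noteq> 0) \<Longrightarrow> diff_times r (\<lambda>t. inverse (f t))"
proof (induction r arbitrary: f)
  case (Suc r)
  then obtain f' where *: "diff_times r f'" "\<And>t. (f has_real_derivative f' t) (at t)" by auto
  have "diff_times r (\<lambda>t. (- 1) * (f' t * (inverse (f t) * inverse (f t))))"
    using * Suc.prems(1)[THEN diff_times_SucD] Suc.prems(2)
    by (intro diff_times_mult diff_times_const Suc.IH)
  moreover have "((\<lambda>t. inverse (f t)) has_real_derivative (- 1) * (f' t * (inverse (f t) * inverse (f t)))) (at t)" for t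
    using DERIV_inverse'[OF *(2) Suc.prems(2)] by (simp add: ac_simps)
  ultimately show ?case by auto
qed (auto intro!: continuous_intros)

lemma diff_times_affine: "diff_times r f \<Longrightarrow> diff_times r (\<lambda>t. f (a * t + b))"
proof (induction r arbitrary: f)
  case 0
  then show ?case
    by (auto intro!: continuous_on_compose2[of UNIV f] continuous_intros)
next
  case (Suc r)
  then obtain f' where *: "diff_times r f'" "\<And>t. (f has_real_derivative f' t) (at t)" by auto
  have "((\<lambda>t. f (a * t + b)) has_real_derivative f' (a * t + b) * a) (at t)" for t
    by (rule DERIV_chain2[OF *(2)]) (auto intro!: derivative_eq_intros)
  moreover have "diff_times r (\<lambda>t. f' (a * t + b) * a)"
    by (rule diff_times_mult[OF Suc.IH[OF *(1)] diff_times_const])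
  ultimately show ?case by auto
qed

text \<open>The witness for the derivative might depend on the order \<open>r\<close>; uniqueness of
  derivatives replaces all of them by \<open>deriv f\<close>.\<close>

lemma smooth_derivative:
  assumes "\<And>r. diff_times r f"
  obtains f' where "\<And>r. diff_times r f'" "\<And>t. (f has_real_derivative f' t) (at t)"
proof -
  have "diff_times r (deriv f)" for r
  proof -
    obtain g where "diff_times r g" "\<And>t. (f has_real_derivative g t) (at t)"
      using assms[of "Suc r"] by auto
    then show ?thesis using DERIV_imp_deriv[of f] by (metis ext)
  qed
  moreover have "(f has_real_derivative deriv f t) (at t)" for t
    using assms[of "Suc 0"] DERIV_imp_deriv[of f] unfolding diff_times.simps by metis
  ultimately show ?thesis using that by blast
qed

text \<open>\<open>exp (- 1 / t)\<close> is flat at \<open>0\<close>; the derivatives stay in the family with a polynomial in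
  \<open>1 / t\<close> as an additional factor.\<close>

definition flat :: "real poly \<Rightarrow> real \<Rightarrow> real"
  where "flat p t = (if 0 < t then poly p (1 / t) * exp (- (1 / t)) else 0)"

lemma poly_div_exp_tendsto_0: "((\<lambda>x. poly p x * exp (- x)) \<longlongrightarrow> (0::real)) at_top"
proof -
  have "((\<lambda>x. \<Sum>i\<le>Polynomial.degree p. Polynomial.coeff p i * (x ^ i / exp x)) \<longlongrightarrow> (\<Sum>i\<le>Polynomial.degree p. Polynomial.coeff p i * 0)) at_top"
    by (intro tendsto_intros tendsto_power_div_exp_0)
  then show ?thesis
    by (simp add: poly_altdef sum_distrib_right exp_minus divide_inverse mult.assoc)
qed

text \<open>With \<open>x = 1 / t\<close>, the derivative in \<open>t\<close> of the polynomial
  times \<open>exp (- x)\<close> is the square of \<open>x\<close> times the difference of the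
  polynomial and its derivative, times \<open>exp (- x)\<close>; the square of \<open>x\<close> is
  \<open>[:0, 0, 1:]\<close>. At zero the difference quotient tends to zero since the exponential
  beats every polynomial.\<close>

lemma flat_has_derivative:
  "(flat p has_real_derivative flat ([:0, 0, 1:] * (p - pderiv p)) t) (at t)"
proof (cases t "0::real" rule: linorder_cases)
  case greater
  have "((\<lambda>t. poly p (1 / t) * exp (- (1 / t))) has_real_derivative
      flat ([:0, 0, 1:] * (p - pderiv p)) t) (at t)"
    using greater unfolding flat_def
    by (auto intro!: derivative_eq_intros DERIV_chain2[OF poly_DERIV]
        simp: field_simps power2_eq_square)
  then show ?thesis
    by (rule has_field_derivative_transform_within_open[of _ _ _ "{0<..}"])
      (use greater in \<open>auto simp: flat_def\<close>)
next
  case less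
  have "((\<lambda>t. 0) has_real_derivative flat ([:0, 0, 1:] * (p - pderiv p)) t) (at t)"
    using less by (simp add: flat_def)
  then show ?thesis
    by (rule has_field_derivative_transform_within_open[of _ _ _ "{..<0}"])
      (use less in \<open>auto simp: flat_def\<close>)
next
  case equal
  have "((\<lambda>h. flat p h / h) \<longlongrightarrow> 0) (at_right 0)"
  proof -
    \<comment> \<open>Dividing by \<open>h\<close> multiplies the polynomial by one more
      \<open>1 / h\<close>, hence \<open>pCons 0 p\<close>.\<close>
    have "((\<lambda>h. poly (pCons 0 p) (inverse h) * exp (- inverse h)) \<longlongrightarrow> 0) (at_right (0::real))"
      by (rule filterlim_compose[OF poly_div_exp_tendsto_0 filterlim_inverse_at_top_right])
    then show ?thesis
      by (rule Lim_transform_eventually)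
        (auto simp: eventually_at_right_less flat_def field_simps
          intro!: eventually_mono[OF eventually_at_right_less])
  qed
  moreover have "((\<lambda>h. flat p h / h) \<longlongrightarrow> 0) (at_left 0)"
    by (rule Lim_transform_eventually[OF tendsto_const])
      (auto simp: flat_def eventually_at_left_field intro!: exI[of _ "-1"])
  ultimately have "((\<lambda>h. flat p h / h) \<longlongrightarrow> 0) (at 0)"
    by (simp add: filterlim_at_split)
  then show ?thesis
    unfolding equal DERIV_def by (simp add: flat_def)
qed

lemma diff_times_flat: "diff_times r (flat p)"
proof (induction r arbitrary: p)
  case 0
  have "isCont (flat p) t" for t by (rule DERIV_isCont[OF flat_has_derivative])
  then show ?case by (simp add: continuous_on_eq_continuous_at)
next
  case (Suc r)
  then show ?case using flat_has_derivative by auto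
qed

text \<open>The standard smooth transition: \<open>flat 1 t\<close> is
  \<open>exp (- (1 / t))\<close> for positive \<open>t\<close> and zero otherwise, and one of
  \<open>t\<close> and \<open>1 - t\<close> is always positive, so the denominator never
  vanishes.\<close>

definition step :: "real \<Rightarrow> real"
  where "step t = flat 1 t * inverse (flat 1 t + flat 1 (1 - t))"

lemma diff_times_step: "diff_times r step"
proof -
  have "flat 1 t + flat 1 (1 - t) \<noteq> 0" for t
    by (simp add: flat_def) (smt (verit) exp_gt_zero)
  moreover have "diff_times r (\<lambda>t. flat 1 (1 - t))"
    using diff_times_affine[OF diff_times_flat, of r 1 "-1" 1] by simp
  ultimately have "diff_times r (\<lambda>t. flat 1 t * inverse (flat 1 t + flat 1 (1 - t)))"
    by (intro diff_times_mult diff_times_inverse diff_times_add diff_times_flat)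
  then show ?thesis
    by (simp add: step_def[abs_def])
qed

lemma step_eq_0: "t \<le> 0 \<Longrightarrow> step t = 0"
  by (simp add: step_def flat_def)

lemma step_eq_1: "1 \<le> t \<Longrightarrow> step t = 1"
  by (simp add: step_def flat_def)

section \<open>Products of one-variable functions and Euclidean bumps\<close>

lemma continuous_on_prod_coordinates:
  fixes g :: "nat \<Rightarrow> real \<Rightarrow> real"
  assumes "\<And>i. continuous_on UNIV (g i)"
  shows "continuous_on S (\<lambda>x. complex_of_real (\<Prod>i<n. g i (x i)))"
proof -
  have "continuous_on S (\<lambda>x. x i)" for i
    by (rule continuous_on_subset[OF continuous_on_product_coordinates subset_UNIV])
  then have "continuous_on S (\<lambda>x. g i (x i))" for i
    by (rule continuous_on_compose2[OF assms]) simp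
  then show ?thesis by (intro continuous_on_of_real continuous_on_prod)
qed

text \<open>A partial derivative replaces one factor by its derivative, which gives a function of
  the same shape; the induction therefore runs over all families \<open>g\<close> of smooth
  functions at once.\<close>

lemma C_on_prod_coordinates:
  assumes "\<And>i r. diff_times r (g i)"
  shows "C_on n r UNIV (\<lambda>x. complex_of_real (\<Prod>i<n. g i (x i)))"
  using assms
proof (induction r arbitrary: g)
  case 0
  have "continuous_on UNIV (g i)" for i using 0[of 0] by simp
  then show ?case
    unfolding C_on.simps continuous_map_Euclidean_subtopology
    by (rule continuous_on_prod_coordinates)
next
  case (Suc r)
  have "continuous_on UNIV (g i)" for i using Suc.prems[of 0] by simp
  then have "continuous_map (subtopology (Euclidean_space n) UNIV) euclidean
      (\<lambda>x. complex_of_real (\<Prod>i<n. g i (x i)))"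
    unfolding continuous_map_Euclidean_subtopology
    by (rule continuous_on_prod_coordinates)
  moreover have "\<exists>h. C_on n r UNIV h \<and> (\<forall>x\<in>UNIV.
      ((\<lambda>t. complex_of_real (\<Prod>j<n. g j ((x(i := t)) j))) has_vector_derivative h x) (at (x i)))"
    if i: "i < n" for i
  proof -
    obtain g' where g': "\<And>r. diff_times r g'" "\<And>t. (g i has_real_derivative g' t) (at t)"
      using smooth_derivative[of "g i"] Suc.prems by blast
    let ?g = "g(i := g')"
    have prod: "(\<Prod>j<n. f j) = f i * (\<Prod>j\<in>{..<n} - {i}. f j)" for f :: "nat \<Rightarrow> real"
      using i by (intro prod.remove) auto
    have "((\<lambda>t. complex_of_real (\<Prod>j<n. g j ((x(i := t)) j))) has_vector_derivative
        complex_of_real (\<Prod>j<n. ?g j (x j))) (at (x i))" for x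
    proof -
      have "((\<lambda>t. g i t * (\<Prod>j\<in>{..<n} - {i}. g j (x j))) has_real_derivative
          g' (x i) * (\<Prod>j\<in>{..<n} - {i}. g j (x j))) (at (x i))"
        by (intro DERIV_cmult_right g'(2))
      moreover have "(\<Prod>j<n. g j ((x(i := t)) j)) = g i t * (\<Prod>j\<in>{..<n} - {i}. g j (x j))" for t
        unfolding prod by (auto intro!: prod.cong)
      moreover have "(\<Prod>j<n. ?g j (x j)) = g' (x i) * (\<Prod>j\<in>{..<n} - {i}. g j (x j))"
        unfolding prod by (auto intro!: prod.cong)
      ultimately show ?thesis
        by (intro has_vector_derivative_of_real) simp
    qed
    moreover have "C_on n r UNIV (\<lambda>x. complex_of_real (\<Prod>j<n. ?g j (x j)))"
      by (rule Suc.IH) (use g' Suc.prems in auto)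
    ultimately show ?thesis by blast
  qed
  ultimately show ?case
    unfolding C_on.simps by blast
qed

text \<open>A neighbourhood of \<open>a\<close> in the product topology contains a box around
  \<open>a\<close>; the bump is a product of one-variable plateaus that vanishes off this box and is
  one on the box of half the size.\<close>

lemma Euclidean_bump:
  assumes V: "openin (Euclidean_space n) V" and a: "a \<in> V"
  obtains b C W where "smooth_on n (topspace (Euclidean_space n)) b"
    and "\<And>x. x \<notin> topspace (Euclidean_space n) \<Longrightarrow> b x = 0"
    and "compactin (Euclidean_space n) C" "C \<subseteq> V" "\<And>x. x \<notin> C \<Longrightarrow> b x = 0"
    and "openin (Euclidean_space n) W" "a \<in> W" "\<And>x. x \<in> W \<Longrightarrow> b x = 1"
proof -
  let ?E = "{x. \<forall>i\<ge>n. x i = (0::real)}"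
  have top: "topspace (Euclidean_space n) = ?E" by (rule topspace_Euclidean_space)
  obtain T where T: "open T" "V = ?E \<inter> T"
    using V unfolding Euclidean_space_eq_top_of_set openin_open by blast
  have aE: "\<forall>i\<ge>n. a i = 0" and aT: "a \<in> T" using a T by auto
  have "openin (powertop_real UNIV) T"
    using T(1) by (simp add: euclidean_product_topology)
  then obtain Z where Z: "finite {i. Z i \<noteq> UNIV}" "\<And>i. open (Z i)" "a \<in> Pi\<^sub>E UNIV Z" "Pi\<^sub>E UNIV Z \<subseteq> T"
    using aT unfolding openin_product_topology_alt by auto
  have "\<exists>e>0. cball (a i) e \<subseteq> Z i" for i
    using Z(2)[of i] Z(3) by (auto simp: open_contains_cball)
  then obtain e where e: "\<And>i. e i > 0" "\<And>i. cball (a i) (e i) \<subseteq> Z i" by metis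
  \<comment> \<open>Only finitely many coordinates of a basic open set are constrained; the inserted
    \<open>1\<close> keeps the minimum defined when none is.\<close>
  define \<epsilon> where "\<epsilon> = Min (insert 1 (e ` {i. Z i \<noteq> UNIV}))"
  have \<epsilon>: "0 < \<epsilon>"
    unfolding \<epsilon>_def using Z(1) e(1) by (subst Min_gr_iff) auto
  have \<epsilon>e: "\<epsilon> \<le> e i" if "Z i \<noteq> UNIV" for i
    unfolding \<epsilon>_def using Z(1) that by (intro Min_le) auto
  have inT: "x \<in> T" if "\<And>i. \<bar>x i - a i\<bar> \<le> \<epsilon>" for x
  proof -
    have "x i \<in> Z i" for i
    proof (cases "Z i = UNIV")
      case False
      then have "\<bar>x i - a i\<bar> \<le> e i" using that[of i] \<epsilon>e by fastforce
      then have "x i \<in> cball (a i) (e i)" by (simp add: dist_real_def abs_minus_commute)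
      then show ?thesis using e(2) by blast
    qed simp
    then show ?thesis using Z(4) by auto
  qed
  \<comment> \<open>With \<open>s = (t - a i) / \<epsilon>\<close> the arguments of
    \<open>step\<close> are \<open>2 - 2 * s\<close> and \<open>2 + 2 * s\<close>: the product
    vanishes for \<open>\<bar>s\<bar> \<ge> 1\<close> and is one for
    \<open>\<bar>s\<bar> \<le> 1 / 2\<close>. The expanded affine form suits
    \<open>diff_times_affine\<close>.\<close>
  define \<beta> where "\<beta> i t = step ((- 2 / \<epsilon>) * t + (2 + 2 * a i / \<epsilon>)) * step ((2 / \<epsilon>) * t + (2 - 2 * a i / \<epsilon>))"
    for i t
  \<comment> \<open>The factors \<open>{0}\<close> from index \<open>n\<close> on place the box in
    the Euclidean space; it is compact as a product of compact sets.\<close>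
  define C where "C = Pi\<^sub>E UNIV (\<lambda>i. if i < n then {a i - \<epsilon> .. a i + \<epsilon>} else {0})"
  define W where "W = ?E \<inter> (\<Inter>i<n. {x. \<bar>x i - a i\<bar> < \<epsilon> / 2})"
  define b where "b x = (if x \<in> ?E then complex_of_real (\<Prod>i<n. \<beta> i (x i)) else 0)" for x
  have \<beta>_eq: "\<beta> i t = step (2 - 2 * ((t - a i) / \<epsilon>)) * step (2 + 2 * ((t - a i) / \<epsilon>))" for i t
    unfolding \<beta>_def by (simp add: diff_divide_distrib algebra_simps)
  have \<beta>0: "\<beta> i t = 0" if "\<bar>t - a i\<bar> > \<epsilon>" for i t
  proof -
    have "\<bar>(t - a i) / \<epsilon>\<bar> > 1" using that \<epsilon> by simp
    then have "2 - 2 * ((t - a i) / \<epsilon>) \<le> 0 \<or> 2 + 2 * ((t - a i) / \<epsilon>) \<le> 0" by linarith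
    then show ?thesis unfolding \<beta>_eq using step_eq_0 by auto
  qed
  have \<beta>1: "\<beta> i t = 1" if "\<bar>t - a i\<bar> < \<epsilon> / 2" for i t
  proof -
    have "\<bar>(t - a i) / \<epsilon>\<bar> < 1 / 2" using that \<epsilon> by (simp add: field_simps)
    then have "2 - 2 * ((t - a i) / \<epsilon>) \<ge> 1" "2 + 2 * ((t - a i) / \<epsilon>) \<ge> 1" by linarith+
    then show ?thesis unfolding \<beta>_eq by (simp add: step_eq_1)
  qed
  have \<beta>: "diff_times r (\<beta> i)" for i r
    unfolding \<beta>_def[abs_def] by (intro diff_times_mult diff_times_affine diff_times_step)
  have openE: "openin (Euclidean_space n) ?E" using top by (metis openin_topspace)
  have "C_on n r ?E b" for r
    by (rule C_on_cong_subset[OF openE subset_UNIV C_on_prod_coordinates[OF \<beta>]]) (simp add: b_def)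
  then have "smooth_on n (topspace (Euclidean_space n)) b"
    by (simp add: smooth_on_def top)
  moreover have "compactin (Euclidean_space n) C"
  proof -
    have "compactin (powertop_real UNIV) C"
      unfolding C_def by (subst compactin_PiE) auto
    moreover have "C \<subseteq> ?E"
    proof (intro subsetI CollectI allI impI)
      fix x i assume "x \<in> C" "n \<le> i"
      then have "x i \<in> (if i < n then {a i - \<epsilon>..a i + \<epsilon>} else {0})"
        unfolding C_def PiE_iff by blast
      with \<open>n \<le> i\<close> show "x i = 0" by simp
    qed
    ultimately show ?thesis
      unfolding Euclidean_space_def by (simp add: compactin_subtopology)
  qed
  moreover have "C \<subseteq> V"
  proof
    fix x assume x: "x \<in> C"
    then have xi: "x i \<in> (if i < n then {a i - \<epsilon>..a i + \<epsilon>} else {0})" for i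
      unfolding C_def PiE_iff by blast
    have "\<bar>x i - a i\<bar> \<le> \<epsilon>" for i
      using xi[of i] aE \<epsilon> by (cases "i < n") auto
    moreover have "x i = 0" if "n \<le> i" for i
      using xi[of i] that by simp
    ultimately show "x \<in> V" using T inT by blast
  qed
  moreover have "b x = 0" if xC: "x \<notin> C" for x
  proof (cases "x \<in> ?E")
    case True
    obtain i where i: "i < n" "x i \<notin> {a i - \<epsilon> .. a i + \<epsilon>}"
    proof (rule ccontr)
      assume "\<not> thesis"
      then have "\<And>i. i < n \<Longrightarrow> x i \<in> {a i - \<epsilon> .. a i + \<epsilon>}" using that by blast
      then have "\<And>i. x i \<in> (if i < n then {a i - \<epsilon>..a i + \<epsilon>} else {0})"
        using True by simp
      then have "x \<in> C" unfolding C_def PiE_iff by simp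
      then show False using xC by blast
    qed
    then have "\<beta> i (x i) = 0" by (intro \<beta>0) auto
    then show ?thesis using i by (auto simp: b_def)
  next
    case False
    then show ?thesis unfolding b_def by (rule if_not_P)
  qed
  moreover have "b x = 0" if "x \<notin> topspace (Euclidean_space n)" for x
    using that unfolding b_def top by (rule if_not_P)
  moreover have "openin (Euclidean_space n) W"
  proof -
    have "open (\<Inter>i<n. {x. \<bar>x i - a i\<bar> < \<epsilon> / 2})"
      by (intro open_INT ballI open_Collect_less continuous_intros continuous_on_product_coordinates) auto
    then show ?thesis
      unfolding W_def Euclidean_space_eq_top_of_set openin_open by blast
  qed
  moreover have "a \<in> W" unfolding W_def using aE \<epsilon> by auto
  moreover have "b x = 1" if "x \<in> W" for x
    using that \<beta>1 unfolding W_def b_def by (auto intro!: prod.neutral)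
  ultimately show ?thesis
    using that[of b C W] by blast
qed

section \<open>Charts and cutoff sections\<close>

context
  fixes n k :: nat and U :: "(nat \<Rightarrow> real) set"
  assumes U: "openin (Euclidean_space n) U"
begin

private lemma smooth_on_const: "smooth_on n U (\<lambda>x. if x \<in> U then c else 0)"
  unfolding smooth_on_def by (intro allI C_on_cong_subset[OF U order.refl C_on_const[of n _ U c]]) simp

private lemma smooth_on_zero: "smooth_on n U (\<lambda>x. 0)"
  unfolding smooth_on_def by (intro allI C_on_const)

lemma power_series_zero_closed: "(\<lambda>\<alpha> x. 0) \<in> carrier (power_series_sections n k U)"
  by (simp add: power_series_sections_def smooth_on_zero)

lemma power_series_smult_one_closed:
  "c \<odot>\<^bsub>power_series_sections n k U\<^esub> \<one>\<^bsub>power_series_sections n k U\<^esub>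
    \<in> carrier (power_series_sections n k U)"
proof -
  have "smooth_on n U (\<lambda>x. c * (if \<alpha> = (\<lambda>i. 0) \<and> x \<in> U then 1 else 0))" for \<alpha> :: "nat \<Rightarrow> nat"
    using smooth_on_const[of c] smooth_on_zero by (cases "\<alpha> = (\<lambda>i. 0)") (simp_all add: if_distrib cong: if_cong)
  then show ?thesis
    by (auto simp: power_series_sections_def fun_eq_iff)
qed

lemma power_series_one_closed: "\<one>\<^bsub>power_series_sections n k U\<^esub> \<in> carrier (power_series_sections n k U)"
proof -
  have "smooth_on n U (\<lambda>x. if \<alpha> = (\<lambda>i. 0) \<and> x \<in> U then 1 else 0)" for \<alpha> :: "nat \<Rightarrow> nat"
    using smooth_on_const[of 1] smooth_on_zero by (cases "\<alpha> = (\<lambda>i. 0)") simp_all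
  then show ?thesis
    by (auto simp: power_series_sections_def fun_eq_iff)
qed

lemma power_series_C_on: "s \<in> carrier (power_series_sections n k U) \<Longrightarrow> C_on n r U (s \<alpha>)"
  by (auto simp: power_series_sections_def smooth_on_def)

lemma power_series_add_closed:
  assumes "s \<in> carrier (power_series_sections n k U)" "t \<in> carrier (power_series_sections n k U)"
  shows "s \<oplus>\<^bsub>power_series_sections n k U\<^esub> t \<in> carrier (power_series_sections n k U)"
  using assms by (auto simp: power_series_sections_def smooth_on_def intro: C_on_add)

lemma power_series_mult_closed:
  assumes s: "s \<in> carrier (power_series_sections n k U)" and t: "t \<in> carrier (power_series_sections n k U)"
  shows "s \<otimes>\<^bsub>power_series_sections n k U\<^esub> t \<in> carrier (power_series_sections n k U)"
proof -
  note C = power_series_C_on[OF s] power_series_C_on[OF t]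
  have 0: "x \<notin> U \<Longrightarrow> s \<alpha> x = 0" for \<alpha> x
    using s by (auto simp: power_series_sections_def)
  have "smooth_on n U (\<lambda>x. if \<exists>i\<ge>k. \<alpha> i \<noteq> 0 then 0
      else \<Sum>\<beta> | \<forall>i. \<beta> i \<le> \<alpha> i. s \<beta> x * t (\<lambda>i. \<alpha> i - \<beta> i) x)" for \<alpha>
  proof (cases "\<exists>i\<ge>k. \<alpha> i \<noteq> 0")
    case True
    show ?thesis
      by (simp only: True if_True smooth_on_def C_on_const simp_thms)
  next
    case False
    show ?thesis
      by (simp only: False if_False smooth_on_def) (intro allI C_on_sum C_on_mult C)
  qed
  then show ?thesis
    by (simp add: power_series_sections_def 0)
qed

text \<open>Only the zero multi-index lies below zero, so taking the constant coefficient at a point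
  is multiplicative. This detects nonunits: a unit has a nonzero constant coefficient at every point
  of \<open>U\<close>.\<close>

lemma power_series_mult_const_coeff:
  "(s \<otimes>\<^bsub>power_series_sections n k U\<^esub> t) (\<lambda>i. 0) x = s (\<lambda>i. 0) x * t (\<lambda>i. 0) x"
proof -
  have "{\<beta>::nat \<Rightarrow> nat. \<forall>i. \<beta> i \<le> 0} = {\<lambda>i. 0}" by auto
  then show ?thesis by (simp add: power_series_sections_def)
qed

lemma power_series_restr_closed:
  assumes "s \<in> carrier (power_series_sections n k U)" and V: "openin (Euclidean_space n) V" "V \<subseteq> U"
  shows "(\<lambda>\<alpha> x. if x \<in> V then s \<alpha> x else 0) \<in> carrier (power_series_sections n k V)"
proof -
  have "C_on n r V (\<lambda>x. if x \<in> V then s \<alpha> x else 0)" for r \<alpha>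
    by (rule C_on_cong_subset[OF V, of _ "s \<alpha>"])
      (use assms(1) in \<open>auto simp: power_series_sections_def smooth_on_def\<close>)
  then show ?thesis
    using assms(1) by (auto simp: power_series_sections_def smooth_on_def fun_eq_iff)
qed

end

section \<open>Charts and the sections they supply\<close>

locale formal_chart = algebra_sheaf M \<O>
  for M :: "'a topology" and \<O> :: "('a, complex, 'r) sheaf_data" +
  fixes N :: "'a set" and n k :: nat and \<phi> :: "'a \<Rightarrow> nat \<Rightarrow> real"
    and h :: "(nat \<Rightarrow> real) set \<Rightarrow> ((nat \<Rightarrow> nat) \<Rightarrow> (nat \<Rightarrow> real) \<Rightarrow> complex) \<Rightarrow> 'r"
  assumes N: "openin M N"
    and homeo: "homeomorphic_map (subtopology M N) (Euclidean_space n) \<phi>"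
    and iso: "openin (Euclidean_space n) V \<Longrightarrow>
      h V \<in> ring_iso (power_series_sections n k V) (sections \<O> {x \<in> N. \<phi> x \<in> V})"
    and scalar: "openin (Euclidean_space n) V \<Longrightarrow> s \<in> carrier (power_series_sections n k V) \<Longrightarrow>
      h V (c \<odot>\<^bsub>power_series_sections n k V\<^esub> s) = c \<odot>\<^bsub>sections \<O> {x \<in> N. \<phi> x \<in> V}\<^esub> h V s"
    and compat: "openin (Euclidean_space n) V \<Longrightarrow> openin (Euclidean_space n) W \<Longrightarrow> W \<subseteq> V \<Longrightarrow>
      s \<in> carrier (power_series_sections n k V) \<Longrightarrow>
      h W (\<lambda>\<alpha> x. if x \<in> W then s \<alpha> x else 0)
        = restr \<O> {x \<in> N. \<phi> x \<in> V} {x \<in> N. \<phi> x \<in> W} (h V s)"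
begin

abbreviation "E \<equiv> Euclidean_space n"
abbreviation "P \<equiv> power_series_sections n k"

definition pre :: "(nat \<Rightarrow> real) set \<Rightarrow> 'a set"
  where "pre V = {x \<in> N. \<phi> x \<in> V}"

lemmas iso_pre = iso[folded pre_def] and scalar_pre = scalar[folded pre_def]
  and compat_pre = compat[folded pre_def]

lemma topspace_N: "topspace (subtopology M N) = N"
  using openin_subset[OF N] by auto

lemma openin_pre: "openin E V \<Longrightarrow> openin M (pre V)"
proof -
  assume V: "openin E V"
  have "openin (subtopology M N) {x \<in> topspace (subtopology M N). \<phi> x \<in> V}"
    by (rule openin_continuous_map_preimage[OF homeomorphic_imp_continuous_map[OF homeo] V])
  then show ?thesis
    unfolding topspace_N pre_def using N by (simp add: openin_open_subtopology)
qed

lemma inj_chart: "inj_on \<phi> N"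
  using homeomorphic_imp_injective_map[OF homeo] topspace_N by simp

lemma image_chart: "\<phi> ` N = topspace E"
  using homeomorphic_imp_surjective_map[OF homeo] topspace_N by simp

lemma pre_image: "V \<subseteq> N \<Longrightarrow> pre (\<phi> ` V) = V"
  using inj_chart unfolding pre_def inj_on_def by blast

lemma image_pre: "C \<subseteq> topspace E \<Longrightarrow> \<phi> ` pre C = C"
proof (intro equalityI subsetI)
  fix y assume "C \<subseteq> topspace E" "y \<in> C"
  then have "y \<in> \<phi> ` N" unfolding image_chart by (rule subsetD)
  then obtain x where "x \<in> N" "y = \<phi> x" by (rule imageE)
  with \<open>y \<in> C\<close> have "x \<in> pre C" unfolding pre_def by simp
  with \<open>y = \<phi> x\<close> show "y \<in> \<phi> ` pre C" by (rule image_eqI)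
qed (auto simp: pre_def)

lemma chart_in_topspace: "x \<in> N \<Longrightarrow> \<phi> x \<in> topspace E"
  unfolding image_chart[symmetric] by (rule imageI)

lemma pre_topspace: "pre (topspace E) = N"
  unfolding pre_def using chart_in_topspace by (intro equalityI subsetI CollectI conjI) simp_all

lemma openin_image: "openin M V \<Longrightarrow> V \<subseteq> N \<Longrightarrow> openin E (\<phi> ` V)"
  using homeomorphic_map_openness[OF homeo, of V] openin_subset[of M V] N topspace_N
  by (simp add: openin_open_subtopology)

lemma compactin_pre: "compactin E C \<Longrightarrow> compactin M (pre C)"
proof -
  assume C: "compactin E C"
  have "pre C \<subseteq> topspace (subtopology M N)" unfolding topspace_N pre_def by blast
  moreover have "compactin E (\<phi> ` pre C)"
    using C image_pre[OF compactin_subset_topspace[OF C]] by simp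
  ultimately have "compactin (subtopology M N) (pre C)"
    using homeomorphic_map_compactness[OF homeo] by blast
  then show ?thesis unfolding compactin_subtopology by (rule conjunct1)
qed

lemma h_hom: "openin E V \<Longrightarrow> h V \<in> ring_hom (P V) (sections \<O> (pre V))"
  by (drule iso_pre) (simp only: ring_iso_def mem_Collect_eq)

lemma h_bij: "openin E V \<Longrightarrow> bij_betw (h V) (carrier (P V)) (carrier (sections \<O> (pre V)))"
  by (drule iso_pre) (simp only: ring_iso_def mem_Collect_eq)

lemma h_closed: "openin E V \<Longrightarrow> s \<in> carrier (P V) \<Longrightarrow> h V s \<in> carrier (sections \<O> (pre V))"
  by (rule ring_hom_closed[OF h_hom])

lemma h_one: "openin E V \<Longrightarrow> h V \<one>\<^bsub>P V\<^esub> = \<one>\<^bsub>sections \<O> (pre V)\<^esub>"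
  by (rule ring_hom_one[OF h_hom])

text \<open>\<open>P V\<close> has not been shown to be a ring, so zero is reached through
  additivity alone: the image of zero equals its own double.\<close>

lemma h_zero:
  assumes V: "openin E V"
  shows "h V (\<lambda>\<alpha> x. 0) = \<zero>\<^bsub>sections \<O> (pre V)\<^esub>"
proof -
  interpret cring "sections \<O> (pre V)" using openin_pre[OF V] by (rule cring_sections)
  note z = power_series_zero_closed[OF V, of k]
  have "h V ((\<lambda>\<alpha> x. 0) \<oplus>\<^bsub>P V\<^esub> (\<lambda>\<alpha> x. 0)) = h V (\<lambda>\<alpha> x. 0) \<oplus>\<^bsub>sections \<O> (pre V)\<^esub> h V (\<lambda>\<alpha> x. 0)"
    by (rule ring_hom_add[OF h_hom[OF V] z z])
  moreover have "(\<lambda>\<alpha> x. 0) \<oplus>\<^bsub>P V\<^esub> (\<lambda>\<alpha> x. 0) = (\<lambda>\<alpha> x. 0)"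
    by (simp add: power_series_sections_def)
  ultimately show ?thesis
    using h_closed[OF V z] by (intro add_idem_zero) simp_all
qed

lemma section_from_chart:
  assumes V: "openin M V" "V \<subseteq> N" and f: "f \<in> carrier (sections \<O> V)"
  obtains F where "F \<in> carrier (P (\<phi> ` V))" "h (\<phi> ` V) F = f"
proof -
  have "bij_betw (h (\<phi> ` V)) (carrier (P (\<phi> ` V))) (carrier (sections \<O> V))"
    using h_bij[OF openin_image[OF V]] pre_image[OF V(2)] by simp
  then have "f \<in> h (\<phi> ` V) ` carrier (P (\<phi> ` V))"
    using f by (simp add: bij_betw_imp_surj_on)
  then show ?thesis using that by blast
qed

text \<open>The constant coefficient of the power series is the value of the section: subtracting it
  leaves a section that is invertible on no neighbourhood.\<close>

lemma chart_value:
  assumes V: "openin M V" "V \<subseteq> N" and f: "f \<in> carrier (sections \<O> V)"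
  obtains val :: "'a \<Rightarrow> complex" where "continuous_map (subtopology M V) euclidean val"
    and "\<And>b W g. \<lbrakk>openin M W; b \<in> W; W \<subseteq> V; g \<in> carrier (sections \<O> W)\<rbrakk> \<Longrightarrow>
      (restr \<O> V W f \<ominus>\<^bsub>sections \<O> W\<^esub> val b \<odot>\<^bsub>sections \<O> W\<^esub> \<one>\<^bsub>sections \<O> W\<^esub>) \<otimes>\<^bsub>sections \<O> W\<^esub> g
        \<noteq> \<one>\<^bsub>sections \<O> W\<^esub>"
proof -
  obtain F where F: "F \<in> carrier (P (\<phi> ` V))" "h (\<phi> ` V) F = f"
    using section_from_chart[OF V f] .
  define val where "val b = F (\<lambda>i. 0) (\<phi> b)" for b
  have E: "openin E (\<phi> ` V)" using openin_image[OF V] .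
  have "C_on n 0 (\<phi> ` V) (F (\<lambda>i. 0))"
    by (rule power_series_C_on[OF E F(1)])
  then have "continuous_map (subtopology E (\<phi> ` V)) euclidean (F (\<lambda>i. 0))"
    unfolding C_on.simps .
  moreover have "continuous_map (subtopology M V) (subtopology E (\<phi> ` V)) \<phi>"
  proof -
    have "continuous_map (subtopology (subtopology M N) V) E \<phi>"
      by (rule continuous_map_from_subtopology[OF homeomorphic_imp_continuous_map[OF homeo]])
    moreover have "subtopology (subtopology M N) V = subtopology M V"
      using V(2) by (simp add: subtopology_subtopology inf.absorb2)
    ultimately show ?thesis by (auto simp: continuous_map_in_subtopology)
  qed
  ultimately have "continuous_map (subtopology M V) euclidean (F (\<lambda>i. 0) \<circ> \<phi>)"
    by (rule continuous_map_compose[rotated])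
  then have 1: "continuous_map (subtopology M V) euclidean val"
    by (simp add: val_def[abs_def] comp_def)
  have 2: False
    if W: "openin M W" "b \<in> W" "W \<subseteq> V" and g: "g \<in> carrier (sections \<O> W)"
      and eq: "(restr \<O> V W f \<ominus>\<^bsub>sections \<O> W\<^esub> val b \<odot>\<^bsub>sections \<O> W\<^esub> \<one>\<^bsub>sections \<O> W\<^esub>) \<otimes>\<^bsub>sections \<O> W\<^esub> g
        = \<one>\<^bsub>sections \<O> W\<^esub>" for b W g
  proof -
    interpret W: algebra complex_ring "sections \<O> W" using W(1) by (rule algebra_sections)
    have WN: "W \<subseteq> N" using W V by blast
    note E' = openin_image[OF W(1) WN]
    have pW: "pre (\<phi> ` W) = W" and pV: "pre (\<phi> ` V) = V"
      using pre_image WN V by auto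
    let ?c = "val b \<odot>\<^bsub>sections \<O> W\<^esub> \<one>\<^bsub>sections \<O> W\<^esub>"
    let ?H = "h (\<phi> ` W)" and ?PW = "P (\<phi> ` W)"
    have H: "?H \<in> ring_hom ?PW (sections \<O> W)" and inj: "inj_on ?H (carrier ?PW)"
      using h_hom[OF E'] bij_betw_imp_inj_on[OF h_bij[OF E']] pW by simp_all
    have c: "?c \<in> carrier (sections \<O> W)" by (rule W.smult_closed) auto
    have fW: "restr \<O> V W f \<in> carrier (sections \<O> W)"
      using restr_closed[OF V(1) W(1,3) f] .
    obtain G where G: "G \<in> carrier ?PW" "?H G = g"
      using section_from_chart[OF W(1) WN g] .
    have "restr \<O> V W f \<ominus>\<^bsub>sections \<O> W\<^esub> ?c \<in> carrier (sections \<O> W)"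
      using fW c by simp
    then obtain Y where Y: "Y \<in> carrier ?PW" "?H Y = restr \<O> V W f \<ominus>\<^bsub>sections \<O> W\<^esub> ?c"
      using section_from_chart[OF W(1) WN] by blast
    \<comment> \<open>Subtraction is avoided on the power series side: \<open>Y\<close> is the
      preimage of the difference, and adding the constant \<open>?C\<close> back recovers the
      restriction of \<open>F\<close>.\<close>
    let ?C = "val b \<odot>\<^bsub>?PW\<^esub> \<one>\<^bsub>?PW\<^esub>"
    have C: "?C \<in> carrier ?PW" by (rule power_series_smult_one_closed[OF E'])
    have HC: "?H ?C = ?c"
      using scalar_pre[OF E' power_series_one_closed[OF E']] h_one[OF E'] pW by simp
    have "?H (Y \<otimes>\<^bsub>?PW\<^esub> G) = ?H \<one>\<^bsub>?PW\<^esub>"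
      using ring_hom_mult[OF H Y(1) G(1)] ring_hom_one[OF H] Y(2) G(2) eq by simp
    then have "Y \<otimes>\<^bsub>?PW\<^esub> G = \<one>\<^bsub>?PW\<^esub>"
      using inj_onD[OF inj] power_series_mult_closed[OF E' Y(1) G(1)] power_series_one_closed[OF E'] by blast
    \<comment> \<open>Constant coefficients at the image of \<open>b\<close> are compared: the right
      inverse forces that of \<open>Y\<close> to be nonzero, while the identity of \<open>Y\<close>
      plus \<open>?C\<close> with \<open>?F\<close> below forces it to be zero.\<close>
    then have YG: "Y (\<lambda>i. 0) (\<phi> b) * G (\<lambda>i. 0) (\<phi> b) = 1"
      using power_series_mult_const_coeff[OF E', of k Y G "\<phi> b"] W(2)
      by (simp add: power_series_sections_def)
    let ?F = "\<lambda>\<alpha> x. if x \<in> \<phi> ` W then F \<alpha> x else 0"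
    have "?H (Y \<oplus>\<^bsub>?PW\<^esub> ?C) = (restr \<O> V W f \<ominus>\<^bsub>sections \<O> W\<^esub> ?c) \<oplus>\<^bsub>sections \<O> W\<^esub> ?c"
      using ring_hom_add[OF H Y(1) C] Y(2) HC by simp
    also have "\<dots> = restr \<O> V W f"
      using fW c by (simp add: W.M.minus_eq W.M.a_assoc W.M.l_neg)
    also have "\<dots> = ?H ?F"
      using compat_pre[OF E E' image_mono[OF W(3)] F(1)] F(2) pW pV by simp
    finally have "Y \<oplus>\<^bsub>?PW\<^esub> ?C = ?F"
      using inj_onD[OF inj] power_series_add_closed[OF E' Y(1) C]
        power_series_restr_closed[OF E F(1) E' image_mono[OF W(3)]] by blast
    then have "(Y \<oplus>\<^bsub>?PW\<^esub> ?C) (\<lambda>i. 0) (\<phi> b) = val b"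
      using W(2) by (simp add: val_def)
    then have "Y (\<lambda>i. 0) (\<phi> b) = 0"
      using W(2) by (simp add: power_series_sections_def)
    with YG show False by simp
  qed
  show ?thesis by (rule that[OF 1]) (use 2 in blast)
qed

text \<open>The Euclidean bump is used as the constant coefficient of a power series whose other
  coefficients are zero; it then restricts to the zero and to the unit power series, which
  \<open>h\<close> preserves.\<close>

lemma chart_bump:
  assumes V: "openin M V" and a: "a \<in> V" "a \<in> N"
  obtains f C W where "f \<in> carrier (sections \<O> N)" "compactin M C" "C \<subseteq> V" "C \<subseteq> N"
    and "restr \<O> N (N - C) f = \<zero>\<^bsub>sections \<O> (N - C)\<^esub>"
    and "openin M W" "a \<in> W" "W \<subseteq> N" "restr \<O> N W f = \<one>\<^bsub>sections \<O> W\<^esub>"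
proof -
  have VN: "openin M (V \<inter> N)" "V \<inter> N \<subseteq> N" using V N by auto
  have "\<phi> a \<in> \<phi> ` (V \<inter> N)" using a by blast
  then obtain b C W where b: "smooth_on n (topspace E) b" "\<And>x. x \<notin> topspace E \<Longrightarrow> b x = 0"
    and C: "compactin E C" "C \<subseteq> \<phi> ` (V \<inter> N)" "\<And>x. x \<notin> C \<Longrightarrow> b x = 0"
    and W: "openin E W" "\<phi> a \<in> W" "\<And>x. x \<in> W \<Longrightarrow> b x = 1"
    by (rule Euclidean_bump[OF openin_image[OF VN]]) blast
  have E: "openin E (topspace E)" by simp
  have CE: "C \<subseteq> topspace E" using compactin_subset_topspace[OF C(1)] .
  define s where "s = (\<lambda>(\<alpha>::nat \<Rightarrow> nat) x. if \<alpha> = (\<lambda>i. 0) then b x else 0)"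
  have s: "s \<in> carrier (P (topspace E))"
  proof -
    have "smooth_on n (topspace E) (s \<alpha>)" for \<alpha>
      using b(1) unfolding s_def by (cases "\<alpha> = (\<lambda>i. 0)") (simp_all add: smooth_on_def C_on_const)
    then show ?thesis
      using b(2) by (auto simp: power_series_sections_def s_def fun_eq_iff)
  qed
  define f where "f = h (topspace E) s"
  have cs: "h Z (\<lambda>\<alpha> x. if x \<in> Z then s \<alpha> x else 0) = restr \<O> N (pre Z) f" if "openin E Z" for Z
    using compat_pre[OF E that openin_subset[OF that] s] pre_topspace unfolding f_def by simp
  have NC: "openin E (topspace E - C)"
    using compactin_imp_closedin[OF Hausdorff_Euclidean_space C(1)] by (rule openin_diff[OF E])
  have preC: "pre (topspace E - C) = N - pre C"
    unfolding pre_def using chart_in_topspace by auto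
  show ?thesis
  proof (rule that)
    show "f \<in> carrier (sections \<O> N)"
      using h_closed[OF E s] pre_topspace unfolding f_def by simp
    show "compactin M (pre C)" by (rule compactin_pre[OF C(1)])
    have "pre C \<subseteq> pre (\<phi> ` (V \<inter> N))" using C(2) unfolding pre_def by blast
    then show "pre C \<subseteq> V" "pre C \<subseteq> N" using pre_image[OF VN(2)] by auto
    have "(\<lambda>\<alpha> x. if x \<in> topspace E - C then s \<alpha> x else 0) = (\<lambda>\<alpha> x. 0)"
      using C(3) by (auto simp: s_def fun_eq_iff)
    then show "restr \<O> N (N - pre C) f = \<zero>\<^bsub>sections \<O> (N - pre C)\<^esub>"
      using cs[OF NC] h_zero[OF NC] unfolding preC by simp
    show "openin M (pre W)" by (rule openin_pre[OF W(1)])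
    show "a \<in> pre W" "pre W \<subseteq> N" using a W(2) unfolding pre_def by auto
    have "(\<lambda>\<alpha> x. if x \<in> W then s \<alpha> x else 0) = \<one>\<^bsub>P W\<^esub>"
      using W(3) by (auto simp: s_def power_series_sections_def fun_eq_iff)
    then show "restr \<O> N (pre W) f = \<one>\<^bsub>sections \<O> (pre W)\<^esub>"
      using cs[OF W(1)] h_one[OF W(1)] by simp
  qed
qed

end

section \<open>Global cutoff sections\<close>

context formal_manifold
begin

lemma obtain_chart:
  assumes "a \<in> topspace M"
  obtains N n k \<phi> h where "formal_chart M \<O> N n k \<phi> h" "a \<in> N"
proof -
  obtain N n k where N: "openin M N" "a \<in> N"
    and iso: "ringed_space_iso (subtopology M N) \<O> (Euclidean_space n) (euclidean_formal_sheaf n k)"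
    using chart[OF assms] by blast
  have top: "topspace (subtopology M N) = N" using openin_subset[OF N(1)] by auto
  let ?E = "Euclidean_space n" and ?P = "power_series_sections n k"
  obtain \<phi> h where hom: "homeomorphic_map (subtopology M N) ?E \<phi>"
    and h: "\<forall>V. openin ?E V \<longrightarrow> h V \<in> ring_iso (?P V) (sections \<O> {x \<in> N. \<phi> x \<in> V}) \<and>
        (\<forall>c. \<forall>s\<in>carrier (?P V). h V (c \<odot>\<^bsub>?P V\<^esub> s) = c \<odot>\<^bsub>sections \<O> {x \<in> N. \<phi> x \<in> V}\<^esub> h V s)"
    and compat: "\<forall>V W. openin ?E V \<and> openin ?E W \<and> W \<subseteq> V \<longrightarrow> (\<forall>s\<in>carrier (?P V).
        h W (\<lambda>\<alpha> x. if x \<in> W then s \<alpha> x else 0)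
          = restr \<O> {x \<in> N. \<phi> x \<in> V} {x \<in> N. \<phi> x \<in> W} (h V s))"
    using iso[unfolded ringed_space_iso_def Let_def top euclidean_formal_sheaf_def sheaf_data.simps]
    by (elim exE conjE) (rule that)
  have "formal_chart_axioms M \<O> N n k \<phi> h"
  proof (rule formal_chart_axioms.intro[OF N(1) hom])
    fix V W c s assume V: "openin ?E V"
    show "h V \<in> ring_iso (?P V) (sections \<O> {x \<in> N. \<phi> x \<in> V})"
      using h V by blast
    assume s: "s \<in> carrier (?P V)"
    then show "h V (c \<odot>\<^bsub>?P V\<^esub> s) = c \<odot>\<^bsub>sections \<O> {x \<in> N. \<phi> x \<in> V}\<^esub> h V s"
      using h V by blast
    assume "openin ?E W" "W \<subseteq> V"
    then show "h W (\<lambda>\<alpha> x. if x \<in> W then s \<alpha> x else 0)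
        = restr \<O> {x \<in> N. \<phi> x \<in> V} {x \<in> N. \<phi> x \<in> W} (h V s)"
      using compat V s by simp
  qed
  then have "formal_chart M \<O> N n k \<phi> h"
    by (intro formal_chart.intro algebra_sheaf_axioms)
  then show ?thesis using N(2) by (rule that)
qed

text \<open>The section given by the chart is glued with zero off \<open>C\<close>; the complement
  of \<open>C\<close> is open because compact sets are closed.\<close>

lemma local_bump:
  assumes V: "openin M V" and a: "a \<in> V"
  obtains f C W where "f \<in> carrier (sections \<O> (topspace M))" "compactin M C" "C \<subseteq> V"
    and "restr \<O> (topspace M) (topspace M - C) f = \<zero>\<^bsub>sections \<O> (topspace M - C)\<^esub>"
    and "openin M W" "a \<in> W" "restr \<O> (topspace M) W f = \<one>\<^bsub>sections \<O> W\<^esub>"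
proof -
  have "a \<in> topspace M" using openin_subset[OF V] a by blast
  then obtain N n k \<phi> h where ch: "formal_chart M \<O> N n k \<phi> h" and aN: "a \<in> N"
    by (rule obtain_chart)
  interpret formal_chart M \<O> N n k \<phi> h by fact
  obtain f C W where f: "f \<in> carrier (sections \<O> N)" and C: "compactin M C" "C \<subseteq> V" "C \<subseteq> N"
    and f0: "restr \<O> N (N - C) f = \<zero>\<^bsub>sections \<O> (N - C)\<^esub>"
    and W: "openin M W" "a \<in> W" "W \<subseteq> N" "restr \<O> N W f = \<one>\<^bsub>sections \<O> W\<^esub>"
    using chart_bump[OF V a aN] .
  have NA: "N \<subseteq> topspace M" using openin_subset[OF N] .
  have AC: "openin M (topspace M - C)" and NC: "openin M (N - C)"
    using compactin_imp_closedin[OF Hausdorff C(1)] N by auto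
  interpret AC: cring "sections \<O> (topspace M - C)" using AC by (rule cring_sections)
  have un: "N \<union> (topspace M - C) = topspace M" using C NA by blast
  have int: "N \<inter> (topspace M - C) = N - C" using NA by blast
  have "restr \<O> N (N \<inter> (topspace M - C)) f
      = restr \<O> (topspace M - C) (N \<inter> (topspace M - C)) \<zero>\<^bsub>sections \<O> (topspace M - C)\<^esub>"
    unfolding int f0 using restr_zero[OF AC NC Diff_mono[OF NA order.refl]] by simp
  then obtain g where g: "g \<in> carrier (sections \<O> (topspace M))" "restr \<O> (topspace M) N g = f"
    "restr \<O> (topspace M) (topspace M - C) g = \<zero>\<^bsub>sections \<O> (topspace M - C)\<^esub>"
    using glue2[OF N AC un f AC.zero_closed] by metis
  have "restr \<O> (topspace M) W g = restr \<O> N W (restr \<O> (topspace M) N g)"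
    using restr_restr[OF openin_topspace N W(1,3) NA g(1)] by simp
  then show ?thesis
    using that[OF g(1) C(1,2) g(3) W(1,2)] g(2) W(4) by simp
qed

text \<open>From \<open>f\<close> and \<open>g\<close> that are \<open>1\<close> near \<open>K\<close> and \<open>L\<close>, the section \<open>f + (1 - f) g\<close> is \<open>1\<close> near
  \<open>K \<union> L\<close>: this replaces partitions of unity.\<close>

lemma finite_cover_bump:
  assumes U: "\<And>\<gamma>. \<gamma> \<in> \<Gamma> \<Longrightarrow> openin M (U \<gamma>)"
    and K: "compactin M K" "K \<subseteq> (\<Union>\<gamma>\<in>\<Gamma>. U \<gamma>)"
    and G: "G \<subseteq> carrier (sections \<O> (topspace M))"
    and G_supp: "\<And>f C \<gamma>. \<lbrakk>\<gamma> \<in> \<Gamma>; compactin M C; C \<subseteq> U \<gamma>; f \<in> carrier (sections \<O> (topspace M));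
        restr \<O> (topspace M) (topspace M - C) f = \<zero>\<^bsub>sections \<O> (topspace M - C)\<^esub>\<rbrakk> \<Longrightarrow> f \<in> G"
    and G_add: "\<And>f g. f \<in> G \<Longrightarrow> g \<in> G \<Longrightarrow> f \<oplus>\<^bsub>sections \<O> (topspace M)\<^esub> g \<in> G"
    and G_mult: "\<And>f g. f \<in> carrier (sections \<O> (topspace M)) \<Longrightarrow> g \<in> G \<Longrightarrow>
        f \<otimes>\<^bsub>sections \<O> (topspace M)\<^esub> g \<in> G"
    and G_zero: "\<zero>\<^bsub>sections \<O> (topspace M)\<^esub> \<in> G"
  obtains f W where "f \<in> G" "openin M W" "K \<subseteq> W" "restr \<O> (topspace M) W f = \<one>\<^bsub>sections \<O> W\<^esub>"
proof -
  let ?A = "topspace M"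
  interpret A: cring "sections \<O> ?A" by (rule cring_sections) simp
  \<comment> \<open>Goodness passes to finite unions, so by compactness it is enough to find a good
    neighbourhood of each point of \<open>K\<close>.\<close>
  define good where "good W \<longleftrightarrow> openin M W \<and> (\<exists>f\<in>G. restr \<O> ?A W f = \<one>\<^bsub>sections \<O> W\<^esub>)" for W
  have WA: "W \<subseteq> ?A" if "good W" for W
    using that openin_subset unfolding good_def by blast
  have good_Un: "good (V \<union> W)" if VW: "good V" "good W" for V W
  proof -
    obtain f g where V: "openin M V" and f: "f \<in> G" "restr \<O> ?A V f = \<one>\<^bsub>sections \<O> V\<^esub>"
      and W: "openin M W" and g: "g \<in> G" "restr \<O> ?A W g = \<one>\<^bsub>sections \<O> W\<^esub>"
      using VW unfolding good_def by blast
    have un: "openin M (V \<union> W)" using V W by blast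
    note VA = openin_subset[OF V] and WA = openin_subset[OF W] and uA = openin_subset[OF un]
    interpret u: cring "sections \<O> (V \<union> W)" using un by (rule cring_sections)
    interpret V: cring "sections \<O> V" using V by (rule cring_sections)
    interpret W: cring "sections \<O> W" using W by (rule cring_sections)
    have fA: "f \<in> carrier (sections \<O> ?A)" and gA: "g \<in> carrier (sections \<O> ?A)"
      using f g G by auto
    let ?d = "\<one>\<^bsub>sections \<O> ?A\<^esub> \<ominus>\<^bsub>sections \<O> ?A\<^esub> f"
    let ?e = "f \<oplus>\<^bsub>sections \<O> ?A\<^esub> ?d \<otimes>\<^bsub>sections \<O> ?A\<^esub> g"
    have d: "?d \<in> carrier (sections \<O> ?A)" using fA by simp
    have e: "?e \<in> G" using G_add[OF f(1) G_mult[OF d g(1)]] .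
    have eA: "?e \<in> carrier (sections \<O> ?A)" using e G by blast
    have r: "restr \<O> ?A Z ?e = restr \<O> ?A Z f \<oplus>\<^bsub>sections \<O> Z\<^esub>
        (\<one>\<^bsub>sections \<O> Z\<^esub> \<ominus>\<^bsub>sections \<O> Z\<^esub> restr \<O> ?A Z f) \<otimes>\<^bsub>sections \<O> Z\<^esub> restr \<O> ?A Z g"
      if "openin M Z" "Z \<subseteq> ?A" for Z
      using that fA gA d by (simp add: restr_add restr_mult restr_minus restr_one)
    have "restr \<O> ?A (V \<union> W) ?e = \<one>\<^bsub>sections \<O> (V \<union> W)\<^esub>"
    proof (rule locality2[OF V W refl])
      show "restr \<O> ?A (V \<union> W) ?e \<in> carrier (sections \<O> (V \<union> W))"
        using restr_closed[OF openin_topspace un uA eA] .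
      have "restr \<O> (V \<union> W) V (restr \<O> ?A (V \<union> W) ?e) = restr \<O> ?A V ?e"
        using restr_restr[OF openin_topspace un V _ uA eA] by simp
      also have "\<dots> = \<one>\<^bsub>sections \<O> V\<^esub>"
        unfolding r[OF V VA] f(2) using restr_closed[OF openin_topspace V VA gA]
        by (simp add: V.minus_eq V.r_neg)
      finally show "restr \<O> (V \<union> W) V (restr \<O> ?A (V \<union> W) ?e) = restr \<O> (V \<union> W) V \<one>\<^bsub>sections \<O> (V \<union> W)\<^esub>"
        using restr_one[OF un V] by simp
      have "restr \<O> (V \<union> W) W (restr \<O> ?A (V \<union> W) ?e) = restr \<O> ?A W ?e"
        using restr_restr[OF openin_topspace un W _ uA eA] by simp
      also have "\<dots> = \<one>\<^bsub>sections \<O> W\<^esub>"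
        unfolding r[OF W WA] g(2) using restr_closed[OF openin_topspace W WA fA]
        by (simp add: W.minus_eq W.a_lcomm[of "restr \<O> ?A W f"] W.r_neg)
      finally show "restr \<O> (V \<union> W) W (restr \<O> ?A (V \<union> W) ?e) = restr \<O> (V \<union> W) W \<one>\<^bsub>sections \<O> (V \<union> W)\<^esub>"
        using restr_one[OF un W] by simp
    qed simp
    then show ?thesis
      unfolding good_def using e un by blast
  qed
  \<comment> \<open>Over the empty set zero equals one, by locality for the empty cover, so the zero
    section serves. This starts the induction over finite unions.\<close>
  have good_empty: "good {}"
  proof -
    interpret e: cring "sections \<O> {}" by (rule cring_sections) simp
    have "\<zero>\<^bsub>sections \<O> {}\<^esub> = \<one>\<^bsub>sections \<O> {}\<^esub>"
      by (rule locality[of "{}"]) simp_all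
    then show ?thesis
      unfolding good_def using G_zero restr_zero[of ?A "{}"] by auto
  qed
  have good_Union: "finite \<W> \<Longrightarrow> \<forall>W\<in>\<W>. good W \<Longrightarrow> good (\<Union>\<W>)" for \<W>
    by (induction \<W> rule: finite_induct) (auto intro: good_empty good_Un)
  have "\<exists>W. good W \<and> a \<in> W" if aK: "a \<in> K" for a
  proof -
    obtain \<gamma> where \<gamma>: "\<gamma> \<in> \<Gamma>" "a \<in> U \<gamma>" using K(2) aK by blast
    obtain f C W where fC: "f \<in> carrier (sections \<O> ?A)" "compactin M C" "C \<subseteq> U \<gamma>"
        "restr \<O> ?A (?A - C) f = \<zero>\<^bsub>sections \<O> (?A - C)\<^esub>"
      and W: "openin M W" "a \<in> W" "restr \<O> ?A W f = \<one>\<^bsub>sections \<O> W\<^esub>"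
      using local_bump[OF U[OF \<gamma>(1)] \<gamma>(2)] .
    have "f \<in> G" using G_supp[OF \<gamma>(1) fC(2,3,1,4)] .
    then show ?thesis using W unfolding good_def by blast
  qed
  then have "K \<subseteq> \<Union>{W. good W}" by blast
  moreover have "\<forall>W\<in>{W. good W}. openin M W" by (simp add: good_def)
  ultimately obtain \<W> where "finite \<W>" "\<W> \<subseteq> {W. good W}" "K \<subseteq> \<Union>\<W>"
    using compactinD[OF K(1), of "{W. good W}"] by auto
  then have "good (\<Union>\<W>)" "K \<subseteq> \<Union>\<W>" using good_Union by auto
  then show ?thesis using that unfolding good_def by blast
qed

end

section \<open>Germs and residues\<close>

text \<open>Since \<open>x\<close> is not a unit, its principal ideal omits \<open>\<one>\<close>.
  Zorn's lemma applies to the ideals that contain \<open>x\<close> and omit \<open>\<one>\<close>,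
  and a maximal one among them is a maximal ideal of the ring.\<close>

lemma (in cring) nonunit_in_maximalideal:
  assumes x: "x \<in> carrier R" "x \<notin> Units R"
  obtains m where "maximalideal m R" "x \<in> m"
proof -
  define \<I> where "\<I> = {I. ideal I R \<and> x \<in> I \<and> \<one> \<notin> I}"
  have "PIdl x \<in> \<I>"
  proof -
    have "\<one> \<notin> PIdl x"
    proof
      assume "\<one> \<in> PIdl x"
      then obtain y where "y \<in> carrier R" "\<one> = y \<otimes> x" unfolding cgenideal_def by auto
      then have "y \<otimes> x = \<one>" "x \<otimes> y = \<one>" using x(1) by (simp_all add: m_comm)
      then have "x \<in> Units R" using x(1) \<open>y \<in> carrier R\<close> unfolding Units_def by blast
      with x(2) show False by simp
    qed
    then show ?thesis
      using cgenideal_ideal[OF x(1)] cgenideal_self[OF x(1)] unfolding \<I>_def by simp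
  qed
  then have ne: "\<I> \<noteq> {}" by blast
  have "\<exists>m\<in>\<I>. \<forall>I\<in>\<I>. m \<subseteq> I \<longrightarrow> I = m"
  proof (rule subset_Zorn_nonempty[OF ne])
    fix \<C> assume \<C>: "\<C> \<noteq> {}" "subset.chain \<I> \<C>"
    then have "subset.chain {I. ideal I R} \<C>"
      unfolding pred_on.chain_def \<I>_def by blast
    then have "ideal (\<Union>\<C>) R"
      using chain_Union_is_ideal[of \<C>] \<C>(1) by simp
    moreover have "x \<in> \<Union>\<C>" "\<one> \<notin> \<Union>\<C>"
      using \<C> unfolding pred_on.chain_def \<I>_def by blast+
    ultimately show "\<Union>\<C> \<in> \<I>" unfolding \<I>_def by blast
  qed
  then obtain m where m: "m \<in> \<I>" "\<And>I. I \<in> \<I> \<Longrightarrow> m \<subseteq> I \<Longrightarrow> I = m" by blast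
  have "maximalideal m R"
  proof (rule maximalidealI)
    show "ideal m R" "carrier R \<noteq> m" using m(1) unfolding \<I>_def by auto
    fix J assume J: "ideal J R" "m \<subseteq> J" "J \<subseteq> carrier R"
    show "J = m \<or> J = carrier R"
    proof (cases "\<one> \<in> J")
      case True
      then show ?thesis using ideal.one_imp_carrier[OF J(1)] by blast
    next
      case False
      then have "J \<in> \<I>" using J m(1) unfolding \<I>_def by blast
      then show ?thesis using m(2) J(2) by blast
    qed
  qed
  then show ?thesis using m(1) that unfolding \<I>_def by blast
qed

section \<open>Germs and the operations of the stalks\<close>

context set_sheaf
begin

text \<open>The equivalence relation behind \<open>germ\<close>, which collects all representatives
  that agree with a given one; it has to relate sections over different domains.\<close>

definition agree :: "'a \<Rightarrow> 'a set \<Rightarrow> 's \<Rightarrow> 'a set \<Rightarrow> 's \<Rightarrow> bool"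
  where "agree a U s V t \<longleftrightarrow> (\<exists>W. openin M W \<and> a \<in> W \<and> W \<subseteq> U \<inter> V \<and> restr S U W s = restr S V W t)"

lemma agree_sym: "agree a U s V t \<Longrightarrow> agree a V t U s"
  unfolding agree_def by (metis Int_commute)

lemma agree_trans:
  assumes "openin M U" "s \<in> carrier (sections S U)" "openin M V" "t \<in> carrier (sections S V)"
    "openin M Z" "r \<in> carrier (sections S Z)" and "agree a U s V t" "agree a V t Z r"
  shows "agree a U s Z r"
proof -
  obtain W where W: "openin M W" "a \<in> W" "W \<subseteq> U \<inter> V" "restr S U W s = restr S V W t"
    using assms(7) unfolding agree_def by blast
  obtain W' where W': "openin M W'" "a \<in> W'" "W' \<subseteq> V \<inter> Z" "restr S V W' t = restr S Z W' r"
    using assms(8) unfolding agree_def by blast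
  have i: "openin M (W \<inter> W')" using W W' by blast
  have "restr S U (W \<inter> W') s = restr S W (W \<inter> W') (restr S U W s)"
    by (rule restr_restr[symmetric]) (use W W' i assms in auto)
  also have "\<dots> = restr S V (W \<inter> W') t"
    unfolding W(4) by (rule restr_restr) (use W W' i assms in auto)
  also have "\<dots> = restr S W' (W \<inter> W') (restr S V W' t)"
    by (rule restr_restr[symmetric]) (use W W' i assms in auto)
  also have "\<dots> = restr S Z (W \<inter> W') r"
    unfolding W'(4) by (rule restr_restr) (use W W' i assms in auto)
  finally show ?thesis
    unfolding agree_def using i W W' by (intro exI[of _ "W \<inter> W'"]) auto
qed

lemma mem_germ:
  "(V, t) \<in> germ M S a U s \<longleftrightarrow> openin M V \<and> a \<in> V \<and> t \<in> carrier (sections S V) \<and> agree a U s V t"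
  by (simp add: germ_def agree_def)

lemma agree_refl: "openin M U \<Longrightarrow> a \<in> U \<Longrightarrow> agree a U s U s"
  unfolding agree_def by auto

lemma germ_self: "openin M U \<Longrightarrow> a \<in> U \<Longrightarrow> s \<in> carrier (sections S U) \<Longrightarrow> (U, s) \<in> germ M S a U s"
  by (simp add: mem_germ agree_refl)

lemma germ_eq_iff:
  assumes U: "openin M U" "a \<in> U" "s \<in> carrier (sections S U)"
    and V: "openin M V" "a \<in> V" "t \<in> carrier (sections S V)"
  shows "germ M S a U s = germ M S a V t \<longleftrightarrow> agree a U s V t"
proof
  assume "germ M S a U s = germ M S a V t"
  then have "(V, t) \<in> germ M S a U s" using germ_self[OF V] by simp
  then show "agree a U s V t" by (simp add: mem_germ)
next
  assume a: "agree a U s V t"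
  show "germ M S a U s = germ M S a V t"
  proof (rule Set.set_eqI)
    fix p :: "'a set \<times> 's"
    obtain Z r where p: "p = (Z, r)" by (cases p)
    show "p \<in> germ M S a U s \<longleftrightarrow> p \<in> germ M S a V t"
      unfolding p mem_germ
      using agree_trans[OF V(1,3) U(1,3) _ _ agree_sym[OF a], of Z r]
        agree_trans[OF U(1,3) V(1,3) _ _ a, of Z r] by blast
  qed
qed

lemma germ_restr:
  assumes "openin M U" "openin M V" "V \<subseteq> U" "a \<in> V" "s \<in> carrier (sections S U)"
  shows "germ M S a V (restr S U V s) = germ M S a U s"
proof -
  have "agree a V (restr S U V s) U s"
    unfolding agree_def using assms by (intro exI[of _ V]) (auto simp: restr_self restr_closed)
  then show ?thesis using assms by (subst germ_eq_iff) (auto simp: restr_closed)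
qed

text \<open>Every pair of representatives yields the same germ: \<open>f\<close> commutes with
  restriction, and one may pass to a common neighbourhood. So \<open>germ_op\<close> is a union of
  equal sets over a nonempty index set.\<close>

lemma germ_op_germ:
  assumes U: "openin M U" "a \<in> U" and s: "s \<in> carrier (sections S U)" and t: "t \<in> carrier (sections S U)"
    and closed: "\<And>W x y. \<lbrakk>openin M W; x \<in> carrier (sections S W); y \<in> carrier (sections S W)\<rbrakk>
      \<Longrightarrow> f W x y \<in> carrier (sections S W)"
    and compat: "\<And>W W' x y. \<lbrakk>openin M W; openin M W'; W' \<subseteq> W; x \<in> carrier (sections S W);
        y \<in> carrier (sections S W)\<rbrakk> \<Longrightarrow> restr S W W' (f W x y) = f W' (restr S W W' x) (restr S W W' y)"
  shows "germ_op M S a f (germ M S a U s) (germ M S a U t) = germ M S a U (f U s t)"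
proof -
  have eq: "germ M S a (V \<inter> W) (f (V \<inter> W) (restr S V (V \<inter> W) s') (restr S W (V \<inter> W) t')) = germ M S a U (f U s t)"
    if "(V, s') \<in> germ M S a U s" "(W, t') \<in> germ M S a U t" for V s' W t'
  proof -
    have V: "openin M V" "a \<in> V" "s' \<in> carrier (sections S V)" and "agree a U s V s'"
      and W: "openin M W" "a \<in> W" "t' \<in> carrier (sections S W)" and "agree a U t W t'"
      using that by (simp_all add: mem_germ)
    then obtain Z Z' where Z: "openin M Z" "a \<in> Z" "Z \<subseteq> U \<inter> V" "restr S U Z s = restr S V Z s'"
      and Z': "openin M Z'" "a \<in> Z'" "Z' \<subseteq> U \<inter> W" "restr S U Z' t = restr S W Z' t'"
      unfolding agree_def by blast
    let ?Z = "Z \<inter> Z'" and ?V = "V \<inter> W"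
    have i: "openin M ?Z" "openin M ?V" using V W Z Z' by auto
    have s': "restr S V ?V s' \<in> carrier (sections S ?V)" and t': "restr S W ?V t' \<in> carrier (sections S ?V)"
      using V W i by (auto intro: restr_closed)
    have "restr S ?V ?Z (f ?V (restr S V ?V s') (restr S W ?V t'))
        = f ?Z (restr S ?V ?Z (restr S V ?V s')) (restr S ?V ?Z (restr S W ?V t'))"
      by (rule compat) (use i s' t' Z Z' in auto)
    also have "restr S ?V ?Z (restr S V ?V s') = restr S Z ?Z (restr S V Z s')"
      using i V Z Z' by (subst (1 2) restr_restr) auto
    also have "\<dots> = restr S U ?Z s"
      unfolding Z(4)[symmetric] using i U Z s by (intro restr_restr) auto
    also have "restr S ?V ?Z (restr S W ?V t') = restr S Z' ?Z (restr S W Z' t')"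
      using i W Z Z' by (subst (1 2) restr_restr) auto
    also have "\<dots> = restr S U ?Z t"
      unfolding Z'(4)[symmetric] using i U Z' t by (intro restr_restr) auto
    also have "f ?Z (restr S U ?Z s) (restr S U ?Z t) = restr S U ?Z (f U s t)"
      by (rule compat[symmetric]) (use U i s t Z in auto)
    finally have "agree a ?V (f ?V (restr S V ?V s') (restr S W ?V t')) U (f U s t)"
      unfolding agree_def using i Z Z' by (intro exI[of _ ?Z]) auto
    then show ?thesis
      using i U V W s' t' s t closed by (subst germ_eq_iff) auto
  qed
  have "germ_op M S a f (germ M S a U s) (germ M S a U t)
      = (\<Union>p\<in>germ M S a U s. \<Union>q\<in>germ M S a U t. germ M S a U (f U s t))"
    unfolding germ_op_def
    by (intro SUP_cong refl) (auto intro!: SUP_cong simp: eq split: prod.splits)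
  also have "\<dots> = germ M S a U (f U s t)"
    using germ_self[OF U s] germ_self[OF U t] by blast
  finally show ?thesis .
qed

end

context algebra_sheaf
begin

abbreviation "R a \<equiv> stalk M \<O> a"

definition const :: "'a set \<Rightarrow> complex \<Rightarrow> 'r"
  where "const U c = c \<odot>\<^bsub>sections \<O> U\<^esub> \<one>\<^bsub>sections \<O> U\<^esub>"

lemma const:
  assumes "openin M U"
  shows const_closed: "const U c \<in> carrier (sections \<O> U)"
    and const_add: "const U (c + d) = const U c \<oplus>\<^bsub>sections \<O> U\<^esub> const U d"
    and const_mult: "const U (c * d) = const U c \<otimes>\<^bsub>sections \<O> U\<^esub> const U d"
    and const_one: "const U 1 = \<one>\<^bsub>sections \<O> U\<^esub>"
    and const_zero: "const U 0 = \<zero>\<^bsub>sections \<O> U\<^esub>"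
proof -
  interpret O: algebra complex_ring "sections \<O> U" using assms by (rule algebra_sections)
  show cl: "const U c \<in> carrier (sections \<O> U)" for c
    unfolding const_def by (rule O.smult_closed) auto
  show "const U (c + d) = const U c \<oplus>\<^bsub>sections \<O> U\<^esub> const U d"
    using O.smult_l_distr[of c d "\<one>\<^bsub>sections \<O> U\<^esub>"] by (simp add: const_def)
  show "const U (c * d) = const U c \<otimes>\<^bsub>sections \<O> U\<^esub> const U d"
    using O.smult_assoc2[of c "\<one>\<^bsub>sections \<O> U\<^esub>" "const U d"]
      O.smult_assoc1[of c d "\<one>\<^bsub>sections \<O> U\<^esub>"] cl by (simp add: const_def)
  show "const U 1 = \<one>\<^bsub>sections \<O> U\<^esub>"
    using O.smult_one[of "\<one>\<^bsub>sections \<O> U\<^esub>"] by (simp add: const_def)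
  show "const U 0 = \<zero>\<^bsub>sections \<O> U\<^esub>"
    using O.smult_l_null[of "\<one>\<^bsub>sections \<O> U\<^esub>"] by (simp add: const_def)
qed

lemma restr_const: "openin M U \<Longrightarrow> openin M V \<Longrightarrow> V \<subseteq> U \<Longrightarrow> restr \<O> U V (const U c) = const V c"
  unfolding const_def
  using restr_scalar[of U V "\<one>\<^bsub>sections \<O> U\<^esub>" c] restr_one[of U V] cring_sections[of U]
  by (simp add: cring.cring_simprules(6))

lemma germ_closed:
  "openin M U \<Longrightarrow> a \<in> U \<Longrightarrow> s \<in> carrier (sections \<O> U) \<Longrightarrow> germ M \<O> a U s \<in> carrier (R a)"
  unfolding stalk_def by auto

lemma stalk_cases:
  assumes "g \<in> carrier (R a)"
  obtains U s where "openin M U" "a \<in> U" "s \<in> carrier (sections \<O> U)" "g = germ M \<O> a U s"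
  using assms unfolding stalk_def by auto

context
  fixes a U assumes U: "openin M U" "a \<in> U"
begin

lemma stalk_add:
  assumes "s \<in> carrier (sections \<O> U)" "t \<in> carrier (sections \<O> U)"
  shows "germ M \<O> a U s \<oplus>\<^bsub>R a\<^esub> germ M \<O> a U t = germ M \<O> a U (s \<oplus>\<^bsub>sections \<O> U\<^esub> t)"
  unfolding stalk_def using germ_op_germ[OF U assms, of "\<lambda>W s t. s \<oplus>\<^bsub>sections \<O> W\<^esub> t"]
  by (simp add: restr_add cring.cring_simprules(1)[OF cring_sections])

lemma stalk_mult:
  assumes "s \<in> carrier (sections \<O> U)" "t \<in> carrier (sections \<O> U)"
  shows "germ M \<O> a U s \<otimes>\<^bsub>R a\<^esub> germ M \<O> a U t = germ M \<O> a U (s \<otimes>\<^bsub>sections \<O> U\<^esub> t)"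
  unfolding stalk_def using germ_op_germ[OF U assms, of "\<lambda>W s t. s \<otimes>\<^bsub>sections \<O> W\<^esub> t"]
  by (simp add: restr_mult cring.cring_simprules(5)[OF cring_sections])

lemma stalk_one: "\<one>\<^bsub>R a\<^esub> = germ M \<O> a U \<one>\<^bsub>sections \<O> U\<^esub>"
  unfolding stalk_def
  using germ_restr[OF openin_topspace U(1) openin_subset[OF U(1)] U(2), of "\<one>\<^bsub>sections \<O> (topspace M)\<^esub>"]
  by (simp add: restr_one[OF openin_topspace U(1) openin_subset[OF U(1)]]
      cring.cring_simprules(6)[OF cring_sections])

lemma stalk_zero: "\<zero>\<^bsub>R a\<^esub> = germ M \<O> a U \<zero>\<^bsub>sections \<O> U\<^esub>"
  unfolding stalk_def
  using germ_restr[OF openin_topspace U(1) openin_subset[OF U(1)] U(2), of "\<zero>\<^bsub>sections \<O> (topspace M)\<^esub>"]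
  by (simp add: restr_zero[OF openin_topspace U(1) openin_subset[OF U(1)]]
      cring.cring_simprules(2)[OF cring_sections])

text \<open>Each representative of the unit equals one near \<open>a\<close>, so the union in the
  scalar action collapses. The action on the unit is the only one that \<open>residue_at\<close>
  uses.\<close>

lemma stalk_smult_one: "c \<odot>\<^bsub>R a\<^esub> \<one>\<^bsub>R a\<^esub> = germ M \<O> a U (const U c)"
proof -
  have one: "\<one>\<^bsub>sections \<O> W\<^esub> \<in> carrier (sections \<O> W)" if "openin M W" for W
    using cring.cring_simprules(6)[OF cring_sections[OF that]] .
  have eq: "germ M \<O> a V (c \<odot>\<^bsub>sections \<O> V\<^esub> s) = germ M \<O> a U (const U c)"
    if "(V, s) \<in> germ M \<O> a U \<one>\<^bsub>sections \<O> U\<^esub>" for V s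
  proof -
    have V: "openin M V" "a \<in> V" "s \<in> carrier (sections \<O> V)" and "agree a U \<one>\<^bsub>sections \<O> U\<^esub> V s"
      using that by (simp_all add: mem_germ)
    then obtain W where W: "openin M W" "a \<in> W" "W \<subseteq> U \<inter> V"
      "restr \<O> U W \<one>\<^bsub>sections \<O> U\<^esub> = restr \<O> V W s"
      unfolding agree_def by blast
    interpret V: algebra complex_ring "sections \<O> V" using V(1) by (rule algebra_sections)
    have cs: "c \<odot>\<^bsub>sections \<O> V\<^esub> s \<in> carrier (sections \<O> V)"
      using V(3) by (intro V.smult_closed) auto
    have "restr \<O> V W (c \<odot>\<^bsub>sections \<O> V\<^esub> s) = c \<odot>\<^bsub>sections \<O> W\<^esub> restr \<O> U W \<one>\<^bsub>sections \<O> U\<^esub>"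
      using restr_scalar[OF V(1) W(1) _ V(3)] W(3,4) by simp
    also have "\<dots> = restr \<O> U W (const U c)"
      using U W by (simp add: restr_one restr_const) (simp add: const_def)
    finally have "agree a V (c \<odot>\<^bsub>sections \<O> V\<^esub> s) U (const U c)"
      unfolding agree_def using W by (intro exI[of _ W]) auto
    then show ?thesis
      using germ_eq_iff[OF V(1,2) cs U const_closed[OF U(1)]] by simp
  qed
  have "c \<odot>\<^bsub>R a\<^esub> \<one>\<^bsub>R a\<^esub> = (\<Union>(V, s)\<in>germ M \<O> a U \<one>\<^bsub>sections \<O> U\<^esub>. germ M \<O> a V (c \<odot>\<^bsub>sections \<O> V\<^esub> s))"
    unfolding stalk_one by (simp add: stalk_def)
  also have "\<dots> = (\<Union>p\<in>germ M \<O> a U \<one>\<^bsub>sections \<O> U\<^esub>. germ M \<O> a U (const U c))"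
    by (intro SUP_cong refl) (auto simp: eq split: prod.splits)
  also have "\<dots> = germ M \<O> a U (const U c)"
    using germ_self[OF U one[OF U(1)]] by blast
  finally show ?thesis .
qed

end

end

section \<open>Maximal ideals of the stalks and uniqueness of residues\<close>

context locally_ringed_space
begin

definition max_at :: "'a \<Rightarrow> ('a set \<times> 'r) set set"
  where "max_at a = (THE m. maximalideal m (R a))"

context
  fixes a assumes a: "a \<in> topspace M"
begin

lemma cring_stalk: "cring (R a)"
  using local_stalk[OF a] unfolding local_ring_def by blast

lemma maximalideal_max_at: "maximalideal (max_at a) (R a)"
  unfolding max_at_def
  by (rule theI'[OF conjunct2[OF local_stalk[OF a, unfolded local_ring_def]]])

lemma maximalideal_eq_max_at: "maximalideal m (R a) \<Longrightarrow> m = max_at a"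
  by (rule ex1E[OF conjunct2[OF local_stalk[OF a, unfolded local_ring_def]]])
    (use maximalideal_max_at in metis)

interpretation R: cring "R a" by (rule cring_stalk)
interpretation m: maximalideal "max_at a" "R a" by (rule maximalideal_max_at)

text \<open>A nonunit lies in some maximal ideal, and there is only one in a local ring. Membership
  thus becomes a statement about inverses, which charts can decide.\<close>

lemma mem_max_at: "g \<in> max_at a \<longleftrightarrow> g \<in> carrier (R a) \<and> g \<notin> Units (R a)"
proof
  assume g: "g \<in> max_at a"
  have "g \<notin> Units (R a)"
  proof
    assume "g \<in> Units (R a)"
    then obtain h where "h \<in> carrier (R a)" "h \<otimes>\<^bsub>R a\<^esub> g = \<one>\<^bsub>R a\<^esub>"
      using R.Units_l_inv_ex by blast
    then have "\<one>\<^bsub>R a\<^esub> \<in> max_at a" using m.I_l_closed[OF g] by metis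
    then show False using m.one_imp_carrier m.I_notcarr by blast
  qed
  then show "g \<in> carrier (R a) \<and> g \<notin> Units (R a)" using m.Icarr[OF g] by blast
next
  assume "g \<in> carrier (R a) \<and> g \<notin> Units (R a)"
  then obtain m where "maximalideal m (R a)" "g \<in> m" using R.nonunit_in_maximalideal by blast
  then show "g \<in> max_at a" using maximalideal_eq_max_at by blast
qed

definition scalar_germ :: "complex \<Rightarrow> ('a set \<times> 'r) set"
  where "scalar_germ c = c \<odot>\<^bsub>R a\<^esub> \<one>\<^bsub>R a\<^esub>"

lemma scalar_germ:
  shows scalar_germ_closed: "scalar_germ c \<in> carrier (R a)"
    and scalar_germ_add: "scalar_germ (c + d) = scalar_germ c \<oplus>\<^bsub>R a\<^esub> scalar_germ d"
    and scalar_germ_mult: "scalar_germ (c * d) = scalar_germ c \<otimes>\<^bsub>R a\<^esub> scalar_germ d"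
    and scalar_germ_one: "scalar_germ 1 = \<one>\<^bsub>R a\<^esub>"
    and scalar_germ_zero: "scalar_germ 0 = \<zero>\<^bsub>R a\<^esub>"
  unfolding scalar_germ_def stalk_smult_one[OF openin_topspace a]
  using a const_closed[OF openin_topspace]
  by (simp_all add: germ_closed const_add const_mult const_one const_zero
      stalk_add[OF openin_topspace a] stalk_mult[OF openin_topspace a]
      stalk_one[OF openin_topspace a] stalk_zero[OF openin_topspace a])

lemma germ_ring_hom: "openin M U \<Longrightarrow> a \<in> U \<Longrightarrow> germ M \<O> a U \<in> ring_hom (sections \<O> U) (R a)"
  by (rule ring_hom_memI) (simp_all add: germ_closed stalk_add stalk_mult stalk_one)

lemma germ_minus:
  assumes "openin M U" "a \<in> U" "s \<in> carrier (sections \<O> U)" "t \<in> carrier (sections \<O> U)"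
  shows "germ M \<O> a U s \<ominus>\<^bsub>R a\<^esub> germ M \<O> a U t = germ M \<O> a U (s \<ominus>\<^bsub>sections \<O> U\<^esub> t)"
proof -
  interpret U: cring "sections \<O> U" using assms(1) by (rule cring_sections)
  interpret ring_hom_cring "sections \<O> U" "R a" "germ M \<O> a U"
    by unfold_locales (rule germ_ring_hom[OF assms(1,2)])
  show ?thesis using assms(3,4) by (simp add: a_minus_def)
qed

lemma scalar_germ_in_max_at: "scalar_germ c \<in> max_at a \<Longrightarrow> c = 0"
proof (rule ccontr)
  assume c: "scalar_germ c \<in> max_at a" "c \<noteq> 0"
  have "scalar_germ (inverse c) \<otimes>\<^bsub>R a\<^esub> scalar_germ c = \<one>\<^bsub>R a\<^esub>"
    using c(2) by (simp add: scalar_germ_mult[symmetric] scalar_germ_one)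
  then have "\<one>\<^bsub>R a\<^esub> \<in> max_at a"
    using m.I_l_closed[OF c(1) scalar_germ_closed] by metis
  then show False using m.one_imp_carrier m.I_notcarr by blast
qed

text \<open>Subtracting the two memberships puts \<open>scalar_germ (c - d)\<close> into the maximal
  ideal, where zero is the only scalar.\<close>

lemma residue_unique:
  assumes g: "g \<in> carrier (R a)" and c: "g \<ominus>\<^bsub>R a\<^esub> scalar_germ c \<in> max_at a"
    and d: "g \<ominus>\<^bsub>R a\<^esub> scalar_germ d \<in> max_at a"
  shows "c = d"
proof -
  have eq: "scalar_germ (c - d) = (g \<ominus>\<^bsub>R a\<^esub> scalar_germ d) \<ominus>\<^bsub>R a\<^esub> (g \<ominus>\<^bsub>R a\<^esub> scalar_germ c)"
  proof -
    have "scalar_germ c = scalar_germ (c - d) \<oplus>\<^bsub>R a\<^esub> scalar_germ d"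
      by (simp add: scalar_germ_add[symmetric])
    moreover have "x = (g \<ominus>\<^bsub>R a\<^esub> y) \<ominus>\<^bsub>R a\<^esub> (g \<ominus>\<^bsub>R a\<^esub> (x \<oplus>\<^bsub>R a\<^esub> y))"
      if "x \<in> carrier (R a)" "y \<in> carrier (R a)" for x y
      using g that by algebra
    ultimately show ?thesis using scalar_germ_closed by metis
  qed
  have "scalar_germ (c - d) \<in> max_at a"
    unfolding eq a_minus_def[of "R a" "g \<ominus>\<^bsub>R a\<^esub> scalar_germ d"]
    by (intro m.a_closed m.a_inv_closed d c)
  then show ?thesis using scalar_germ_in_max_at by fastforce
qed

lemma residue_at_eqI:
  assumes "g \<in> carrier (R a)" "g \<ominus>\<^bsub>R a\<^esub> scalar_germ c \<in> max_at a"
  shows "residue_at M \<O> a g = c"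
  unfolding residue_at_def max_at_def[symmetric] scalar_germ_def[symmetric]
  by (rule the_equality) (use assms residue_unique in blast)+

lemma residue_at_zero: "residue_at M \<O> a \<zero>\<^bsub>R a\<^esub> = 0"
  by (rule residue_at_eqI) (simp_all add: scalar_germ_zero R.minus_eq m.zero_closed)

end

end

context formal_manifold
begin

text \<open>An inverse in the stalk at \<open>b\<close> is represented on a neighbourhood of
  \<open>b\<close>, and restricting it into the chart contradicts \<open>chart_value\<close>. So the
  difference is a nonunit, and the residue is given by the continuous function
  \<open>val\<close>.\<close>

lemma local_value:
  assumes V: "openin M V" and f: "f \<in> carrier (sections \<O> V)" and a: "a \<in> V"
  obtains W val where "openin M W" "a \<in> W" "W \<subseteq> V" "continuous_map (subtopology M W) euclidean val"
    and "\<And>b. b \<in> W \<Longrightarrow> germ M \<O> b V f \<ominus>\<^bsub>R b\<^esub> scalar_germ b (val b) \<in> max_at b"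
proof -
  have VA: "V \<subseteq> topspace M" by (rule openin_subset[OF V])
  then obtain N n k \<phi> h where ch: "formal_chart M \<O> N n k \<phi> h" and aN: "a \<in> N"
    using a obtain_chart by blast
  interpret formal_chart M \<O> N n k \<phi> h by fact
  define W where "W = V \<inter> N"
  have W: "openin M W" "a \<in> W" "W \<subseteq> V" "W \<subseteq> N" unfolding W_def using V N a aN by auto
  have fW: "restr \<O> V W f \<in> carrier (sections \<O> W)" using restr_closed[OF V W(1,3) f] .
  obtain val where val: "continuous_map (subtopology M W) euclidean val"
    and nonunit: "\<And>b Z g. \<lbrakk>openin M Z; b \<in> Z; Z \<subseteq> W; g \<in> carrier (sections \<O> Z)\<rbrakk> \<Longrightarrow>
      (restr \<O> W Z (restr \<O> V W f) \<ominus>\<^bsub>sections \<O> Z\<^esub> val b \<odot>\<^bsub>sections \<O> Z\<^esub> \<one>\<^bsub>sections \<O> Z\<^esub>)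
        \<otimes>\<^bsub>sections \<O> Z\<^esub> g \<noteq> \<one>\<^bsub>sections \<O> Z\<^esub>"
    by (rule chart_value[OF W(1,4) fW]) blast
  have "germ M \<O> b V f \<ominus>\<^bsub>R b\<^esub> scalar_germ b (val b) \<in> max_at b" if b: "b \<in> W" for b
  proof -
    have bA: "b \<in> topspace M" using b W VA by blast
    have bV: "b \<in> V" using b W by blast
    interpret R: cring "R b" by (rule cring_stalk[OF bA])
    interpret V: cring "sections \<O> V" using V by (rule cring_sections)
    let ?g = "f \<ominus>\<^bsub>sections \<O> V\<^esub> const V (val b)"
    have gV: "?g \<in> carrier (sections \<O> V)" using f const_closed[OF V] by simp
    have eq: "germ M \<O> b V f \<ominus>\<^bsub>R b\<^esub> scalar_germ b (val b) = germ M \<O> b V ?g"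
      unfolding scalar_germ_def[OF bA] stalk_smult_one[OF V bV]
      by (rule germ_minus[OF bA V bV f const_closed[OF V]])
    have "germ M \<O> b V ?g \<notin> Units (R b)"
    proof
      assume "germ M \<O> b V ?g \<in> Units (R b)"
      then obtain q where q: "q \<in> carrier (R b)" "germ M \<O> b V ?g \<otimes>\<^bsub>R b\<^esub> q = \<one>\<^bsub>R b\<^esub>"
        using R.Units_r_inv_ex by blast
      obtain U g where U: "openin M U" "b \<in> U" and g: "g \<in> carrier (sections \<O> U)" "q = germ M \<O> b U g"
        using stalk_cases[OF q(1)] .
      let ?Z = "U \<inter> V"
      have Z: "openin M ?Z" "b \<in> ?Z" using U V bV by auto
      interpret Z: cring "sections \<O> ?Z" using Z(1) by (rule cring_sections)
      have r: "restr \<O> V ?Z ?g \<in> carrier (sections \<O> ?Z)" "restr \<O> U ?Z g \<in> carrier (sections \<O> ?Z)"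
        using Z V U gV g(1) by (auto intro: restr_closed)
      let ?p = "restr \<O> V ?Z ?g \<otimes>\<^bsub>sections \<O> ?Z\<^esub> restr \<O> U ?Z g"
      have "germ M \<O> b ?Z ?p = germ M \<O> b ?Z \<one>\<^bsub>sections \<O> ?Z\<^esub>"
        using q(2) unfolding g(2) germ_restr[OF V Z(1) Int_lower2 Z(2) gV, symmetric]
          germ_restr[OF U(1) Z(1) Int_lower1 Z(2) g(1), symmetric]
          stalk_mult[OF Z r] stalk_one[OF Z] .
      then have "agree b ?Z ?p ?Z \<one>\<^bsub>sections \<O> ?Z\<^esub>"
        using r by (subst (asm) germ_eq_iff[OF Z _ Z]) simp_all
      then obtain Y where Y: "openin M Y" "b \<in> Y" "Y \<subseteq> ?Z"
        "restr \<O> ?Z Y ?p = restr \<O> ?Z Y \<one>\<^bsub>sections \<O> ?Z\<^esub>"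
        unfolding agree_def by blast
      \<comment> \<open>Shrinking into \<open>W\<close> brings the identity into the domain of the
        chart, where \<open>nonunit\<close> applies.\<close>
      let ?Y = "Y \<inter> W"
      have Y': "openin M ?Y" "b \<in> ?Y" "?Y \<subseteq> W" "?Y \<subseteq> Y" "?Y \<subseteq> ?Z" "?Y \<subseteq> V" "?Y \<subseteq> U"
        using Y W b by auto
      interpret Y: cring "sections \<O> ?Y" using Y'(1) by (rule cring_sections)
      have pZ: "?p \<in> carrier (sections \<O> ?Z)" using r by simp
      have "restr \<O> ?Z ?Y ?p = restr \<O> Y ?Y (restr \<O> ?Z Y ?p)"
        by (rule restr_restr[symmetric, OF Z(1) Y(1) Y'(1,4) Y(3) pZ])
      also have "\<dots> = \<one>\<^bsub>sections \<O> ?Y\<^esub>"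
        unfolding Y(4) using Y Y' Z by (simp add: restr_one)
      finally have "restr \<O> ?Z ?Y (restr \<O> V ?Z ?g) \<otimes>\<^bsub>sections \<O> ?Y\<^esub> restr \<O> ?Z ?Y (restr \<O> U ?Z g)
          = \<one>\<^bsub>sections \<O> ?Y\<^esub>"
        using restr_mult[OF Z(1) Y'(1,5) r] by simp
      then have "restr \<O> V ?Y ?g \<otimes>\<^bsub>sections \<O> ?Y\<^esub> restr \<O> U ?Y g = \<one>\<^bsub>sections \<O> ?Y\<^esub>"
        using restr_restr[OF V Z(1) Y'(1,5) Int_lower2 gV] restr_restr[OF U(1) Z(1) Y'(1,5) Int_lower1 g(1)]
        by simp
      moreover have "restr \<O> V ?Y ?g = restr \<O> W ?Y (restr \<O> V W f) \<ominus>\<^bsub>sections \<O> ?Y\<^esub>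
          val b \<odot>\<^bsub>sections \<O> ?Y\<^esub> \<one>\<^bsub>sections \<O> ?Y\<^esub>"
        by (simp only: restr_minus[OF V Y'(1,6) f const_closed[OF V]] restr_const[OF V Y'(1,6)]
            restr_restr[OF V W(1) Y'(1,3) W(3) f]) (simp only: const_def)
      ultimately show False
        using nonunit[OF Y'(1,2,3) restr_closed[OF U(1) Y'(1,7) g(1)]] by simp
    qed
    then show ?thesis
      unfolding eq mem_max_at[OF bA] using germ_closed[OF V bV gV] by blast
  qed
  then show ?thesis using that[OF W(1,2,3) val] by blast
qed

context
  fixes a assumes a: "a \<in> topspace M"
begin

interpretation R: cring "R a" by (rule cring_stalk[OF a])
interpretation m: maximalideal "max_at a" "R a" by (rule maximalideal_max_at[OF a])

text \<open>\<open>residue_at\<close> is a definite description. Uniqueness holds in every stalk of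
  a locally ringed space, while existence comes from the chart, that is, from the residue field
  being the complex numbers.\<close>

lemma residue_at_spec:
  assumes g: "g \<in> carrier (R a)"
  shows "g \<ominus>\<^bsub>R a\<^esub> scalar_germ a (residue_at M \<O> a g) \<in> max_at a"
proof -
  obtain U f where U: "openin M U" "a \<in> U" and f: "f \<in> carrier (sections \<O> U)" "g = germ M \<O> a U f"
    using stalk_cases[OF g] .
  obtain W val where "openin M W" "a \<in> W" and
    "\<And>b. b \<in> W \<Longrightarrow> germ M \<O> b U f \<ominus>\<^bsub>R b\<^esub> scalar_germ b (val b) \<in> max_at b"
    by (rule local_value[OF U(1) f(1) U(2)]) blast
  then have "g \<ominus>\<^bsub>R a\<^esub> scalar_germ a (val a) \<in> max_at a" using f(2) by blast
  then show ?thesis using residue_at_eqI[OF a g] by simp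
qed

lemma residue_at_add:
  assumes g: "g \<in> carrier (R a)" and h: "h \<in> carrier (R a)"
  shows "residue_at M \<O> a (g \<oplus>\<^bsub>R a\<^esub> h) = residue_at M \<O> a g + residue_at M \<O> a h"
proof (rule residue_at_eqI[OF a])
  show "g \<oplus>\<^bsub>R a\<^esub> h \<in> carrier (R a)" using g h by simp
  let ?c = "scalar_germ a (residue_at M \<O> a g)" and ?d = "scalar_germ a (residue_at M \<O> a h)"
  have c: "?c \<in> carrier (R a)" "?d \<in> carrier (R a)" using scalar_germ_closed[OF a] by auto
  have "(g \<oplus>\<^bsub>R a\<^esub> h) \<ominus>\<^bsub>R a\<^esub> scalar_germ a (residue_at M \<O> a g + residue_at M \<O> a h)
      = (g \<ominus>\<^bsub>R a\<^esub> ?c) \<oplus>\<^bsub>R a\<^esub> (h \<ominus>\<^bsub>R a\<^esub> ?d)"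
    unfolding scalar_germ_add[OF a] using g h c by algebra
  also have "\<dots> \<in> max_at a"
    by (intro m.a_closed residue_at_spec g h)
  finally show "(g \<oplus>\<^bsub>R a\<^esub> h) \<ominus>\<^bsub>R a\<^esub> scalar_germ a (residue_at M \<O> a g + residue_at M \<O> a h) \<in> max_at a" .
qed

lemma residue_at_eq_0_iff:
  assumes g: "g \<in> carrier (R a)"
  shows "residue_at M \<O> a g = 0 \<longleftrightarrow> g \<in> max_at a"
proof -
  have "g \<ominus>\<^bsub>R a\<^esub> scalar_germ a 0 = g"
    unfolding scalar_germ_zero[OF a] using g by (simp add: R.minus_eq)
  then show ?thesis
    using residue_at_spec[OF g] residue_at_eqI[OF a g, of 0] by auto
qed

end

text \<open>Near \<open>a\<close> the values form a continuous function, so they stay within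
  distance one of the value at \<open>a\<close>. All boundedness of the seminorms originates
  here.\<close>

lemma sec_value_locally_bounded:
  assumes V: "openin M V" and f: "f \<in> carrier (sections \<O> V)" and a: "a \<in> V"
  obtains W B where "openin M W" "a \<in> W" "W \<subseteq> V" "\<And>b. b \<in> W \<Longrightarrow> cmod (sec_value M \<O> V f b) \<le> B"
proof -
  obtain W val where W: "openin M W" "a \<in> W" "W \<subseteq> V" and cont: "continuous_map (subtopology M W) euclidean val"
    and val: "\<And>b. b \<in> W \<Longrightarrow> germ M \<O> b V f \<ominus>\<^bsub>R b\<^esub> scalar_germ b (val b) \<in> max_at b"
    by (rule local_value[OF V f a]) blast
  have top: "topspace (subtopology M W) = W" using openin_subset[OF W(1)] by auto
  define Z where "Z = {b \<in> topspace (subtopology M W). val b \<in> ball (val a) 1}"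
  have "openin (subtopology M W) Z"
    unfolding Z_def by (rule openin_continuous_map_preimage[OF cont]) simp
  then have Z: "openin M Z" using W(1) by (simp add: openin_open_subtopology)
  have "cmod (sec_value M \<O> V f b) \<le> cmod (val a) + 1" if b: "b \<in> Z" for b
  proof -
    have bW: "b \<in> W" using b top unfolding Z_def by blast
    then have bV: "b \<in> V" using W by blast
    have "sec_value M \<O> V f b = val b"
      unfolding sec_value_def
      using residue_at_eqI[OF _ germ_closed[OF V bV f] val[OF bW]] openin_subset[OF V] bV by blast
    moreover have "cmod (val b) \<le> cmod (val a) + cmod (val b - val a)"
      using norm_triangle_ineq[of "val a" "val b - val a"] by simp
    moreover have "cmod (val b - val a) < 1"
      using b unfolding Z_def by (simp add: dist_norm norm_minus_commute)
    ultimately show ?thesis by simp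
  qed
  moreover have "a \<in> Z" "Z \<subseteq> V" using W top unfolding Z_def by auto
  ultimately show ?thesis using that Z by blast
qed

end

section \<open>The reduction\<close>

context formal_manifold
begin

abbreviation "\<V> \<equiv> vanishing_ideal M \<O>"
abbreviation "J a \<equiv> stalk_ideal M \<O> \<V> a"
abbreviation "Q a \<equiv> R a Quot J a"
abbreviation "red \<equiv> reduction M \<O>"
abbreviation "cls \<equiv> stalk_class M \<O> \<V>"

lemma sec_value_restr:
  assumes "openin M U" "openin M V" "V \<subseteq> U" "a \<in> V" "s \<in> carrier (sections \<O> U)"
  shows "sec_value M \<O> V (restr \<O> U V s) a = sec_value M \<O> U s a"
  unfolding sec_value_def germ_restr[OF assms] ..

lemma vanishing_restr:
  "\<lbrakk>openin M U; openin M V; V \<subseteq> U; f \<in> \<V> U\<rbrakk> \<Longrightarrow> restr \<O> U V f \<in> \<V> V"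
  unfolding vanishing_ideal_def by (auto simp: sec_value_restr restr_closed)

lemma sec_value_add:
  assumes U: "openin M U" "b \<in> U" and fg: "f \<in> carrier (sections \<O> U)" "g \<in> carrier (sections \<O> U)"
  shows "sec_value M \<O> U (f \<oplus>\<^bsub>sections \<O> U\<^esub> g) b = sec_value M \<O> U f b + sec_value M \<O> U g b"
proof -
  have "b \<in> topspace M" using openin_subset[OF U(1)] U(2) by blast
  then show ?thesis
    unfolding sec_value_def stalk_add[OF U fg, symmetric]
    using residue_at_add germ_closed[OF U] fg by blast
qed

lemma sec_value_mult_zero:
  assumes U: "openin M U" "b \<in> U" and fg: "f \<in> carrier (sections \<O> U)" "g \<in> carrier (sections \<O> U)"
    and 0: "sec_value M \<O> U f b = 0"
  shows "sec_value M \<O> U (g \<otimes>\<^bsub>sections \<O> U\<^esub> f) b = 0"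
proof -
  have b: "b \<in> topspace M" using openin_subset[OF U(1)] U(2) by blast
  interpret R: cring "R b" by (rule cring_stalk[OF b])
  interpret m: maximalideal "max_at b" "R b" by (rule maximalideal_max_at[OF b])
  note cl = germ_closed[OF U]
  have "germ M \<O> b U f \<in> max_at b"
    using 0 residue_at_eq_0_iff[OF b cl[OF fg(1)]] unfolding sec_value_def by blast
  then have "germ M \<O> b U g \<otimes>\<^bsub>R b\<^esub> germ M \<O> b U f \<in> max_at b"
    using m.I_l_closed cl[OF fg(2)] by blast
  then show ?thesis
    unfolding sec_value_def stalk_mult[OF U fg(2,1), symmetric]
    using residue_at_eq_0_iff[OF b] cl[OF fg(1)] cl[OF fg(2)] R.m_closed by blast
qed

context
  fixes a assumes a: "a \<in> topspace M"
begin

interpretation R: cring "R a" by (rule cring_stalk[OF a])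
interpretation m: maximalideal "max_at a" "R a" by (rule maximalideal_max_at[OF a])

lemma stalk_ideal_cases:
  assumes "g \<in> J a"
  obtains U f where "openin M U" "a \<in> U" "f \<in> \<V> U" "g = germ M \<O> a U f"
  using assms unfolding stalk_ideal_def by blast

lemma stalk_ideal_subset: "J a \<subseteq> carrier (R a)"
  unfolding stalk_ideal_def vanishing_ideal_def by (auto intro: germ_closed)

lemma residue_at_stalk_ideal: "g \<in> J a \<Longrightarrow> residue_at M \<O> a g = 0"
  unfolding stalk_ideal_def vanishing_ideal_def by (auto simp: sec_value_def)

lemma germ_in_stalk_ideal: "openin M U \<Longrightarrow> a \<in> U \<Longrightarrow> f \<in> \<V> U \<Longrightarrow> germ M \<O> a U f \<in> J a"
  unfolding stalk_ideal_def by blast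

lemma stalk_ideal_mult:
  assumes g: "g \<in> J a" and x: "x \<in> carrier (R a)"
  shows "x \<otimes>\<^bsub>R a\<^esub> g \<in> J a"
proof -
  obtain U f where U: "openin M U" "a \<in> U" and f: "f \<in> \<V> U" "g = germ M \<O> a U f"
    using stalk_ideal_cases[OF g] .
  obtain V q where V: "openin M V" "a \<in> V" and q: "q \<in> carrier (sections \<O> V)" "x = germ M \<O> a V q"
    using stalk_cases[OF x] .
  let ?W = "U \<inter> V"
  have W: "openin M ?W" "a \<in> ?W" using U V by auto
  have fU: "f \<in> carrier (sections \<O> U)" using f(1) by (simp add: vanishing_ideal_def)
  have f': "restr \<O> U ?W f \<in> \<V> ?W" by (rule vanishing_restr[OF U(1) W(1) Int_lower1 f(1)])
  have fW: "restr \<O> U ?W f \<in> carrier (sections \<O> ?W)" using f' by (simp add: vanishing_ideal_def)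
  have qW: "restr \<O> V ?W q \<in> carrier (sections \<O> ?W)" by (rule restr_closed[OF V(1) W(1) Int_lower2 q(1)])
  interpret W: cring "sections \<O> ?W" using W(1) by (rule cring_sections)
  have "restr \<O> V ?W q \<otimes>\<^bsub>sections \<O> ?W\<^esub> restr \<O> U ?W f \<in> \<V> ?W"
    using sec_value_mult_zero[OF W(1) _ fW qW] f' fW qW unfolding vanishing_ideal_def by simp
  then have "germ M \<O> a ?W (restr \<O> V ?W q \<otimes>\<^bsub>sections \<O> ?W\<^esub> restr \<O> U ?W f) \<in> J a"
    by (rule germ_in_stalk_ideal[OF W])
  then show ?thesis
    unfolding stalk_mult[OF W qW fW, symmetric] germ_restr[OF U(1) W(1) Int_lower1 W(2) fU]
      germ_restr[OF V(1) W(1) Int_lower2 W(2) q(1)] f(2)[symmetric] q(2)[symmetric] .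
qed

lemma stalk_ideal_add:
  assumes g: "g \<in> J a" and h: "h \<in> J a"
  shows "g \<oplus>\<^bsub>R a\<^esub> h \<in> J a"
proof -
  obtain U f where U: "openin M U" "a \<in> U" and f: "f \<in> \<V> U" "g = germ M \<O> a U f"
    using stalk_ideal_cases[OF g] .
  obtain V q where V: "openin M V" "a \<in> V" and q: "q \<in> \<V> V" "h = germ M \<O> a V q"
    using stalk_ideal_cases[OF h] .
  let ?W = "U \<inter> V"
  have W: "openin M ?W" "a \<in> ?W" using U V by auto
  have fU: "f \<in> carrier (sections \<O> U)" and qV: "q \<in> carrier (sections \<O> V)"
    using f(1) q(1) by (simp_all add: vanishing_ideal_def)
  have f': "restr \<O> U ?W f \<in> \<V> ?W" by (rule vanishing_restr[OF U(1) W(1) Int_lower1 f(1)])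
  have q': "restr \<O> V ?W q \<in> \<V> ?W" by (rule vanishing_restr[OF V(1) W(1) Int_lower2 q(1)])
  have fW: "restr \<O> U ?W f \<in> carrier (sections \<O> ?W)" and qW: "restr \<O> V ?W q \<in> carrier (sections \<O> ?W)"
    using f' q' by (simp_all add: vanishing_ideal_def)
  interpret W: cring "sections \<O> ?W" using W(1) by (rule cring_sections)
  have "restr \<O> U ?W f \<oplus>\<^bsub>sections \<O> ?W\<^esub> restr \<O> V ?W q \<in> \<V> ?W"
    using sec_value_add[OF W(1) _ fW qW] f' q' fW qW unfolding vanishing_ideal_def by simp
  then have "germ M \<O> a ?W (restr \<O> U ?W f \<oplus>\<^bsub>sections \<O> ?W\<^esub> restr \<O> V ?W q) \<in> J a"
    by (rule germ_in_stalk_ideal[OF W])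
  then show ?thesis
    unfolding stalk_add[OF W fW qW, symmetric] germ_restr[OF U(1) W(1) Int_lower1 W(2) fU]
      germ_restr[OF V(1) W(1) Int_lower2 W(2) qV] f(2)[symmetric] q(2)[symmetric] .
qed

lemma zero_in_stalk_ideal: "\<zero>\<^bsub>R a\<^esub> \<in> J a"
proof -
  interpret A: cring "sections \<O> (topspace M)" by (rule cring_sections) simp
  have "\<zero>\<^bsub>sections \<O> (topspace M)\<^esub> \<in> \<V> (topspace M)"
    unfolding vanishing_ideal_def sec_value_def
    using residue_at_zero stalk_zero[OF openin_topspace, symmetric] by auto
  then show ?thesis
    using germ_in_stalk_ideal[OF openin_topspace a] stalk_zero[OF openin_topspace a] by simp
qed

lemma ideal_stalk_ideal: "ideal (J a) (R a)"
proof (rule idealI)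
  show "ring (R a)" by (rule R.ring_axioms)
  show "subgroup (J a) (add_monoid (R a))"
  proof (rule R.add.subgroupI)
    show "J a \<subseteq> carrier (R a)" by (rule stalk_ideal_subset)
    show "J a \<noteq> {}" using zero_in_stalk_ideal by blast
    fix g h assume g: "g \<in> J a"
    then have gc: "g \<in> carrier (R a)" using stalk_ideal_subset by blast
    have "(\<ominus>\<^bsub>R a\<^esub> \<one>\<^bsub>R a\<^esub>) \<otimes>\<^bsub>R a\<^esub> g \<in> J a"
      by (rule stalk_ideal_mult[OF g]) simp
    then show "\<ominus>\<^bsub>R a\<^esub> g \<in> J a" using gc by (simp add: R.l_minus)
    assume "h \<in> J a"
    then show "g \<oplus>\<^bsub>R a\<^esub> h \<in> J a" using stalk_ideal_add[OF g] by blast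
  qed
  show "x \<otimes>\<^bsub>R a\<^esub> g \<in> J a" if "g \<in> J a" "x \<in> carrier (R a)" for g x
    using stalk_ideal_mult that by blast
  show "g \<otimes>\<^bsub>R a\<^esub> x \<in> J a" if "g \<in> J a" "x \<in> carrier (R a)" for g x
    using stalk_ideal_mult[OF that] R.m_comm[OF subsetD[OF stalk_ideal_subset that(1)] that(2)] by simp
qed

interpretation J: ideal "J a" "R a" by (rule ideal_stalk_ideal)
interpretation Q: cring "Q a" by (rule J.quotient_is_cring[OF R.cring_axioms])

lemma quotient_zero: "\<zero>\<^bsub>Q a\<^esub> = J a"
  by (simp add: FactRing_def)

lemma quotient_cases:
  assumes "z \<in> carrier (Q a)"
  obtains g where "g \<in> carrier (R a)" "z = J a +>\<^bsub>R a\<^esub> g"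
  using assms unfolding FactRing_simps by auto

lemma coset_closed: "g \<in> carrier (R a) \<Longrightarrow> J a +>\<^bsub>R a\<^esub> g \<in> carrier (Q a)"
  by (rule ring_hom_closed[OF J.rcos_ring_hom])

text \<open>Elements of the coset differ from \<open>g\<close> by members of \<open>J a\<close>,
  whose residue is zero, so the residue is constant on the coset. That \<open>g\<close> itself
  belongs to it makes the description determined.\<close>

lemma reduced_value_coset:
  assumes s: "s a = J a +>\<^bsub>R a\<^esub> g" and g: "g \<in> carrier (R a)"
  shows "reduced_value M \<O> s a = residue_at M \<O> a g"
proof -
  have "residue_at M \<O> a q = residue_at M \<O> a g" if q: "q \<in> s a" for q
  proof -
    obtain j where j: "j \<in> J a" "q = j \<oplus>\<^bsub>R a\<^esub> g"
      using q unfolding s a_r_coset_def' by blast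
    then show ?thesis
      using residue_at_add[OF a _ g] residue_at_stalk_ideal stalk_ideal_subset by auto
  qed
  note all = this
  have gs: "g \<in> s a" unfolding s using g by (rule J.a_rcos_self)
  show ?thesis
    unfolding reduced_value_def
  proof (rule the_equality)
    show "\<forall>q\<in>s a. residue_at M \<O> a q = residue_at M \<O> a g" by (rule ballI) (rule all)
    show "c = residue_at M \<O> a g" if "\<forall>q\<in>s a. residue_at M \<O> a q = c" for c
      using bspec[OF that gs] by (rule sym)
  qed
qed

lemma reduced_value_zero: "s a = J a \<Longrightarrow> reduced_value M \<O> s a = 0"
  using reduced_value_coset[of s "\<zero>\<^bsub>R a\<^esub>"] residue_at_zero[OF a]
    ring_hom_zero[OF J.rcos_ring_hom R.ring_axioms Q.ring_axioms] quotient_zero by simp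

lemma reduced_value_add:
  assumes "s a \<in> carrier (Q a)" "t a \<in> carrier (Q a)" "r a = s a \<oplus>\<^bsub>Q a\<^esub> t a"
  shows "reduced_value M \<O> r a = reduced_value M \<O> s a + reduced_value M \<O> t a"
proof -
  obtain g h where gh: "g \<in> carrier (R a)" "s a = J a +>\<^bsub>R a\<^esub> g" "h \<in> carrier (R a)" "t a = J a +>\<^bsub>R a\<^esub> h"
    using quotient_cases[OF assms(1)] quotient_cases[OF assms(2)] by metis
  then have "r a = J a +>\<^bsub>R a\<^esub> (g \<oplus>\<^bsub>R a\<^esub> h)"
    using assms(3) ring_hom_add[OF J.rcos_ring_hom, of g h] by simp
  then show ?thesis
    using gh reduced_value_coset[of s g] reduced_value_coset[of t h]
      reduced_value_coset[of r "g \<oplus>\<^bsub>R a\<^esub> h"] residue_at_add[OF a, of g h] by simp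
qed

lemma cls_closed: "openin M U \<Longrightarrow> a \<in> U \<Longrightarrow> f \<in> carrier (sections \<O> U) \<Longrightarrow> cls U f a \<in> carrier (Q a)"
  unfolding stalk_class_def by (intro coset_closed germ_closed)

lemma cls_restr:
  "\<lbrakk>openin M U; openin M V; V \<subseteq> U; a \<in> V; f \<in> carrier (sections \<O> U)\<rbrakk>
    \<Longrightarrow> cls V (restr \<O> U V f) a = cls U f a"
  unfolding stalk_class_def by (simp add: germ_restr)

lemma cls_add:
  assumes U: "openin M U" "a \<in> U" and fg: "f \<in> carrier (sections \<O> U)" "g \<in> carrier (sections \<O> U)"
  shows "cls U (f \<oplus>\<^bsub>sections \<O> U\<^esub> g) a = cls U f a \<oplus>\<^bsub>Q a\<^esub> cls U g a"
  unfolding stalk_class_def stalk_add[OF U fg, symmetric]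
  by (rule ring_hom_add[OF J.rcos_ring_hom germ_closed[OF U fg(1)] germ_closed[OF U fg(2)]])

lemma cls_zero:
  assumes U: "openin M U" "a \<in> U"
  shows "cls U \<zero>\<^bsub>sections \<O> U\<^esub> a = J a"
  using ring_hom_zero[OF J.rcos_ring_hom R.ring_axioms Q.ring_axioms]
  unfolding stalk_class_def stalk_zero[OF U, symmetric] quotient_zero .

lemma cls_a_inv:
  assumes U: "openin M U" "a \<in> U" and f: "f \<in> carrier (sections \<O> U)"
  shows "cls U (\<ominus>\<^bsub>sections \<O> U\<^esub> f) a \<oplus>\<^bsub>Q a\<^esub> cls U f a = J a"
proof -
  interpret U: cring "sections \<O> U" using U(1) by (rule cring_sections)
  show ?thesis
    using cls_add[OF U _ f, of "\<ominus>\<^bsub>sections \<O> U\<^esub> f"] cls_zero[OF U] f by (simp add: U.l_neg)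
qed

lemma cring_quotient: "cring (Q a)"
  by (rule Q.cring_axioms)

end

definition locally_induced :: "'a set \<Rightarrow> ('a \<Rightarrow> ('a set \<times> 'r) set set) \<Rightarrow> bool"
  where "locally_induced U s \<longleftrightarrow> (\<forall>a\<in>U. \<exists>V f. openin M V \<and> a \<in> V \<and> V \<subseteq> U \<and>
    f \<in> carrier (sections \<O> V) \<and> (\<forall>b\<in>V. s b = cls V f b))"

lemma red_simps:
  "carrier (sections red U) = {s \<in> extensional U. locally_induced U s}"
  "\<zero>\<^bsub>sections red U\<^esub> = (\<lambda>a\<in>U. \<zero>\<^bsub>Q a\<^esub>)"
  "s \<oplus>\<^bsub>sections red U\<^esub> t = (\<lambda>a\<in>U. s a \<oplus>\<^bsub>Q a\<^esub> t a)"
  "f \<odot>\<^bsub>sections red U\<^esub> s = (\<lambda>a\<in>U. cls U f a \<otimes>\<^bsub>Q a\<^esub> s a)"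
  "restr red U V s = restrict s V"
  by (simp_all add: reduction_def quotient_sheaf_def Let_def locally_induced_def)

lemma red_local:
  assumes "s \<in> carrier (sections red U)" "a \<in> U"
  obtains V f where "openin M V" "a \<in> V" "V \<subseteq> U" "f \<in> carrier (sections \<O> V)" "\<forall>b\<in>V. s b = cls V f b"
proof -
  have "locally_induced U s" using assms(1) by (simp only: red_simps(1) mem_Collect_eq)
  then have "\<exists>V f. openin M V \<and> a \<in> V \<and> V \<subseteq> U \<and> f \<in> carrier (sections \<O> V) \<and> (\<forall>b\<in>V. s b = cls V f b)"
    unfolding locally_induced_def using assms(2) by (rule bspec)
  then show ?thesis by (elim exE conjE) (rule that)
qed

lemma redI:
  assumes "s \<in> extensional U" "\<And>a. a \<in> U \<Longrightarrow> \<exists>V f. openin M V \<and> a \<in> V \<and> V \<subseteq> U \<and>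
    f \<in> carrier (sections \<O> V) \<and> (\<forall>b\<in>V. s b = cls V f b)"
  shows "s \<in> carrier (sections red U)"
  unfolding red_simps(1) locally_induced_def using assms by (intro CollectI conjI ballI)

lemma red_in_quotient:
  assumes U: "openin M U" and s: "s \<in> carrier (sections red U)" and a: "a \<in> U"
  shows "s a \<in> carrier (Q a)"
proof -
  obtain V f where V: "openin M V" "a \<in> V" "V \<subseteq> U" "f \<in> carrier (sections \<O> V)" "\<forall>b\<in>V. s b = cls V f b"
    using red_local[OF s a] .
  then have "s a = cls V f a" by blast
  moreover have "a \<in> topspace M" using openin_subset[OF U] a by blast
  ultimately show ?thesis using cls_closed[OF _ V(1,2,4)] by simp
qed

lemma red_ext:
  assumes "s \<in> carrier (sections red U)" "t \<in> carrier (sections red U)" "\<And>a. a \<in> U \<Longrightarrow> s a = t a"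
  shows "s = t"
  using assms(1,2) unfolding red_simps(1) by (intro extensionalityI[of s U t] assms(3)) simp_all

lemma red_zero_closed:
  assumes "openin M U"
  shows "\<zero>\<^bsub>sections red U\<^esub> \<in> carrier (sections red U)"
proof -
  interpret U: cring "sections \<O> U" using assms by (rule cring_sections)
  have "b \<in> U \<Longrightarrow> \<zero>\<^bsub>Q b\<^esub> = cls U \<zero>\<^bsub>sections \<O> U\<^esub> b" for b
    using quotient_zero cls_zero[OF _ assms] openin_subset[OF assms] by auto
  then have "\<forall>b\<in>U. (\<lambda>a\<in>U. \<zero>\<^bsub>Q a\<^esub>) b = cls U \<zero>\<^bsub>sections \<O> U\<^esub> b"
    by simp
  then show ?thesis
    unfolding red_simps(2) using assms U.zero_closed by (intro redI) auto
qed

lemma red_add_closed: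
  assumes U: "openin M U" and s: "s \<in> carrier (sections red U)" and t: "t \<in> carrier (sections red U)"
  shows "s \<oplus>\<^bsub>sections red U\<^esub> t \<in> carrier (sections red U)"
proof -
  have "\<exists>W f. openin M W \<and> a \<in> W \<and> W \<subseteq> U \<and> f \<in> carrier (sections \<O> W) \<and>
      (\<forall>b\<in>W. (\<lambda>a\<in>U. s a \<oplus>\<^bsub>Q a\<^esub> t a) b = cls W f b)" if a: "a \<in> U" for a
  proof -
    obtain Z f where Z: "openin M Z" "a \<in> Z" "Z \<subseteq> U" "f \<in> carrier (sections \<O> Z)" "\<forall>b\<in>Z. s b = cls Z f b"
      using red_local[OF s a] .
    obtain Y g where Y: "openin M Y" "a \<in> Y" "Y \<subseteq> U" "g \<in> carrier (sections \<O> Y)" "\<forall>b\<in>Y. t b = cls Y g b"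
      using red_local[OF t a] .
    let ?W = "Z \<inter> Y"
    have W: "openin M ?W" "a \<in> ?W" "?W \<subseteq> U" using Z Y by auto
    have f: "restr \<O> Z ?W f \<in> carrier (sections \<O> ?W)" by (rule restr_closed[OF Z(1) W(1) Int_lower1 Z(4)])
    have g: "restr \<O> Y ?W g \<in> carrier (sections \<O> ?W)" by (rule restr_closed[OF Y(1) W(1) Int_lower2 Y(4)])
    interpret W: cring "sections \<O> ?W" using W(1) by (rule cring_sections)
    have "(\<lambda>a\<in>U. s a \<oplus>\<^bsub>Q a\<^esub> t a) b = cls ?W (restr \<O> Z ?W f \<oplus>\<^bsub>sections \<O> ?W\<^esub> restr \<O> Y ?W g) b"
      if b: "b \<in> ?W" for b
    proof -
      have bA: "b \<in> topspace M" using b openin_subset[OF W(1)] by blast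
      show ?thesis
        using Z(5) Y(5) b W(3) cls_add[OF bA W(1) b f g] cls_restr[OF bA Z(1) W(1) Int_lower1 b Z(4)]
          cls_restr[OF bA Y(1) W(1) Int_lower2 b Y(4)] by auto
    qed
    then show ?thesis using W W.a_closed[OF f g] by blast
  qed
  then show ?thesis unfolding red_simps(3) by (intro redI) simp_all
qed

text \<open>The laws hold pointwise in the rings \<open>Q a\<close>. The pointwise negative is again
  locally induced, namely by the negatives of the local representatives.\<close>

lemma abelian_group_red:
  assumes U: "openin M U"
  shows "abelian_group (sections red U)"
proof -
  have UA: "a \<in> U \<Longrightarrow> a \<in> topspace M" for a using openin_subset[OF U] by blast
  note q = red_in_quotient[OF U]
  have Q: "cring (Q a)" if "a \<in> U" for a using cring_quotient[OF UA[OF that]] .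
  show ?thesis
  proof (rule abelian_groupI)
    show "\<zero>\<^bsub>sections red U\<^esub> \<in> carrier (sections red U)" by (rule red_zero_closed[OF U])
    fix s t r assume s: "s \<in> carrier (sections red U)"
    show "\<zero>\<^bsub>sections red U\<^esub> \<oplus>\<^bsub>sections red U\<^esub> s = s"
      by (rule red_ext[OF red_add_closed[OF U red_zero_closed[OF U] s] s])
        (simp add: red_simps(2,3) cring.cring_simprules(8)[OF Q] q[OF s])
    show "\<exists>y\<in>carrier (sections red U). y \<oplus>\<^bsub>sections red U\<^esub> s = \<zero>\<^bsub>sections red U\<^esub>"
    proof (rule bexI)
      let ?n = "\<lambda>a\<in>U. \<ominus>\<^bsub>Q a\<^esub> s a"
      have "\<exists>W f. openin M W \<and> a \<in> W \<and> W \<subseteq> U \<and> f \<in> carrier (sections \<O> W) \<and> (\<forall>b\<in>W. ?n b = cls W f b)"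
        if a: "a \<in> U" for a
      proof -
        obtain Z f where Z: "openin M Z" "a \<in> Z" "Z \<subseteq> U" "f \<in> carrier (sections \<O> Z)" "\<forall>b\<in>Z. s b = cls Z f b"
          using red_local[OF s a] .
        interpret Z: cring "sections \<O> Z" using Z(1) by (rule cring_sections)
        have "?n b = cls Z (\<ominus>\<^bsub>sections \<O> Z\<^esub> f) b" if b: "b \<in> Z" for b
        proof -
          have bU: "b \<in> U" using Z(3) b by blast
          interpret Qb: cring "Q b" by (rule Q[OF bU])
          have "cls Z (\<ominus>\<^bsub>sections \<O> Z\<^esub> f) b \<oplus>\<^bsub>Q b\<^esub> s b = \<zero>\<^bsub>Q b\<^esub>"
            using cls_a_inv[OF UA[OF bU] Z(1) b Z(4)] Z(5) b quotient_zero[OF UA[OF bU]] by simp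
          then have "\<ominus>\<^bsub>Q b\<^esub> s b = cls Z (\<ominus>\<^bsub>sections \<O> Z\<^esub> f) b"
            using Qb.minus_equality q[OF s bU] cls_closed[OF UA[OF bU] Z(1) b] Z(4) by simp
          then show ?thesis using bU by simp
        qed
        then show ?thesis using Z Z.a_inv_closed[OF Z(4)] by blast
      qed
      then show n: "?n \<in> carrier (sections red U)"
        by (intro redI) simp_all
      show "?n \<oplus>\<^bsub>sections red U\<^esub> s = \<zero>\<^bsub>sections red U\<^esub>"
        by (rule red_ext[OF red_add_closed[OF U n s] red_zero_closed[OF U]])
          (simp add: red_simps(2,3) cring.cring_simprules(9)[OF Q] q[OF s])
    qed
    assume t: "t \<in> carrier (sections red U)"
    show "s \<oplus>\<^bsub>sections red U\<^esub> t \<in> carrier (sections red U)" by (rule red_add_closed[OF U s t])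
    show "s \<oplus>\<^bsub>sections red U\<^esub> t = t \<oplus>\<^bsub>sections red U\<^esub> s"
      by (rule red_ext[OF red_add_closed[OF U s t] red_add_closed[OF U t s]])
        (simp add: red_simps(3) cring.cring_simprules(10)[OF Q q[OF s] q[OF t]])
    assume r: "r \<in> carrier (sections red U)"
    show "s \<oplus>\<^bsub>sections red U\<^esub> t \<oplus>\<^bsub>sections red U\<^esub> r = s \<oplus>\<^bsub>sections red U\<^esub> (t \<oplus>\<^bsub>sections red U\<^esub> r)"
      by (rule red_ext[OF red_add_closed[OF U red_add_closed[OF U s t] r]
            red_add_closed[OF U s red_add_closed[OF U t r]]])
        (simp add: red_simps(3) cring.cring_simprules(7)[OF Q q[OF s] q[OF t] q[OF r]])
  qed
qed

lemma red_smult_zero: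
  assumes U: "openin M U" and f: "f \<in> carrier (sections \<O> U)"
  shows "f \<odot>\<^bsub>sections red U\<^esub> \<zero>\<^bsub>sections red U\<^esub> = \<zero>\<^bsub>sections red U\<^esub>"
proof -
  have "cls U f a \<otimes>\<^bsub>Q a\<^esub> \<zero>\<^bsub>Q a\<^esub> = \<zero>\<^bsub>Q a\<^esub>" if "a \<in> U" for a
  proof -
    have aA: "a \<in> topspace M" using openin_subset[OF U] that by blast
    interpret Qa: cring "Q a" by (rule cring_quotient[OF aA])
    show ?thesis using cls_closed[OF aA U that f] by simp
  qed
  then show ?thesis unfolding red_simps(2,4) by (intro restrict_ext) simp
qed

text \<open>Finitely many open sets on which the values are bounded cover \<open>C\<close>, and off
  \<open>C\<close> the values are zero.\<close>

lemma reduced_value_bounded: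
  assumes U: "openin M U" and s: "s \<in> carrier (sections red U)"
    and C: "compactin M C" "C \<subseteq> U" and 0: "\<And>a. a \<in> U - C \<Longrightarrow> s a = \<zero>\<^bsub>Q a\<^esub>"
  obtains B where "\<And>a. a \<in> U \<Longrightarrow> cmod (reduced_value M \<O> s a) \<le> B"
proof -
  have UA: "a \<in> U \<Longrightarrow> a \<in> topspace M" for a using openin_subset[OF U] by blast
  define \<W> where "\<W> = {W. openin M W \<and> (\<exists>B. \<forall>b\<in>W. cmod (reduced_value M \<O> s b) \<le> B)}"
  have "\<exists>W\<in>\<W>. a \<in> W" if "a \<in> C" for a
  proof -
    have aU: "a \<in> U" using that C by blast
    obtain V f where V: "openin M V" "a \<in> V" "V \<subseteq> U" "f \<in> carrier (sections \<O> V)" "\<forall>b\<in>V. s b = cls V f b"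
      using red_local[OF s aU] .
    obtain W B where W: "openin M W" "a \<in> W" "W \<subseteq> V" "\<And>b. b \<in> W \<Longrightarrow> cmod (sec_value M \<O> V f b) \<le> B"
      by (rule sec_value_locally_bounded[OF V(1,4,2)]) blast
    have "reduced_value M \<O> s b = sec_value M \<O> V f b" if b: "b \<in> W" for b
    proof -
      have bV: "b \<in> V" using W b by blast
      then have bA: "b \<in> topspace M" using UA V by blast
      show ?thesis
        unfolding sec_value_def
        by (rule reduced_value_coset[OF bA _ germ_closed[OF V(1) bV V(4)]])
          (use V(5) bV in \<open>simp add: stalk_class_def\<close>)
    qed
    then have "W \<in> \<W>" unfolding \<W>_def using W by auto
    then show ?thesis using W by blast
  qed
  then have "C \<subseteq> \<Union>\<W>" by blast
  then obtain \<F> where F: "finite \<F>" "\<F> \<subseteq> \<W>" "C \<subseteq> \<Union>\<F>"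
    using compactinD[OF C(1), of \<W>] unfolding \<W>_def by auto
  have "\<exists>B. \<forall>b\<in>\<Union>\<F>. cmod (reduced_value M \<O> s b) \<le> B"
    using F(1,2)
  proof (induction \<F> rule: finite_induct)
    case (insert W \<F>)
    then obtain B B' where "\<forall>b\<in>\<Union>\<F>. cmod (reduced_value M \<O> s b) \<le> B"
      "\<forall>b\<in>W. cmod (reduced_value M \<O> s b) \<le> B'"
      unfolding \<W>_def by auto
    then show ?case by (intro exI[of _ "max B B'"]) force
  qed simp
  then obtain B where B: "\<forall>b\<in>\<Union>\<F>. cmod (reduced_value M \<O> s b) \<le> B" by blast
  have "cmod (reduced_value M \<O> s a) \<le> max B 0" if "a \<in> U" for a
  proof (cases "a \<in> C")
    case True
    then show ?thesis using B F by fastforce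
  next
    case False
    then have "reduced_value M \<O> s a = 0"
      using reduced_value_zero[OF UA[OF that]] 0[of a] quotient_zero[OF UA[OF that]] that by simp
    then show ?thesis by simp
  qed
  then show ?thesis by (rule that)
qed

end

section \<open>Differential operators\<close>

context formal_module_sheaf
begin

abbreviation "commutator \<equiv> sheaf_commutator \<O> \<F> red"
abbreviation "Diffc U \<equiv> Diff_c M \<O> \<F> red U"
abbreviation "dsn \<equiv> diff_seminorm M \<O>"

text \<open>This is commutativity of \<open>\<O>\<close>, and the reason why multiplication by a
  cutoff can be moved past commutators.\<close>

lemma act_commute:
  assumes "openin M W" "openin M Z" "openin M V" "V \<subseteq> W" "V \<subseteq> Z"
    and "f \<in> carrier (sections \<O> W)" "g \<in> carrier (sections \<O> Z)" "u \<in> carrier (sections \<F> V)"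
  shows "act W f V (act Z g V u) = act Z g V (act W f V u)"
proof -
  interpret V: module "sections \<O> V" "sections \<F> V" using assms by (intro F.module_sections)
  have f: "restr \<O> W V f \<in> carrier (sections \<O> V)" and g: "restr \<O> Z V g \<in> carrier (sections \<O> V)"
    using assms restr_closed by blast+
  show ?thesis
    unfolding act_def V.smult_assoc1[OF f g assms(8), symmetric] V.smult_assoc1[OF g f assms(8), symmetric]
      V.m_comm[OF f g] ..
qed

lemma commutator_eq:
  "commutator Z D f V u = D V (act Z f V u) \<ominus>\<^bsub>sections red V\<^esub> restr \<O> Z V f \<odot>\<^bsub>sections red V\<^esub> D V u"
  by (simp add: sheaf_commutator_def act_def)

text \<open>If \<open>D1\<close> is \<open>D2\<close> after multiplication by \<open>g\<close>, then
  the same relation holds between their commutators with \<open>f\<close>, because \<open>f\<close>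
  and \<open>g\<close> commute. \<open>D1\<close> and \<open>D2\<close> stay arbitrary so that the
  induction can pass to these commutators.\<close>

lemma foldl_commutator_precompose:
  assumes Z: "openin M Z" "Z \<subseteq> W" and W: "openin M W" "g \<in> carrier (sections \<O> W)"
    and D: "\<And>V u. \<lbrakk>openin M V; V \<subseteq> Z; u \<in> carrier (sections \<F> V)\<rbrakk> \<Longrightarrow> D1 V u = D2 V (act W g V u)"
    and fs: "set fs \<subseteq> carrier (sections \<O> Z)"
    and V: "openin M V" "V \<subseteq> Z" "u \<in> carrier (sections \<F> V)"
  shows "foldl (commutator Z) D1 fs V u = foldl (commutator Z) D2 fs V (act W g V u)"
  using D fs V
proof (induction fs arbitrary: D1 D2 V u)
  case (Cons f fs)
  have "commutator Z D1 f V u = commutator Z D2 f V (act W g V u)"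
    if V: "openin M V" "V \<subseteq> Z" and u: "u \<in> carrier (sections \<F> V)" for V u
  proof -
    have f: "f \<in> carrier (sections \<O> Z)" using Cons.prems(2) by simp
    have VW: "V \<subseteq> W" using V Z by blast
    have "D1 V (act Z f V u) = D2 V (act W g V (act Z f V u))"
      by (rule Cons.prems(1)[OF V act_closed[OF Z(1) V f u]])
    also have "act W g V (act Z f V u) = act Z f V (act W g V u)"
      by (rule act_commute[OF W(1) Z(1) V(1) VW V(2) W(2) f u])
    finally show ?thesis
      unfolding commutator_eq Cons.prems(1)[OF V u] by simp
  qed
  then show ?case
    using Cons.IH[of "commutator Z D1 f" "commutator Z D2 f" V u] Cons.prems(2-5) by simp
qed simp

text \<open>Operators are families indexed by all sets, so agreement can be expected only over open
  \<open>V \<subseteq> Z\<close>; commutators with sections over \<open>Z\<close> look no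
  further.\<close>

lemma foldl_commutator_cong:
  assumes Z: "openin M Z"
    and D: "\<And>V u. \<lbrakk>openin M V; V \<subseteq> Z; u \<in> carrier (sections \<F> V)\<rbrakk> \<Longrightarrow> D1 V u = D2 V u"
    and fs: "set fs \<subseteq> carrier (sections \<O> Z)"
    and V: "openin M V" "V \<subseteq> Z" "u \<in> carrier (sections \<F> V)"
  shows "foldl (commutator Z) D1 fs V u = foldl (commutator Z) D2 fs V u"
  using D fs V
proof (induction fs arbitrary: D1 D2 V u)
  case (Cons f fs)
  have "commutator Z D1 f V u = commutator Z D2 f V u"
    if V: "openin M V" "V \<subseteq> Z" and u: "u \<in> carrier (sections \<F> V)" for V u
    unfolding commutator_eq using Cons.prems(1)[OF V u]
      Cons.prems(1)[OF V act_closed[OF Z V _ u], of f] Cons.prems(2) by simp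
  then show ?case
    using Cons.IH[of "commutator Z D1 f" "commutator Z D2 f" V u] Cons.prems(2-5) by simp
qed simp

lemma foldl_commutator_zero:
  assumes Z: "openin M Z"
    and D: "\<And>V u. \<lbrakk>openin M V; V \<subseteq> Z; u \<in> carrier (sections \<F> V)\<rbrakk> \<Longrightarrow> D V u = \<zero>\<^bsub>sections red V\<^esub>"
    and fs: "set fs \<subseteq> carrier (sections \<O> Z)"
    and V: "openin M V" "V \<subseteq> Z" "u \<in> carrier (sections \<F> V)"
  shows "foldl (commutator Z) D fs V u = \<zero>\<^bsub>sections red V\<^esub>"
  using D fs V
proof (induction fs arbitrary: D V u)
  case (Cons f fs)
  have "commutator Z D f V u = \<zero>\<^bsub>sections red V\<^esub>"
    if V: "openin M V" "V \<subseteq> Z" and u: "u \<in> carrier (sections \<F> V)" for V u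
  proof -
    interpret V: abelian_group "sections red V" by (rule abelian_group_red[OF V(1)])
    have f: "f \<in> carrier (sections \<O> Z)" using Cons.prems(2) by simp
    show ?thesis
      unfolding commutator_eq Cons.prems(1)[OF V u] Cons.prems(1)[OF V act_closed[OF Z V f u]]
        red_smult_zero[OF V(1) restr_closed[OF Z V f]] by (simp add: V.minus_eq V.r_neg)
  qed
  then show ?case
    using Cons.IH[of "commutator Z D f" V u] Cons.prems(2-5) by simp
qed simp

lemma order_le_mono: "order_le M \<O> \<F> red U D r \<Longrightarrow> V \<subseteq> U \<Longrightarrow> order_le M \<O> \<F> red V D r"
  unfolding order_le_def by (meson subset_trans)

lemma order_le_precompose:
  assumes U: "openin M U" "U \<subseteq> W" and W: "openin M W" "g \<in> carrier (sections \<O> W)"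
    and D: "order_le M \<O> \<F> red U D2 r"
    and eq: "\<And>V u. \<lbrakk>openin M V; V \<subseteq> U; u \<in> carrier (sections \<F> V)\<rbrakk> \<Longrightarrow> D1 V u = D2 V (act W g V u)"
  shows "order_le M \<O> \<F> red U D1 r"
  unfolding order_le_def zero_on_def
proof (intro allI impI ballI)
  fix Z fs V u
  assume Z: "openin M Z \<and> Z \<subseteq> U \<and> length fs = Suc r \<and> set fs \<subseteq> carrier (sections \<O> Z)"
    and V: "openin M V \<and> V \<subseteq> Z" and u: "u \<in> carrier (sections \<F> V)"
  have ZW: "Z \<subseteq> W" using Z U by blast
  have VW: "V \<subseteq> W" using V ZW by blast
  have "foldl (commutator Z) D1 fs V u = foldl (commutator Z) D2 fs V (act W g V u)"
  proof (rule foldl_commutator_precompose[OF _ ZW W])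
    show "D1 V u = D2 V (act W g V u)" if "openin M V" "V \<subseteq> Z" "u \<in> carrier (sections \<F> V)" for V u
      using eq that Z by blast
  qed (use Z V u in auto)
  also have "\<dots> = \<zero>\<^bsub>sections red V\<^esub>"
    using D Z V act_closed[OF W(1) _ VW W(2) u] unfolding order_le_def zero_on_def by blast
  finally show "foldl (commutator Z) D1 fs V u = \<zero>\<^bsub>sections red V\<^esub>" .
qed

lemma order_le_cong:
  assumes U: "openin M U" and D: "order_le M \<O> \<F> red U D2 r"
    and eq: "\<And>V u. \<lbrakk>openin M V; V \<subseteq> U; u \<in> carrier (sections \<F> V)\<rbrakk> \<Longrightarrow> D1 V u = D2 V u"
  shows "order_le M \<O> \<F> red U D1 r"
  unfolding order_le_def zero_on_def
proof (intro allI impI ballI)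
  fix Z fs V u
  assume Z: "openin M Z \<and> Z \<subseteq> U \<and> length fs = Suc r \<and> set fs \<subseteq> carrier (sections \<O> Z)"
    and V: "openin M V \<and> V \<subseteq> Z" and u: "u \<in> carrier (sections \<F> V)"
  have "foldl (commutator Z) D1 fs V u = foldl (commutator Z) D2 fs V u"
  proof (rule foldl_commutator_cong)
    show "D1 V u = D2 V u" if "openin M V" "V \<subseteq> Z" "u \<in> carrier (sections \<F> V)" for V u
      using eq that Z by blast
  qed (use Z V u in auto)
  also have "\<dots> = \<zero>\<^bsub>sections red V\<^esub>"
    using D Z V u unfolding order_le_def zero_on_def by blast
  finally show "foldl (commutator Z) D1 fs V u = \<zero>\<^bsub>sections red V\<^esub>" .
qed

lemma order_le_zero:
  assumes U: "openin M U"
    and eq: "\<And>V u. \<lbrakk>openin M V; V \<subseteq> U; u \<in> carrier (sections \<F> V)\<rbrakk> \<Longrightarrow> D V u = \<zero>\<^bsub>sections red V\<^esub>"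
  shows "order_le M \<O> \<F> red U D r"
  unfolding order_le_def zero_on_def
proof (intro allI impI ballI)
  fix Z fs V u
  assume Z: "openin M Z \<and> Z \<subseteq> U \<and> length fs = Suc r \<and> set fs \<subseteq> carrier (sections \<O> Z)"
    and V: "openin M V \<and> V \<subseteq> Z" and u: "u \<in> carrier (sections \<F> V)"
  show "foldl (commutator Z) D fs V u = \<zero>\<^bsub>sections red V\<^esub>"
  proof (rule foldl_commutator_zero)
    show "D V u = \<zero>\<^bsub>sections red V\<^esub>" if "openin M V" "V \<subseteq> Z" "u \<in> carrier (sections \<F> V)" for V u
      using eq that Z by blast
  qed (use Z V u in auto)
qed

lemma red_vs_simps:
  "carrier (sections_vs \<O> red U) = carrier (sections red U)"
  "add (sections_vs \<O> red U) = add (sections red U)"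
  "c \<odot>\<^bsub>sections_vs \<O> red U\<^esub> s = const U c \<odot>\<^bsub>sections red U\<^esub> s"
  by (simp_all add: sections_vs_def const_def)

lemma sheaf_homD:
  assumes "sheaf_hom M \<O> \<F> red U D" "openin M V" "V \<subseteq> U"
  shows sheaf_hom_linear: "linear_between (vs V) (sections_vs \<O> red V) (D V)"
    and sheaf_hom_closed: "u \<in> carrier (sections \<F> V) \<Longrightarrow> D V u \<in> carrier (sections red V)"
    and sheaf_hom_add: "u \<in> carrier (sections \<F> V) \<Longrightarrow> v \<in> carrier (sections \<F> V) \<Longrightarrow>
      D V (u \<oplus>\<^bsub>sections \<F> V\<^esub> v) = D V u \<oplus>\<^bsub>sections red V\<^esub> D V v"
    and sheaf_hom_zero: "D V \<zero>\<^bsub>sections \<F> V\<^esub> = \<zero>\<^bsub>sections red V\<^esub>"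
    and sheaf_hom_restr: "openin M W \<Longrightarrow> W \<subseteq> V \<Longrightarrow> u \<in> carrier (sections \<F> V) \<Longrightarrow>
      D W (restr \<F> V W u) = restrict (D V u) W"
proof -
  show lin: "linear_between (vs V) (sections_vs \<O> red V) (D V)"
    using assms unfolding sheaf_hom_def by blast
  show cl: "D V u \<in> carrier (sections red V)" if "u \<in> carrier (sections \<F> V)" for u
    using linear_between_closed[OF lin, of u] that by (simp add: red_vs_simps)
  show add: "D V (u \<oplus>\<^bsub>sections \<F> V\<^esub> v) = D V u \<oplus>\<^bsub>sections red V\<^esub> D V v"
    if "u \<in> carrier (sections \<F> V)" "v \<in> carrier (sections \<F> V)" for u v
    using linear_between_add[OF lin, of u v] that by (simp add: red_vs_simps)
  interpret V: module "sections \<O> V" "sections \<F> V" using assms(2) by (rule F.module_sections)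
  interpret r: abelian_group "sections red V" by (rule abelian_group_red[OF assms(2)])
  show "D V \<zero>\<^bsub>sections \<F> V\<^esub> = \<zero>\<^bsub>sections red V\<^esub>"
    using add[of "\<zero>\<^bsub>sections \<F> V\<^esub>" "\<zero>\<^bsub>sections \<F> V\<^esub>"] cl[of "\<zero>\<^bsub>sections \<F> V\<^esub>"]
    by (intro r.add_idem_zero) simp_all
  show "D W (restr \<F> V W u) = restrict (D V u) W"
    if "openin M W" "W \<subseteq> V" "u \<in> carrier (sections \<F> V)"
    using assms that unfolding sheaf_hom_def red_simps(5) by blast
qed

lemma op_support_subset: "op_support M \<F> red U D \<subseteq> U"
  unfolding op_support_def by blast

text \<open>The support is the intersection of \<open>C\<close> with a closed set, hence
  compact.\<close>

lemma Diff_cI: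
  assumes U: "openin M U" and D: "diff_op M \<O> \<F> red U D" and C: "compactin M C" "C \<subseteq> U"
    and 0: "\<And>V u. \<lbrakk>openin M V; V \<subseteq> U - C; u \<in> carrier (sections \<F> V)\<rbrakk> \<Longrightarrow> D V u = \<zero>\<^bsub>sections red V\<^esub>"
  shows "D \<in> Diffc U"
proof -
  define N where "N = \<Union>{V. openin M V \<and> V \<subseteq> U \<and> zero_on M \<F> red V D}"
  have "zero_on M \<F> red (U - C) D" unfolding zero_on_def using 0 by blast
  then have "U - C \<subseteq> N"
    unfolding N_def using openin_diff_compact[OF U C(1)] by blast
  then have "op_support M \<F> red U D = C \<inter> (topspace M - N)"
    unfolding op_support_def N_def[symmetric] using C(2) openin_subset[OF U] by blast
  moreover have "openin M N" unfolding N_def by blast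
  then have "closedin M (topspace M - N)" by (rule closedin_diff[OF closedin_topspace])
  ultimately have "compactin M (op_support M \<F> red U D)"
    using compact_Int_closedin[OF C(1)] by simp
  then show ?thesis unfolding Diff_c_def using D by blast
qed

text \<open>Sections of \<open>red\<close> are functions of the point and restriction is
  \<open>restrict\<close>, so vanishing over a neighbourhood \<open>W\<close> of \<open>a\<close>
  can be read off at \<open>a\<close> after restricting to \<open>V \<inter> W\<close>.\<close>

lemma Diff_c_vanish:
  assumes U: "openin M U" and D: "sheaf_hom M \<O> \<F> red U D"
    and V: "openin M V" "V \<subseteq> U" "u \<in> carrier (sections \<F> V)" and a: "a \<in> V - op_support M \<F> red U D"
  shows "D V u a = \<zero>\<^bsub>Q a\<^esub>"
proof -
  obtain W where W: "openin M W" "W \<subseteq> U" "zero_on M \<F> red W D" "a \<in> W"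
    using a V unfolding op_support_def by blast
  let ?Z = "V \<inter> W"
  have Z: "openin M ?Z" using V W by blast
  have "restrict (D V u) ?Z = D ?Z (restr \<F> V ?Z u)"
    by (rule sheaf_hom_restr[OF D V(1,2) Z _ V(3), symmetric]) simp
  also have "\<dots> = \<zero>\<^bsub>sections red ?Z\<^esub>"
    using W(3) Z F.restr_closed[OF V(1) Z _ V(3)] unfolding zero_on_def by simp
  finally show ?thesis
    using a W(4) by (auto simp: red_simps(2) dest: fun_cong[of _ _ a])
qed

lemma Diff_c_vanish_on:
  assumes U: "openin M U" and D: "sheaf_hom M \<O> \<F> red U D"
    and V: "openin M V" "V \<subseteq> U - op_support M \<F> red U D" "u \<in> carrier (sections \<F> V)"
  shows "D V u = \<zero>\<^bsub>sections red V\<^esub>"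
proof (rule red_ext[OF sheaf_hom_closed[OF D V(1) _ V(3)] red_zero_closed[OF V(1)]])
  show VU: "V \<subseteq> U" using V by blast
  show "D V u a = \<zero>\<^bsub>sections red V\<^esub> a" if "a \<in> V" for a
    using Diff_c_vanish[OF U D V(1) VU V(3)] that V(2) by (auto simp: red_simps(2))
qed

lemma diff_op_restrict:
  assumes U: "openin M U" and V: "openin M V" "V \<subseteq> U" and D: "diff_op M \<O> \<F> red U D"
  shows "diff_op M \<O> \<F> red V D"
  unfolding diff_op_def
proof (intro conjI ballI)
  show "sheaf_hom M \<O> \<F> red V D"
    using D V unfolding diff_op_def sheaf_hom_def by (meson subset_trans)
  fix a assume a: "a \<in> V"
  then obtain W r where "openin M W" "a \<in> W" "W \<subseteq> U" "order_le M \<O> \<F> red W D r"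
    using D V unfolding diff_op_def by blast
  then show "\<exists>W r. openin M W \<and> a \<in> W \<and> W \<subseteq> V \<and> order_le M \<O> \<F> red W D r"
    using V a order_le_mono[of W D r "W \<inter> V"] by (intro exI[of _ "W \<inter> V"] exI[of _ r]) auto
qed

section \<open>Composition with multipliers and extension of operators by zero\<close>

definition precompose :: "'a set \<Rightarrow> 'r \<Rightarrow> ('a set \<Rightarrow> 'f \<Rightarrow> 'a \<Rightarrow> ('a set \<times> 'r) set set)
    \<Rightarrow> ('a set \<Rightarrow> 'f \<Rightarrow> 'a \<Rightarrow> ('a set \<times> 'r) set set)"
  where "precompose W g D = (\<lambda>V u. D V (act W g V u))"

lemma diff_op_precompose:
  assumes U: "openin M U" "U \<subseteq> W" and W: "openin M W" "g \<in> carrier (sections \<O> W)"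
    and D: "diff_op M \<O> \<F> red U D"
  shows "diff_op M \<O> \<F> red U (precompose W g D)"
  unfolding diff_op_def
proof (intro conjI ballI)
  have hom: "sheaf_hom M \<O> \<F> red U D" using D by (simp add: diff_op_def)
  show "sheaf_hom M \<O> \<F> red U (precompose W g D)"
    unfolding sheaf_hom_def precompose_def
  proof (intro conjI allI impI ballI)
    fix V assume "openin M V \<and> V \<subseteq> U"
    then have V: "openin M V" "V \<subseteq> U" "V \<subseteq> W" using U by auto
    show "linear_between (vs V) (sections_vs \<O> red V) (\<lambda>u. D V (act W g V u))"
      using linear_between_compose[OF linear_act[OF W(1) V(1,3) W(2)] sheaf_hom_linear[OF hom V(1,2)]]
      by (simp add: comp_def)
  next
    fix V Z u assume *: "openin M V \<and> openin M Z \<and> Z \<subseteq> V \<and> V \<subseteq> U" and u: "u \<in> carrier (sections \<F> V)"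
    then have V: "openin M V" "V \<subseteq> U" "V \<subseteq> W" and Z: "openin M Z" "Z \<subseteq> V" using U by auto
    show "D Z (act W g Z (restr \<F> V Z u)) = restr red V Z (D V (act W g V u))"
      unfolding act_restr[OF W(1) V(1) Z(1,2) V(3) W(2) u, symmetric] red_simps(5)
      by (rule sheaf_hom_restr[OF hom V(1,2) Z act_closed[OF W(1) V(1,3) W(2) u]])
  qed
  fix a assume "a \<in> U"
  then obtain V r where V: "openin M V" "a \<in> V" "V \<subseteq> U" "order_le M \<O> \<F> red V D r"
    using D unfolding diff_op_def by blast
  have VW: "V \<subseteq> W" using V U by blast
  have "order_le M \<O> \<F> red V (precompose W g D) r"
    by (rule order_le_precompose[OF V(1) VW W V(4)]) (simp add: precompose_def)
  then show "\<exists>V r. openin M V \<and> a \<in> V \<and> V \<subseteq> U \<and> order_le M \<O> \<F> red V (precompose W g D) r"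
    using V by blast
qed

lemma Diff_cD:
  assumes "D \<in> Diffc U"
  shows "diff_op M \<O> \<F> red U D" "sheaf_hom M \<O> \<F> red U D" "compactin M (op_support M \<F> red U D)"
  using assms unfolding Diff_c_def diff_op_def by auto

lemma Diff_c_precompose:
  assumes U: "openin M U" "U \<subseteq> W" and W: "openin M W" "g \<in> carrier (sections \<O> W)" and D: "D \<in> Diffc U"
  shows "precompose W g D \<in> Diffc U"
proof (rule Diff_cI[OF U(1) diff_op_precompose[OF U W Diff_cD(1)[OF D]] Diff_cD(3)[OF D] op_support_subset])
  fix V u assume V: "openin M V" "V \<subseteq> U - op_support M \<F> red U D" and u: "u \<in> carrier (sections \<F> V)"
  have VW: "V \<subseteq> W" using V U by blast
  show "precompose W g D V u = \<zero>\<^bsub>sections red V\<^esub>"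
    unfolding precompose_def
    by (rule Diff_c_vanish_on[OF U(1) Diff_cD(2)[OF D] V act_closed[OF W(1) V(1) VW W(2) u]])
qed

text \<open>Multiplication by \<open>g\<close> kills sections over open sets that avoid
  \<open>C\<close>, so the composite has its support in \<open>C\<close> even if the support of
  \<open>D\<close> leaves \<open>U\<close>.\<close>

lemma Diff_c_precompose_cutoff:
  assumes U: "openin M U" and D: "D \<in> Diffc A" and g: "g \<in> carrier (sections \<O> A)"
    and C: "compactin M C" "C \<subseteq> U" and g0: "restr \<O> A (A - C) g = \<zero>\<^bsub>sections \<O> (A - C)\<^esub>"
  shows "precompose A g D \<in> Diffc U"
proof -
  note UA = openin_subset[OF U]
  have AC: "openin M (A - C)" using openin_diff_compact[OF openin_topspace C(1)] .
  have D': "diff_op M \<O> \<F> red U D" by (rule diff_op_restrict[OF openin_topspace U UA Diff_cD(1)[OF D]])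
  show ?thesis
  proof (rule Diff_cI[OF U diff_op_precompose[OF U UA openin_topspace g D'] C])
    fix V u assume V: "openin M V" "V \<subseteq> U - C" and u: "u \<in> carrier (sections \<F> V)"
    have VC: "V \<subseteq> A - C" and VA: "V \<subseteq> A" using V UA by auto
    have "restr \<O> A V g = restr \<O> (A - C) V (restr \<O> A (A - C) g)"
      by (rule restr_restr[symmetric, OF openin_topspace AC V(1) VC _ g]) blast
    then have "restr \<O> A V g = \<zero>\<^bsub>sections \<O> V\<^esub>"
      unfolding g0 using restr_zero[OF AC V(1) VC] by simp
    then have "act A g V u = \<zero>\<^bsub>sections \<F> V\<^esub>" by (rule act_zero[OF V(1) _ u])
    then show "precompose A g D V u = \<zero>\<^bsub>sections red V\<^esub>"
      unfolding precompose_def using sheaf_hom_zero[OF Diff_cD(2)[OF D] V(1) VA] by simp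
  qed
qed

text \<open>Sections of \<open>red\<close> are families of elements of the rings \<open>Q a\<close>,
  so extension by zero can be written pointwise, without gluing. That the padded family is again a
  section depends on the compact support of \<open>D\<close>.\<close>

definition extend_op :: "'a set \<Rightarrow> ('a set \<Rightarrow> 'f \<Rightarrow> 'a \<Rightarrow> ('a set \<times> 'r) set set)
    \<Rightarrow> ('a set \<Rightarrow> 'f \<Rightarrow> 'a \<Rightarrow> ('a set \<times> 'r) set set)"
  where "extend_op U D = (\<lambda>V u. \<lambda>a\<in>V. if a \<in> U then D (V \<inter> U) (restr \<F> V (V \<inter> U) u) a else \<zero>\<^bsub>Q a\<^esub>)"

context
  fixes U D assumes U: "openin M U" and D: "D \<in> Diffc U"
begin

private abbreviation (input) "C \<equiv> op_support M \<F> red U D"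

private lemma hom: "sheaf_hom M \<O> \<F> red U D" by (rule Diff_cD(2)[OF D])

private lemma restr_VU:
  assumes "openin M V" "u \<in> carrier (sections \<F> V)"
  shows "openin M (V \<inter> U)" "restr \<F> V (V \<inter> U) u \<in> carrier (sections \<F> (V \<inter> U))"
  using assms U F.restr_closed[of V "V \<inter> U" u] by auto

lemma extend_op_vanish:
  assumes V: "openin M V" and u: "u \<in> carrier (sections \<F> V)" and b: "b \<in> V - C"
  shows "extend_op U D V u b = \<zero>\<^bsub>Q b\<^esub>"
  using Diff_c_vanish[OF U hom restr_VU(1)[OF V u] _ restr_VU(2)[OF V u], of b] b
  unfolding extend_op_def by auto

lemma extend_op_eq:
  assumes V: "openin M V" "V \<subseteq> U" and u: "u \<in> carrier (sections \<F> V)"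
  shows "extend_op U D V u = D V u"
proof -
  have VU: "V \<inter> U = V" using V by blast
  have "D V u \<in> extensional V"
    using sheaf_hom_closed[OF hom V u] by (simp add: red_simps(1))
  then show ?thesis
    unfolding extend_op_def VU F.restr_self[OF V(1) u] using V(2)
    by (intro extensionalityI[of _ V]) auto
qed

text \<open>Near a point of \<open>U\<close> the family is induced by a representative of the value
  of \<open>D\<close>. A point of \<open>V\<close> outside \<open>U\<close> has the neighbourhood
  \<open>V - C\<close>, open because \<open>C\<close> is compact, on which the family is
  zero.\<close>

lemma extend_op_closed:
  assumes V: "openin M V" and u: "u \<in> carrier (sections \<F> V)"
  shows "extend_op U D V u \<in> carrier (sections red V)"
proof (rule redI)
  show "extend_op U D V u \<in> extensional V" unfolding extend_op_def by (rule restrict_extensional)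
  fix a assume a: "a \<in> V"
  show "\<exists>Z f. openin M Z \<and> a \<in> Z \<and> Z \<subseteq> V \<and> f \<in> carrier (sections \<O> Z) \<and>
      (\<forall>b\<in>Z. extend_op U D V u b = cls Z f b)"
  proof (cases "a \<in> U")
    case True
    have s: "D (V \<inter> U) (restr \<F> V (V \<inter> U) u) \<in> carrier (sections red (V \<inter> U))"
      by (rule sheaf_hom_closed[OF hom restr_VU(1)[OF V u] Int_lower2 restr_VU(2)[OF V u]])
    have "a \<in> V \<inter> U" using a True by blast
    then obtain Z f where Z: "openin M Z" "a \<in> Z" "Z \<subseteq> V \<inter> U" "f \<in> carrier (sections \<O> Z)"
      "\<forall>b\<in>Z. D (V \<inter> U) (restr \<F> V (V \<inter> U) u) b = cls Z f b"
      by (rule red_local[OF s])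
    have "\<forall>b\<in>Z. extend_op U D V u b = cls Z f b"
      using Z(3,5) unfolding extend_op_def by auto
    then show ?thesis using Z(1-4) by blast
  next
    case False
    let ?Z = "V - C"
    have Z: "openin M ?Z" "a \<in> ?Z" "?Z \<subseteq> V"
      using openin_diff_compact[OF V Diff_cD(3)[OF D]] a False op_support_subset[of U D] by auto
    interpret Z: cring "sections \<O> ?Z" by (rule cring_sections[OF Z(1)])
    have "extend_op U D V u b = cls ?Z \<zero>\<^bsub>sections \<O> ?Z\<^esub> b" if b: "b \<in> ?Z" for b
    proof -
      have bA: "b \<in> A" using openin_subset[OF V] b by blast
      show ?thesis
        using extend_op_vanish[OF V u b] cls_zero[OF bA Z(1) b] quotient_zero[OF bA] by simp
    qed
    then show ?thesis using Z Z.zero_closed by blast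
  qed
qed

lemma sheaf_hom_extend_op: "sheaf_hom M \<O> \<F> red A (extend_op U D)"
  unfolding sheaf_hom_def
proof (intro conjI allI impI ballI)
  fix V assume "openin M V \<and> V \<subseteq> A"
  then have V: "openin M V" by blast
  have VU: "openin M (V \<inter> U)" "V \<inter> U \<subseteq> V" "V \<inter> U \<subseteq> U" using V U by auto
  interpret V: module "sections \<O> V" "sections \<F> V" using V by (rule F.module_sections)
  interpret Vv: module complex_ring "vs V" by (rule module_vs[OF V])
  have Q: "cring (Q a)" if "a \<in> V" for a
    using openin_subset[OF V] that by (intro cring_quotient) blast
  show "linear_between (vs V) (sections_vs \<O> red V) (extend_op U D V)"
    unfolding linear_between_def red_vs_simps vs_simps(1,2)
  proof (intro conjI funcsetI ballI allI)
    fix u assume u: "u \<in> carrier (sections \<F> V)"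
    show "extend_op U D V u \<in> carrier (sections red V)" by (rule extend_op_closed[OF V u])
    note ru = restr_VU(2)[OF V u]
    { fix v assume v: "v \<in> carrier (sections \<F> V)"
      note rv = restr_VU(2)[OF V v]
      have "D (V \<inter> U) (restr \<F> V (V \<inter> U) (u \<oplus>\<^bsub>sections \<F> V\<^esub> v))
          = D (V \<inter> U) (restr \<F> V (V \<inter> U) u) \<oplus>\<^bsub>sections red (V \<inter> U)\<^esub> D (V \<inter> U) (restr \<F> V (V \<inter> U) v)"
        unfolding F.restr_add[OF V VU(1,2) u v] by (rule sheaf_hom_add[OF hom VU(1,3) ru rv])
      then show "extend_op U D V (u \<oplus>\<^bsub>sections \<F> V\<^esub> v)
          = extend_op U D V u \<oplus>\<^bsub>sections red V\<^esub> extend_op U D V v"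
        unfolding extend_op_def red_simps(3)
        by (intro restrict_ext) (simp add: cring.cring_simprules(8)[OF Q] cring.cring_simprules(2)[OF Q]) }
    fix c
    have "D (V \<inter> U) (restr \<F> V (V \<inter> U) (c \<odot>\<^bsub>vs V\<^esub> u))
        = const (V \<inter> U) c \<odot>\<^bsub>sections red (V \<inter> U)\<^esub> D (V \<inter> U) (restr \<F> V (V \<inter> U) u)"
      unfolding restr_vs_smult[OF V VU(1,2) u] red_vs_simps(3)[symmetric]
      by (rule linear_between_smult[OF sheaf_hom_linear[OF hom VU(1,3)]]) (simp add: ru)
    moreover have "cls (V \<inter> U) (const (V \<inter> U) c) a = cls V (const V c) a" if "a \<in> V \<inter> U" for a
      using cls_restr[OF _ V VU(1,2) that const_closed[OF V]] restr_const[OF V VU(1,2)]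
        openin_subset[OF V] that by auto
    moreover have "cls V (const V c) a \<otimes>\<^bsub>Q a\<^esub> \<zero>\<^bsub>Q a\<^esub> = \<zero>\<^bsub>Q a\<^esub>" if "a \<in> V" for a
      using cring.cring_simprules(27)[OF Q[OF that]] cls_closed[OF _ V that const_closed[OF V]]
        openin_subset[OF V] that by auto
    ultimately show "extend_op U D V (c \<odot>\<^bsub>vs V\<^esub> u) = const V c \<odot>\<^bsub>sections red V\<^esub> extend_op U D V u"
      unfolding extend_op_def red_simps(4) by (intro restrict_ext) (simp del: vs_simps)
  qed
next
  fix V W u assume *: "openin M V \<and> openin M W \<and> W \<subseteq> V \<and> V \<subseteq> A" and u: "u \<in> carrier (sections \<F> V)"
  then have V: "openin M V" and W: "openin M W" "W \<subseteq> V" by auto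
  have VU: "openin M (V \<inter> U)" "V \<inter> U \<subseteq> V" "V \<inter> U \<subseteq> U"
    and WU: "openin M (W \<inter> U)" "W \<inter> U \<subseteq> W" "W \<inter> U \<subseteq> V \<inter> U" using V W U by auto
  have "restr \<F> W (W \<inter> U) (restr \<F> V W u) = restr \<F> V (W \<inter> U) u"
    by (rule F.restr_restr[OF V W(1) WU(1,2) W(2) u])
  also have "\<dots> = restr \<F> (V \<inter> U) (W \<inter> U) (restr \<F> V (V \<inter> U) u)"
    by (rule F.restr_restr[symmetric, OF V VU(1) WU(1,3) VU(2) u])
  finally have "D (W \<inter> U) (restr \<F> W (W \<inter> U) (restr \<F> V W u))
      = restrict (D (V \<inter> U) (restr \<F> V (V \<inter> U) u)) (W \<inter> U)"
    using sheaf_hom_restr[OF hom VU(1,3) WU(1,3) restr_VU(2)[OF V u]] by simp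
  then show "extend_op U D W (restr \<F> V W u) = restr red V W (extend_op U D V u)"
    unfolding extend_op_def red_simps(5) using W(2)
    by (auto simp: restrict_def fun_eq_iff)
qed

text \<open>Locally finite order can be checked on the two open sets \<open>U\<close> and
  \<open>A - C\<close>, which cover the space: on the first the extension is \<open>D\<close>, on
  the second it is zero.\<close>

lemma Diff_c_extend_op: "extend_op U D \<in> Diffc A"
proof (rule Diff_cI[OF openin_topspace _ Diff_cD(3)[OF D]])
  show CA: "C \<subseteq> A" using op_support_subset[of U D] openin_subset[OF U] by blast
  show zero: "extend_op U D V u = \<zero>\<^bsub>sections red V\<^esub>"
    if "openin M V" "V \<subseteq> A - C" "u \<in> carrier (sections \<F> V)" for V u
    by (rule red_ext[OF extend_op_closed[OF that(1,3)] red_zero_closed[OF that(1)]])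
      (use extend_op_vanish[OF that(1,3)] that(2) in \<open>auto simp: red_simps(2)\<close>)
  show "diff_op M \<O> \<F> red A (extend_op U D)"
    unfolding diff_op_def
  proof (intro conjI ballI sheaf_hom_extend_op)
    fix a assume a: "a \<in> A"
    show "\<exists>V r. openin M V \<and> a \<in> V \<and> V \<subseteq> A \<and> order_le M \<O> \<F> red V (extend_op U D) r"
    proof (cases "a \<in> U")
      case True
      then obtain V r where V: "openin M V" "a \<in> V" "V \<subseteq> U" "order_le M \<O> \<F> red V D r"
        using Diff_cD(1)[OF D] unfolding diff_op_def by blast
      have "order_le M \<O> \<F> red V (extend_op U D) r"
        by (rule order_le_cong[OF V(1,4)]) (use extend_op_eq V(3) in blast)
      then show ?thesis using V openin_subset[OF V(1)] by blast
    next
      case False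
      have V: "openin M (A - C)" by (rule openin_diff_compact[OF openin_topspace Diff_cD(3)[OF D]])
      have "order_le M \<O> \<F> red (A - C) (extend_op U D) 0"
        by (rule order_le_zero[OF V]) (rule zero)
      moreover have "a \<in> A - C" using a False op_support_subset[of U D] by blast
      ultimately show ?thesis using V by blast
    qed
  qed
qed

end

end

section \<open>Continuity for the smooth topology\<close>

lemma direct_sum_simps:
  "carrier (direct_sum \<Gamma> V) = {u \<in> Pi\<^sub>E \<Gamma> (\<lambda>\<gamma>. carrier (V \<gamma>)). finite {\<gamma> \<in> \<Gamma>. u \<gamma> \<noteq> \<zero>\<^bsub>V \<gamma>\<^esub>}}"
  "\<zero>\<^bsub>direct_sum \<Gamma> V\<^esub> = (\<lambda>\<gamma>\<in>\<Gamma>. \<zero>\<^bsub>V \<gamma>\<^esub>)"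
  "u \<oplus>\<^bsub>direct_sum \<Gamma> V\<^esub> v = (\<lambda>\<gamma>\<in>\<Gamma>. u \<gamma> \<oplus>\<^bsub>V \<gamma>\<^esub> v \<gamma>)"
  "c \<odot>\<^bsub>direct_sum \<Gamma> V\<^esub> u = (\<lambda>\<gamma>\<in>\<Gamma>. c \<odot>\<^bsub>V \<gamma>\<^esub> u \<gamma>)"
  by (simp_all add: direct_sum_def)

lemma direct_sumD:
  assumes "u \<in> carrier (direct_sum \<Gamma> V)"
  shows "\<gamma> \<in> \<Gamma> \<Longrightarrow> u \<gamma> \<in> carrier (V \<gamma>)" "finite {\<gamma> \<in> \<Gamma>. u \<gamma> \<noteq> \<zero>\<^bsub>V \<gamma>\<^esub>}" "u \<in> extensional \<Gamma>"
  using assms by (auto simp: direct_sum_simps(1) PiE_iff)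

lemma direct_sumI:
  assumes "\<And>\<gamma>. \<gamma> \<in> \<Gamma> \<Longrightarrow> u \<gamma> \<in> carrier (V \<gamma>)" "u \<in> extensional \<Gamma>"
    and "finite S" "\<And>\<gamma>. \<gamma> \<in> \<Gamma> \<Longrightarrow> \<gamma> \<notin> S \<Longrightarrow> u \<gamma> = \<zero>\<^bsub>V \<gamma>\<^esub>"
  shows "u \<in> carrier (direct_sum \<Gamma> V)"
proof -
  have "{\<gamma> \<in> \<Gamma>. u \<gamma> \<noteq> \<zero>\<^bsub>V \<gamma>\<^esub>} \<subseteq> S" using assms(4) by blast
  then show ?thesis
    using assms(1-3) by (auto simp: direct_sum_simps(1) PiE_iff intro: finite_subset)
qed

lemma module_direct_sum:
  assumes V: "\<And>\<gamma>. \<gamma> \<in> \<Gamma> \<Longrightarrow> module complex_ring (V \<gamma>)"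
  shows "module complex_ring (direct_sum \<Gamma> V)"
proof -
  let ?D = "direct_sum \<Gamma> V"
  have ab: "abelian_group (V \<gamma>)" if "\<gamma> \<in> \<Gamma>" for \<gamma>
    using V[OF that] by (rule module.axioms(2))
  have mon: "abelian_monoid (V \<gamma>)" if "\<gamma> \<in> \<Gamma>" for \<gamma>
    using ab[OF that] by (rule abelian_group.axioms(1))
  note c = direct_sumD(1)
  note m = abelian_monoid.l_zero[OF mon] abelian_monoid.a_closed[OF mon] abelian_monoid.zero_closed[OF mon]
  have zero: "\<zero>\<^bsub>?D\<^esub> \<in> carrier ?D"
    by (rule direct_sumI[of _ _ _ "{}"]) (simp_all add: direct_sum_simps(2) m)
  have add: "u \<oplus>\<^bsub>?D\<^esub> v \<in> carrier ?D" if u: "u \<in> carrier ?D" and v: "v \<in> carrier ?D" for u v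
    by (rule direct_sumI[OF _ _ finite_UnI[OF direct_sumD(2)[OF u] direct_sumD(2)[OF v]]])
      (use c[OF u] c[OF v] in \<open>auto simp: direct_sum_simps(3) m\<close>)
  have z: "a \<odot>\<^bsub>V \<gamma>\<^esub> \<zero>\<^bsub>V \<gamma>\<^esub> = \<zero>\<^bsub>V \<gamma>\<^esub>" if "\<gamma> \<in> \<Gamma>" for a \<gamma>
    using module.smult_r_null[OF V[OF that], of a] by simp
  have cl: "a \<odot>\<^bsub>V \<gamma>\<^esub> x \<in> carrier (V \<gamma>)" if "\<gamma> \<in> \<Gamma>" "x \<in> carrier (V \<gamma>)" for a \<gamma> x
    using module.smult_closed[OF V[OF that(1)], of a x] that by simp
  have smult: "a \<odot>\<^bsub>?D\<^esub> u \<in> carrier ?D" if u: "u \<in> carrier ?D" for a u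
    by (rule direct_sumI[OF _ _ direct_sumD(2)[OF u]])
      (use c[OF u] in \<open>auto simp: direct_sum_simps(4) z cl\<close>)
  show ?thesis
  proof (rule moduleI)
    show "abelian_group ?D"
    proof (rule abelian_groupI)
      fix u v w assume u: "u \<in> carrier ?D"
      show "\<zero>\<^bsub>?D\<^esub> \<oplus>\<^bsub>?D\<^esub> u = u"
        by (rule extensionalityI[OF _ direct_sumD(3)[OF u]])
          (use c[OF u] in \<open>simp_all add: direct_sum_simps(2,3) m\<close>)
      have "((-1) \<odot>\<^bsub>V \<gamma>\<^esub> u \<gamma>) \<oplus>\<^bsub>V \<gamma>\<^esub> u \<gamma> = \<zero>\<^bsub>V \<gamma>\<^esub>" if \<gamma>: "\<gamma> \<in> \<Gamma>" for \<gamma>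
      proof -
        interpret V: module complex_ring "V \<gamma>" by (rule V[OF \<gamma>])
        show ?thesis
          using V.smult_l_minus[of 1 "u \<gamma>"] V.smult_one[of "u \<gamma>"] c[OF u \<gamma>] by (simp add: V.M.l_neg)
      qed
      then have "((-1) \<odot>\<^bsub>?D\<^esub> u) \<oplus>\<^bsub>?D\<^esub> u = \<zero>\<^bsub>?D\<^esub>"
        unfolding direct_sum_simps by (intro restrict_ext) simp
      then show "\<exists>y\<in>carrier ?D. y \<oplus>\<^bsub>?D\<^esub> u = \<zero>\<^bsub>?D\<^esub>" using smult[OF u] by blast
      assume v: "v \<in> carrier ?D"
      show "u \<oplus>\<^bsub>?D\<^esub> v = v \<oplus>\<^bsub>?D\<^esub> u"
        unfolding direct_sum_simps(3) using abelian_monoid.a_comm[OF mon c[OF u] c[OF v]]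
        by (intro restrict_ext)
      assume w: "w \<in> carrier ?D"
      show "u \<oplus>\<^bsub>?D\<^esub> v \<oplus>\<^bsub>?D\<^esub> w = u \<oplus>\<^bsub>?D\<^esub> (v \<oplus>\<^bsub>?D\<^esub> w)"
        unfolding direct_sum_simps(3) using abelian_monoid.a_assoc[OF mon c[OF u] c[OF v] c[OF w]]
        by (intro restrict_ext) simp
    qed (use zero add in auto)
    fix a b u v assume u: "u \<in> carrier ?D" and v: "v \<in> carrier ?D"
    show "(a \<oplus>\<^bsub>complex_ring\<^esub> b) \<odot>\<^bsub>?D\<^esub> u = a \<odot>\<^bsub>?D\<^esub> u \<oplus>\<^bsub>?D\<^esub> b \<odot>\<^bsub>?D\<^esub> u"
      unfolding direct_sum_simps(3,4) using module.smult_l_distr[OF V _ _ c[OF u], of _ a b]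
      by (intro restrict_ext) simp
    show "a \<odot>\<^bsub>?D\<^esub> (u \<oplus>\<^bsub>?D\<^esub> v) = a \<odot>\<^bsub>?D\<^esub> u \<oplus>\<^bsub>?D\<^esub> a \<odot>\<^bsub>?D\<^esub> v"
      unfolding direct_sum_simps(3,4) using module.smult_r_distr[OF V _ c[OF u] c[OF v], of _ a]
      by (intro restrict_ext) simp
    show "(a \<otimes>\<^bsub>complex_ring\<^esub> b) \<odot>\<^bsub>?D\<^esub> u = a \<odot>\<^bsub>?D\<^esub> (b \<odot>\<^bsub>?D\<^esub> u)"
      unfolding direct_sum_simps(3,4) using module.smult_assoc1[OF V _ _ c[OF u], of _ a b]
      by (intro restrict_ext) simp
  next
    fix u assume u: "u \<in> carrier ?D"
    show "\<one>\<^bsub>complex_ring\<^esub> \<odot>\<^bsub>?D\<^esub> u = u"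
      by (rule extensionalityI[OF _ direct_sumD(3)[OF u]])
        (use module.smult_one[OF V c[OF u]] in \<open>simp_all add: direct_sum_simps(4)\<close>)
  qed (use smult in \<open>auto intro: cring_from_type_algebra\<close>)
qed

lemma direct_sum_incl_closed:
  assumes V: "\<And>\<gamma>. \<gamma> \<in> \<Gamma> \<Longrightarrow> module complex_ring (V \<gamma>)" and "v \<in> carrier (V \<gamma>)" "\<gamma> \<in> \<Gamma>"
  shows "direct_sum_incl \<Gamma> V \<gamma> v \<in> carrier (direct_sum \<Gamma> V)"
proof -
  have "\<zero>\<^bsub>V \<delta>\<^esub> \<in> carrier (V \<delta>)" if "\<delta> \<in> \<Gamma>" for \<delta>
    using module.axioms(2)[OF V[OF that]] by (simp add: abelian_group_def abelian_monoid.zero_closed)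
  then show ?thesis
    unfolding direct_sum_incl_def using assms(2,3) by (intro direct_sumI[of _ _ _ "{\<gamma>}"]) auto
qed

section \<open>Topologies defined by seminorms\<close>

lemma openin_seminorm_topology:
  assumes "p \<in> P" "u \<in> carrier V" "0 < \<epsilon>"
  shows "openin (seminorm_topology V P) {v \<in> carrier V. p (v \<ominus>\<^bsub>V\<^esub> u) < \<epsilon>}"
  unfolding seminorm_topology_def using assms by (intro topology_generated_by_Basis) blast

lemma topspace_seminorm_topology: "topspace (seminorm_topology V P) = carrier V"
  unfolding seminorm_topology_def topology_generated_by_topspace by auto

text \<open>A generating set is a ball with an arbitrary centre \<open>u\<close>. By the triangle
  inequality it contains, with each point \<open>L v\<close>, the image of the \<open>p\<close>-ball
  around \<open>v\<close> of the remaining radius. Differences stay in \<open>B\<close>, so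
  \<open>p\<close> is evaluated only where it equals \<open>q\<close> after
  \<open>L\<close>.\<close>

lemma continuous_map_seminorm_topology:
  assumes V: "abelian_group V" and W: "abelian_group W"
    and B: "B \<subseteq> carrier V" "\<And>u v. u \<in> B \<Longrightarrow> v \<in> B \<Longrightarrow> u \<ominus>\<^bsub>V\<^esub> v \<in> B"
    and L: "\<And>u. u \<in> B \<Longrightarrow> L u \<in> carrier W"
      "\<And>u v. u \<in> B \<Longrightarrow> v \<in> B \<Longrightarrow> L (u \<ominus>\<^bsub>V\<^esub> v) = L u \<ominus>\<^bsub>W\<^esub> L v"
    and q0: "\<And>q. q \<in> P' \<Longrightarrow> q \<zero>\<^bsub>W\<^esub> = 0"
    and q_add: "\<And>q u v. \<lbrakk>q \<in> P'; u \<in> carrier W; v \<in> carrier W\<rbrakk> \<Longrightarrow> q (u \<oplus>\<^bsub>W\<^esub> v) \<le> q u + q v"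
    and pq: "\<And>q. q \<in> P' \<Longrightarrow> \<exists>p\<in>P. \<forall>u\<in>B. p u = q (L u)"
  shows "continuous_map (subtopology (seminorm_topology V P) B) (seminorm_topology W P') L"
  unfolding seminorm_topology_def[of W]
proof (rule continuous_on_generated_topo)
  interpret V: abelian_group V by fact
  interpret W: abelian_group W by fact
  let ?S = "seminorm_topology V P" and ?T = "subtopology (seminorm_topology V P) B"
  have top: "topspace ?T = B" using B(1) by (auto simp: topspace_seminorm_topology)
  show "L ` topspace ?T \<subseteq> \<Union>(insert (carrier W)
      {{v \<in> carrier W. p (v \<ominus>\<^bsub>W\<^esub> u) < \<epsilon>} |p u \<epsilon>. p \<in> P' \<and> u \<in> carrier W \<and> 0 < \<epsilon>})"
    unfolding top using L(1) by blast
  fix Z assume "Z \<in> insert (carrier W)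
      {{v \<in> carrier W. p (v \<ominus>\<^bsub>W\<^esub> u) < \<epsilon>} |p u \<epsilon>. p \<in> P' \<and> u \<in> carrier W \<and> 0 < \<epsilon>}"
  then consider "Z = carrier W" | q u \<epsilon> where "q \<in> P'" "u \<in> carrier W" "0 < \<epsilon>"
    "Z = {v \<in> carrier W. q (v \<ominus>\<^bsub>W\<^esub> u) < \<epsilon>}" by blast
  then show "openin ?T (L -` Z \<inter> topspace ?T)"
  proof cases
    case 1
    then have "L -` Z \<inter> topspace ?T = topspace ?T" using L(1) top by blast
    then show ?thesis by (simp only: openin_topspace)
  next
    case (2 q u \<epsilon>)
    obtain p where p: "p \<in> P" "\<And>u. u \<in> B \<Longrightarrow> p u = q (L u)" using pq[OF 2(1)] by blast
    show ?thesis
    proof (subst openin_subopen, intro ballI)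
      fix v assume "v \<in> L -` Z \<inter> topspace ?T"
      then have v: "v \<in> B" "q (L v \<ominus>\<^bsub>W\<^esub> u) < \<epsilon>" using top 2(4) by auto
      have vV: "v \<in> carrier V" using v B by blast
      let ?\<delta> = "\<epsilon> - q (L v \<ominus>\<^bsub>W\<^esub> u)"
      let ?N = "{w \<in> carrier V. p (w \<ominus>\<^bsub>V\<^esub> v) < ?\<delta>} \<inter> B"
      have "openin ?S {w \<in> carrier V. p (w \<ominus>\<^bsub>V\<^esub> v) < ?\<delta>}"
        by (rule openin_seminorm_topology[OF p(1) vV]) (use v in simp)
      then have "openin ?T ?N" by (auto simp: openin_subtopology)
      moreover have "v \<in> ?N"
      proof -
        have "p (v \<ominus>\<^bsub>V\<^esub> v) = q (L v \<ominus>\<^bsub>W\<^esub> L v)" using p(2) B(2)[OF v(1) v(1)] L(2)[OF v(1) v(1)] by simp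
        also have "\<dots> = 0" using q0[OF 2(1)] L(1)[OF v(1)] by (simp add: W.minus_eq W.r_neg)
        finally show ?thesis using v vV by simp
      qed
      moreover have "?N \<subseteq> L -` Z \<inter> topspace ?T"
      proof
        fix w assume w: "w \<in> ?N"
        note lw = L(1)[of w] L(1)[OF v(1)]
        have wB: "w \<in> B" using w by blast
        have "q (L w \<ominus>\<^bsub>W\<^esub> u) = q ((L w \<ominus>\<^bsub>W\<^esub> L v) \<oplus>\<^bsub>W\<^esub> (L v \<ominus>\<^bsub>W\<^esub> u))"
          using L(1)[OF wB] L(1)[OF v(1)] 2(2)
          by (simp add: W.minus_eq W.a_assoc W.r_neg1)
        also have "\<dots> \<le> q (L w \<ominus>\<^bsub>W\<^esub> L v) + q (L v \<ominus>\<^bsub>W\<^esub> u)"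
          using L(1)[OF wB] L(1)[OF v(1)] 2(2) by (intro q_add[OF 2(1)]) simp_all
        also have "q (L w \<ominus>\<^bsub>W\<^esub> L v) = p (w \<ominus>\<^bsub>V\<^esub> v)"
          using p(2)[OF B(2)[OF wB v(1)]] L(2)[OF wB v(1)] by simp
        also have "p (w \<ominus>\<^bsub>V\<^esub> v) + q (L v \<ominus>\<^bsub>W\<^esub> u) < \<epsilon>" using w by simp
        finally show "w \<in> L -` Z \<inter> topspace ?T"
          using L(1)[OF wB] wB top 2(4) by simp
      qed
      ultimately show "\<exists>T. openin ?T T \<and> v \<in> T \<and> T \<subseteq> L -` Z \<inter> topspace ?T" by blast
    qed
  qed
qed

section \<open>Continuity of multiplication, restriction and extension by zero\<close>

context formal_module_sheaf
begin

abbreviation "smooth U \<equiv> smooth_topology M \<O> \<F> U"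
abbreviation "FK U K \<equiv> subtopology (smooth U) (supp_in U K)"
abbreviation "FcV U \<equiv> Fc M \<O> \<F> U"
abbreviation "FcT U \<equiv> Fc_topology M \<O> \<F> U"

context
  fixes U D assumes U: "openin M U" and D: "D \<in> Diffc U"
begin

private lemma sheaf_hom_D: "sheaf_hom M \<O> \<F> red U D" by (rule Diff_cD(2)[OF D])

text \<open>A real \<open>Sup\<close> is an upper bound only for a bounded set. Here
  \<open>D U u\<close> is zero off the compact support of \<open>D\<close>, so its values are
  bounded.\<close>

lemma bdd_above_diff_seminorm:
  assumes "u \<in> carrier (sections \<F> U)"
  shows "bdd_above (insert 0 ((\<lambda>a. cmod (reduced_value M \<O> (D U u) a)) ` U))"
proof -
  obtain B where "\<And>a. a \<in> U \<Longrightarrow> cmod (reduced_value M \<O> (D U u) a) \<le> B"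
    by (rule reduced_value_bounded[OF U sheaf_hom_closed[OF sheaf_hom_D U order.refl assms] Diff_cD(3)[OF D] op_support_subset
          Diff_c_vanish[OF U sheaf_hom_D U order.refl assms]]) (assumption, rule that)
  then show ?thesis by (intro bdd_aboveI[of _ "max 0 B"]) force
qed

lemma diff_seminorm_zero: "dsn U D \<zero>\<^bsub>sections \<F> U\<^esub> = 0"
proof -
  have "reduced_value M \<O> (D U \<zero>\<^bsub>sections \<F> U\<^esub>) a = 0" if "a \<in> U" for a
  proof -
    have "a \<in> A" using that openin_subset[OF U] by blast
    then show ?thesis
      using reduced_value_zero[of a] quotient_zero that sheaf_hom_zero[OF sheaf_hom_D U order.refl] by (simp add: red_simps(2))
  qed
  then have "insert 0 ((\<lambda>a. cmod (reduced_value M \<O> (D U \<zero>\<^bsub>sections \<F> U\<^esub>) a)) ` U) = {0}" by auto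
  then show ?thesis unfolding diff_seminorm_def by (simp only: cSup_singleton)
qed

lemma diff_seminorm_add:
  assumes u: "u \<in> carrier (sections \<F> U)" and v: "v \<in> carrier (sections \<F> U)"
  shows "dsn U D (u \<oplus>\<^bsub>sections \<F> U\<^esub> v) \<le> dsn U D u + dsn U D v"
  unfolding diff_seminorm_def[of _ _ _ _ "u \<oplus>\<^bsub>sections \<F> U\<^esub> v"]
proof (rule cSup_least)
  fix x assume x: "x \<in> insert 0 ((\<lambda>a. cmod (reduced_value M \<O> (D U (u \<oplus>\<^bsub>sections \<F> U\<^esub> v)) a)) ` U)"
  have ge: "cmod (reduced_value M \<O> (D U w) a) \<le> dsn U D w" "0 \<le> dsn U D w"
    if "w \<in> carrier (sections \<F> U)" "a \<in> U" for w a
    unfolding diff_seminorm_def using that(2) by (auto intro!: cSup_upper bdd_above_diff_seminorm[OF that(1)])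
  have ge0: "0 \<le> dsn U D w" if "w \<in> carrier (sections \<F> U)" for w
    unfolding diff_seminorm_def by (auto intro!: cSup_upper bdd_above_diff_seminorm[OF that])
  show "x \<le> dsn U D u + dsn U D v"
  proof (cases "x = 0")
    case True
    then show ?thesis using ge0[OF u] ge0[OF v] by simp
  next
    case False
    then obtain a where a: "a \<in> U" and x: "x = cmod (reduced_value M \<O> (D U (u \<oplus>\<^bsub>sections \<F> U\<^esub> v)) a)"
      using x by blast
    have aA: "a \<in> A" using a openin_subset[OF U] by blast
    note cl = sheaf_hom_closed[OF sheaf_hom_D U order.refl]
    have "reduced_value M \<O> (D U (u \<oplus>\<^bsub>sections \<F> U\<^esub> v)) a
        = reduced_value M \<O> (D U u) a + reduced_value M \<O> (D U v) a"
    proof (rule reduced_value_add[OF aA])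
      show "D U u a \<in> carrier (Q a)" "D U v a \<in> carrier (Q a)"
        using red_in_quotient[OF U cl a] u v by blast+
      show "D U (u \<oplus>\<^bsub>sections \<F> U\<^esub> v) a = D U u a \<oplus>\<^bsub>Q a\<^esub> D U v a"
        using a sheaf_hom_add[OF sheaf_hom_D U order.refl u v] by (simp add: red_simps(3))
    qed
    then show ?thesis
      unfolding x using ge(1)[OF u a] ge(1)[OF v a] norm_triangle_ineq[of "reduced_value M \<O> (D U u) a"]
      by (smt (verit))
  qed
qed simp

end

text \<open>Points of \<open>V - U\<close> contribute only the value zero, which
  \<open>diff_seminorm\<close> inserts anyway. This compares seminorms over different open sets, for
  different operators and sections.\<close>

lemma diff_seminorm_extend:
  assumes "U \<subseteq> V" "V \<subseteq> A" and eq: "\<And>a. a \<in> U \<Longrightarrow> D V u a = D' U v a"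
    and 0: "\<And>a. a \<in> V - U \<Longrightarrow> D V u a = \<zero>\<^bsub>Q a\<^esub>"
  shows "dsn V D u = dsn U D' v"
proof -
  have e: "reduced_value M \<O> (D V u) a = reduced_value M \<O> (D' U v) a" if "a \<in> U" for a
    unfolding reduced_value_def eq[OF that] ..
  have z: "reduced_value M \<O> (D V u) a = 0" if "a \<in> V - U" for a
    using reduced_value_zero[of a "D V u"] 0[OF that] quotient_zero[of a] that assms(2) by auto
  have "(\<lambda>a. cmod (reduced_value M \<O> (D V u) a)) ` V \<union> {0}
      = (\<lambda>a. cmod (reduced_value M \<O> (D' U v) a)) ` U \<union> {0}" (is "?l = ?r")
  proof (intro equalityI subsetI)
    fix x assume "x \<in> ?l"
    then consider "x = 0" | a where "a \<in> V" "x = cmod (reduced_value M \<O> (D V u) a)" by blast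
    then show "x \<in> ?r"
    proof cases
      case (2 a)
      then show ?thesis using e[of a] z[of a] by (cases "a \<in> U") auto
    qed simp
  next
    fix x assume "x \<in> ?r"
    then consider "x = 0" | a where "a \<in> U" "x = cmod (reduced_value M \<O> (D' U v) a)" by blast
    then show "x \<in> ?l"
    proof cases
      case (2 a)
      then have "x = cmod (reduced_value M \<O> (D V u) a)" "a \<in> V" using e assms(1) by auto
      then show ?thesis by blast
    qed simp
  qed
  then show ?thesis unfolding diff_seminorm_def by (simp only: Un_insert_right sup_bot_right)
qed

lemma topspace_smooth: "topspace (smooth U) = carrier (sections \<F> U)"
  unfolding smooth_topology_def topspace_seminorm_topology by simp

lemma topspace_FK: "topspace (FK U K) = supp_in U K"
  using supp_in_carrier by (auto simp: topspace_smooth)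

lemma continuous_map_smooth:
  assumes U: "openin M U" and V: "openin M V"
    and B: "B \<subseteq> carrier (sections \<F> U)"
      "\<And>u v. u \<in> B \<Longrightarrow> v \<in> B \<Longrightarrow> u \<ominus>\<^bsub>sections \<F> U\<^esub> v \<in> B"
    and L: "\<And>u. u \<in> B \<Longrightarrow> L u \<in> carrier (sections \<F> V)"
      "\<And>u v. u \<in> B \<Longrightarrow> v \<in> B \<Longrightarrow> L (u \<ominus>\<^bsub>sections \<F> U\<^esub> v) = L u \<ominus>\<^bsub>sections \<F> V\<^esub> L v"
    and D: "\<And>D. D \<in> Diffc V \<Longrightarrow> \<exists>D'\<in>Diffc U. \<forall>u\<in>B. dsn U D' u = dsn V D (L u)"
  shows "continuous_map (subtopology (smooth U) B) (smooth V) L"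
  unfolding smooth_topology_def
  by (rule continuous_map_seminorm_topology[OF module.axioms(2)[OF module_vs[OF U]] module.axioms(2)[OF module_vs[OF V]]])
    (use B L D diff_seminorm_zero[OF V] diff_seminorm_add[OF V] in auto)

text \<open>Evaluating the seminorm of \<open>D\<close> after multiplication by \<open>f\<close>
  gives the seminorm of \<open>D\<close> composed with \<open>f\<close>, which is again a compactly
  supported operator.\<close>

lemma continuous_map_act:
  assumes f: "f \<in> carrier (sections \<O> A)" and K: "compactin M K"
  shows "continuous_map (FK A K) (FK A K) (act A f A)"
proof -
  note a = linear_act[OF openin_topspace openin_topspace order.refl f]
  have "continuous_map (FK A K) (smooth A) (act A f A)"
  proof (rule continuous_map_smooth[OF openin_topspace openin_topspace _ minus_supp_in[OF openin_topspace K]])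
    show "supp_in A K \<subseteq> carrier (sections \<F> A)" using supp_in_carrier by blast
    show "act A f A (u \<ominus>\<^bsub>sections \<F> A\<^esub> v) = act A f A u \<ominus>\<^bsub>sections \<F> A\<^esub> act A f A v"
      if "u \<in> supp_in A K" "v \<in> supp_in A K" for u v
      using linear_between_minus[OF module_vs module_vs a] that supp_in_carrier by simp
    show "act A f A u \<in> carrier (sections \<F> A)" if "u \<in> supp_in A K" for u
      using act_closed[OF openin_topspace openin_topspace order.refl f] supp_in_carrier that by blast
    fix D assume "D \<in> Diffc A"
    then have "precompose A f D \<in> Diffc A"
      by (rule Diff_c_precompose[OF openin_topspace order.refl openin_topspace f])
    moreover have "dsn A (precompose A f D) u = dsn A D (act A f A u)" for u
      unfolding diff_seminorm_def precompose_def ..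
    ultimately show "\<exists>D'\<in>Diffc A. \<forall>u\<in>supp_in A K. dsn A D' u = dsn A D (act A f A u)" by blast
  qed
  then show ?thesis
    using act_supp_in[OF openin_topspace K openin_topspace order.refl f]
    by (auto simp: continuous_map_in_subtopology topspace_FK)
qed

text \<open>One half of the identification of \<open>supp_in A K\<close> with
  \<open>supp_in U K\<close>; the other half is \<open>restr_ext_zero\<close>.\<close>

lemma restr_supp_in:
  assumes U: "openin M U" and K: "compactin M K" "K \<subseteq> U" and u: "u \<in> supp_in A K"
  shows "restr \<F> A U u \<in> supp_in U K" "ext0 U (restr \<F> A U u) = u"
proof -
  note UA = openin_subset[OF U]
  have AK: "openin M (A - K)" and UK: "openin M (U - K)"
    using openin_diff_compact K U by auto
  have uA: "u \<in> carrier (sections \<F> A)" and u0: "restr \<F> A (A - K) u = \<zero>\<^bsub>sections \<F> (A - K)\<^esub>"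
    using u mem_supp_in[OF openin_topspace K(1)] by auto
  have "restr \<F> U (U - K) (restr \<F> A U u) = restr \<F> A (U - K) u"
    by (rule F.restr_restr[OF openin_topspace U UK Diff_subset UA uA])
  also have "\<dots> = restr \<F> (A - K) (U - K) (restr \<F> A (A - K) u)"
    by (rule F.restr_restr[symmetric, OF openin_topspace AK UK Diff_mono[OF UA order.refl] Diff_subset uA])
  also have "\<dots> = \<zero>\<^bsub>sections \<F> (U - K)\<^esub>"
    unfolding u0 by (rule restr_zero_F[OF AK UK Diff_mono[OF UA order.refl]])
  finally show r: "restr \<F> A U u \<in> supp_in U K"
    using mem_supp_in[OF U K(1)] F.restr_closed[OF openin_topspace U UA uA] by simp
  show "ext0 U (restr \<F> A U u) = u"
    by (rule ext_zero_unique[OF U K r uA refl u0])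
qed

text \<open>The seminorm of the restriction for \<open>D\<close> is the seminorm of the section
  itself for the extension of \<open>D\<close> by zero, since padding adds only zero values.\<close>

lemma continuous_map_restr:
  assumes U: "openin M U" and K: "compactin M K" "K \<subseteq> U"
  shows "continuous_map (FK A K) (FK U K) (restr \<F> A U)"
proof -
  note UA = openin_subset[OF U]
  have "continuous_map (FK A K) (smooth U) (restr \<F> A U)"
  proof (rule continuous_map_smooth[OF openin_topspace U _ minus_supp_in[OF openin_topspace K(1)]])
    show "supp_in A K \<subseteq> carrier (sections \<F> A)" using supp_in_carrier by blast
    show "restr \<F> A U (u \<ominus>\<^bsub>sections \<F> A\<^esub> v) = restr \<F> A U u \<ominus>\<^bsub>sections \<F> U\<^esub> restr \<F> A U v"
      if "u \<in> supp_in A K" "v \<in> supp_in A K" for u v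
      using restr_minus_F[OF openin_topspace U UA] that supp_in_carrier by blast
    show "restr \<F> A U u \<in> carrier (sections \<F> U)" if "u \<in> supp_in A K" for u
      using F.restr_closed[OF openin_topspace U UA] supp_in_carrier that by blast
    fix D assume D: "D \<in> Diffc U"
    have AU: "A \<inter> U = U" using UA by blast
    have "dsn A (extend_op U D) u = dsn U D (restr \<F> A U u)" for u
      by (rule diff_seminorm_extend[OF UA order.refl]) (use UA in \<open>auto simp: extend_op_def AU\<close>)
    then show "\<exists>D'\<in>Diffc A. \<forall>u\<in>supp_in A K. dsn A D' u = dsn U D (restr \<F> A U u)"
      using Diff_c_extend_op[OF U D] by blast
  qed
  then show ?thesis
    using restr_supp_in(1)[OF U K] by (auto simp: continuous_map_in_subtopology topspace_FK)
qed

text \<open>The finite cover argument for the cover of \<open>K\<close> by the single set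
  \<open>U\<close>, where \<open>G\<close> is the ideal of sections with compact support in
  \<open>U\<close>.\<close>

lemma cutoff:
  assumes U: "openin M U" and K: "compactin M K" "K \<subseteq> U"
  obtains g C W where "g \<in> carrier (sections \<O> A)" "compactin M C" "C \<subseteq> U"
    and "restr \<O> A (A - C) g = \<zero>\<^bsub>sections \<O> (A - C)\<^esub>"
    and "openin M W" "K \<subseteq> W" "restr \<O> A W g = \<one>\<^bsub>sections \<O> W\<^esub>"
proof -
  define G where "G = {g \<in> carrier (sections \<O> A). \<exists>C. compactin M C \<and> C \<subseteq> U \<and>
    restr \<O> A (A - C) g = \<zero>\<^bsub>sections \<O> (A - C)\<^esub>}"
  interpret A: cring "sections \<O> A" by (rule cring_sections) simp
  have AC: "openin M (A - C)" if "compactin M C" for C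
    using openin_diff_compact[OF openin_topspace that] .
  have shrink: "restr \<O> A (A - C') g = \<zero>\<^bsub>sections \<O> (A - C')\<^esub>"
    if g: "g \<in> carrier (sections \<O> A)" "restr \<O> A (A - C) g = \<zero>\<^bsub>sections \<O> (A - C)\<^esub>"
      and C: "compactin M C" "compactin M C'" "C \<subseteq> C'" for g C C'
  proof -
    have sub: "A - C' \<subseteq> A - C" using C(3) by blast
    have "restr \<O> A (A - C') g = restr \<O> (A - C) (A - C') (restr \<O> A (A - C) g)"
      by (rule restr_restr[symmetric, OF openin_topspace AC[OF C(1)] AC[OF C(2)] sub Diff_subset g(1)])
    also have "\<dots> = \<zero>\<^bsub>sections \<O> (A - C')\<^esub>"
      unfolding g(2) by (rule restr_zero[OF AC[OF C(1)] AC[OF C(2)] sub])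
    finally show ?thesis .
  qed
  obtain g W where "g \<in> G" "openin M W" "K \<subseteq> W" "restr \<O> A W g = \<one>\<^bsub>sections \<O> W\<^esub>"
  proof (rule finite_cover_bump[of "{()}" "\<lambda>_. U" K G])
    fix f g assume "f \<in> G" "g \<in> G"
    then obtain C C' where f: "f \<in> carrier (sections \<O> A)" "compactin M C" "C \<subseteq> U"
        "restr \<O> A (A - C) f = \<zero>\<^bsub>sections \<O> (A - C)\<^esub>"
      and g: "g \<in> carrier (sections \<O> A)" "compactin M C'" "C' \<subseteq> U"
        "restr \<O> A (A - C') g = \<zero>\<^bsub>sections \<O> (A - C')\<^esub>"
      unfolding G_def by blast
    let ?C = "C \<union> C'"
    have C: "compactin M ?C" using f g by (intro compactin_Un)
    interpret AC: cring "sections \<O> (A - ?C)" by (rule cring_sections[OF AC[OF C]])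
    have "restr \<O> A (A - ?C) (f \<oplus>\<^bsub>sections \<O> A\<^esub> g) = \<zero>\<^bsub>sections \<O> (A - ?C)\<^esub>"
      unfolding restr_add[OF openin_topspace AC[OF C] Diff_subset f(1) g(1)]
        shrink[OF f(1,4,2) C Un_upper1] shrink[OF g(1,4,2) C Un_upper2] by simp
    then show "f \<oplus>\<^bsub>sections \<O> A\<^esub> g \<in> G" unfolding G_def using f g C by blast
  next
    fix f g assume f: "f \<in> carrier (sections \<O> A)" and "g \<in> G"
    then obtain C where g: "g \<in> carrier (sections \<O> A)" and C: "compactin M C" "C \<subseteq> U"
        and g0: "restr \<O> A (A - C) g = \<zero>\<^bsub>sections \<O> (A - C)\<^esub>"
      unfolding G_def by blast
    interpret AC: cring "sections \<O> (A - C)" by (rule cring_sections[OF AC[OF C(1)]])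
    have "restr \<O> A (A - C) (f \<otimes>\<^bsub>sections \<O> A\<^esub> g) = \<zero>\<^bsub>sections \<O> (A - C)\<^esub>"
      unfolding restr_mult[OF openin_topspace AC[OF C(1)] Diff_subset f g] g0
      using restr_closed[OF openin_topspace AC[OF C(1)] Diff_subset f] by simp
    then show "f \<otimes>\<^bsub>sections \<O> A\<^esub> g \<in> G" unfolding G_def using f g C by blast
  next
    have "restr \<O> A (A - {}) \<zero>\<^bsub>sections \<O> A\<^esub> = \<zero>\<^bsub>sections \<O> (A - {})\<^esub>"
      by (rule restr_zero) auto
    then show "\<zero>\<^bsub>sections \<O> A\<^esub> \<in> G"
      unfolding G_def using A.zero_closed compactin_empty by blast
  qed (use U K in \<open>auto simp: G_def\<close>)
  then show ?thesis unfolding G_def using that by blast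
qed

lemma continuous_map_ext_zero:
  assumes U: "openin M U" and K: "compactin M K" "K \<subseteq> U"
  shows "continuous_map (FK U K) (FK A K) (ext0 U)"
proof -
  note UA = openin_subset[OF U]
  obtain g C W where g: "g \<in> carrier (sections \<O> A)" and C: "compactin M C" "C \<subseteq> U"
    and g0: "restr \<O> A (A - C) g = \<zero>\<^bsub>sections \<O> (A - C)\<^esub>"
    and W: "openin M W" "K \<subseteq> W" "restr \<O> A W g = \<one>\<^bsub>sections \<O> W\<^esub>"
    using cutoff[OF U K] .
  note WA = openin_subset[OF W(1)]
  have AK: "openin M (A - K)" using openin_diff_compact[OF openin_topspace K(1)] .
  note e = ext_zero[OF U K]
  have Fc: "u \<in> carrier (FcV U)" if "u \<in> supp_in U K" for u
    unfolding mem_Fc using that K by blast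
  have "continuous_map (FK U K) (smooth A) (ext0 U)"
  proof (rule continuous_map_smooth[OF U openin_topspace _ minus_supp_in[OF U K(1)]])
    show "supp_in U K \<subseteq> carrier (sections \<F> U)" using supp_in_carrier by blast
    show "ext0 U u \<in> carrier (sections \<F> A)" if "u \<in> supp_in U K" for u by (rule e(1)[OF that])
    show "ext0 U (u \<ominus>\<^bsub>sections \<F> U\<^esub> v) = ext0 U u \<ominus>\<^bsub>sections \<F> A\<^esub> ext0 U v"
      if u: "u \<in> supp_in U K" and v: "v \<in> supp_in U K" for u v
    proof (rule ext_zero_unique[OF U K minus_supp_in[OF U K(1) u v]])
      have "ext0 U u \<ominus>\<^bsub>sections \<F> A\<^esub> ext0 U v \<in> supp_in A K"
        by (rule minus_supp_in[OF openin_topspace K(1) e(4)[OF u] e(4)[OF v]])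
      then show "ext0 U u \<ominus>\<^bsub>sections \<F> A\<^esub> ext0 U v \<in> carrier (sections \<F> A)"
        "restr \<F> A (A - K) (ext0 U u \<ominus>\<^bsub>sections \<F> A\<^esub> ext0 U v) = \<zero>\<^bsub>sections \<F> (A - K)\<^esub>"
        unfolding mem_supp_in[OF openin_topspace K(1)] by auto
      show "restr \<F> A U (ext0 U u \<ominus>\<^bsub>sections \<F> A\<^esub> ext0 U v) = u \<ominus>\<^bsub>sections \<F> U\<^esub> v"
        using restr_minus_F[OF openin_topspace U UA e(1)[OF u] e(1)[OF v]] e(2)[OF u] e(2)[OF v] by simp
    qed
    fix D assume D: "D \<in> Diffc A"
    have hom: "sheaf_hom M \<O> \<F> red A D" by (rule Diff_cD(2)[OF D])
    \<comment> \<open>On \<open>U\<close> multiplication by \<open>g\<close> fixes \<open>u\<close>,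
      so both operators give the same function there; off \<open>U\<close> the function vanishes
      because the extension is zero off \<open>K\<close>.\<close>
    have "dsn A D (ext0 U u) = dsn U (precompose A g D) u" if u: "u \<in> supp_in U K" for u
    proof (rule diff_seminorm_extend[OF UA order.refl])
      have "precompose A g D U u = D U (restr \<F> A U (ext0 U u))"
        unfolding precompose_def
          act_eq_self[OF U openin_topspace UA K(1) u g W(1,2) WA W(3)] e(2)[OF u] ..
      also have "\<dots> = restrict (D A (ext0 U u)) U"
        by (rule sheaf_hom_restr[OF hom openin_topspace order.refl U UA e(1)[OF u]])
      finally show "D A (ext0 U u) a = precompose A g D U u a" if "a \<in> U" for a
        using that by simp
      have "restrict (D A (ext0 U u)) (A - K) = D (A - K) (restr \<F> A (A - K) (ext0 U u))"
        by (rule sheaf_hom_restr[symmetric, OF hom openin_topspace order.refl AK Diff_subset e(1)[OF u]])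
      also have "\<dots> = \<zero>\<^bsub>sections red (A - K)\<^esub>"
        unfolding e(3)[OF u] by (rule sheaf_hom_zero[OF hom AK Diff_subset])
      finally have eq: "restrict (D A (ext0 U u)) (A - K) = \<zero>\<^bsub>sections red (A - K)\<^esub>" .
      show "D A (ext0 U u) a = \<zero>\<^bsub>Q a\<^esub>" if "a \<in> A - U" for a
      proof -
        have "a \<in> A - K" using that K(2) by blast
        then show ?thesis using fun_cong[OF eq, of a] by (simp add: red_simps(2))
      qed
    qed
    then show "\<exists>D'\<in>Diffc U. \<forall>u\<in>supp_in U K. dsn U D' u = dsn A D (ext0 U u)"
      using Diff_c_precompose_cutoff[OF U D g C g0] by (intro bexI[of _ "precompose A g D"]) auto
  qed
  then show ?thesis
    using e(4) by (auto simp: continuous_map_in_subtopology topspace_FK)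
qed

lemma Fc_topology_maps:
  assumes "(S, j) \<in> {(FK U K, \<lambda>u. u) | K. compactin M K \<and> K \<subseteq> U}"
  shows "j ` topspace S \<subseteq> carrier (FcV U)"
  using assms by (auto simp: topspace_FK mem_Fc)

lemma lc_Fc_topology: "openin M U \<Longrightarrow> lc_topology (FcV U) (FcT U)"
  unfolding Fc_topology_def by (rule lc_final[OF module_Fc Fc_topology_maps])

lemma continuous_map_FK_Fc:
  assumes "openin M U" "compactin M K" "K \<subseteq> U"
  shows "continuous_map (FK U K) (FcT U) (\<lambda>u. u)"
  unfolding Fc_topology_def
  by (rule continuous_map_into_final_lc[OF module_Fc[OF assms(1)] Fc_topology_maps]) (use assms in auto)

text \<open>By the universal property it is enough to test on each \<open>FK U K\<close>, where the
  map factors through \<open>FK A K\<close> with the same \<open>K\<close>.\<close>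

lemma continuous_map_Fc_ext_zero:
  assumes U: "openin M U"
  shows "continuous_map (FcT U) (FcT A) (ext0 U)"
  unfolding Fc_topology_def[of _ _ _ U]
proof (rule continuous_map_from_final_lc[OF module_Fc[OF U] module_Fc[OF openin_topspace] linear_ext_zero[OF U]
      lc_Fc_topology[OF openin_topspace] Fc_topology_maps])
  fix S and j :: "'f \<Rightarrow> 'f" assume "(S, j) \<in> {(FK U K, \<lambda>u. u) | K. compactin M K \<and> K \<subseteq> U}"
  then obtain K where K: "compactin M K" "K \<subseteq> U" and S: "S = FK U K" "j = (\<lambda>u. u)" by blast
  have KA: "K \<subseteq> A" using K(2) openin_subset[OF U] by blast
  show "continuous_map S (FcT A) (ext0 U \<circ> j)"
    unfolding S using continuous_map_compose[OF continuous_map_ext_zero[OF U K] continuous_map_FK_Fc[OF openin_topspace K(1) KA]]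
    by (simp add: comp_def)
qed

end

section \<open>The sum of the extensions by zero\<close>

context formal_module_sheaf
begin

context
  fixes \<Gamma> :: "'i set" and U :: "'i \<Rightarrow> 'a set"
  assumes U: "\<And>\<gamma>. \<gamma> \<in> \<Gamma> \<Longrightarrow> openin M (U \<gamma>)" and cover: "(\<Union>\<gamma>\<in>\<Gamma>. U \<gamma>) = A"
begin

private abbreviation "DS \<equiv> direct_sum \<Gamma> (\<lambda>\<gamma>. FcV (U \<gamma>))"
private abbreviation "DT \<equiv> direct_sum_topology \<Gamma> (\<lambda>\<gamma>. FcV (U \<gamma>)) (\<lambda>\<gamma>. FcT (U \<gamma>))"
private abbreviation "incl \<equiv> direct_sum_incl \<Gamma> (\<lambda>\<gamma>. FcV (U \<gamma>))"
private abbreviation "L \<equiv> ext_sum M \<F> \<Gamma> U"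

interpretation FA: module "sections \<O> A" "sections \<F> A" by (rule F.module_sections) simp
interpretation FcA: module complex_ring "FcV A" by (rule module_Fc) simp

lemma module_DS: "module complex_ring DS"
  by (rule module_direct_sum) (rule module_Fc[OF U])

lemma Fc_A_in_sections: "u \<in> carrier (FcV A) \<Longrightarrow> u \<in> carrier (sections \<F> A)"
  using Fc_carrier_subset by blast

lemma ext_zero_Fc: "\<gamma> \<in> \<Gamma> \<Longrightarrow> x \<in> carrier (FcV (U \<gamma>)) \<Longrightarrow> ext0 (U \<gamma>) x \<in> carrier (FcV A)"
  using linear_between_closed[OF linear_ext_zero[OF U]] .

lemma ext_zero_of_zero: "\<gamma> \<in> \<Gamma> \<Longrightarrow> ext0 (U \<gamma>) \<zero>\<^bsub>sections \<F> (U \<gamma>)\<^esub> = \<zero>\<^bsub>sections \<F> A\<^esub>"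
  using linear_between_zero[OF module_Fc[OF U] module_Fc[OF openin_topspace] linear_ext_zero[OF U]] by simp

text \<open>\<open>ext_sum\<close> sums over the exact support of the family, which changes under
  the vector space operations. A larger finite index set gives the same sum, since the extension of
  zero is zero.\<close>

lemma ext_sum_eq:
  assumes u: "u \<in> carrier DS" and S: "finite S" "S \<subseteq> \<Gamma>" "{\<gamma> \<in> \<Gamma>. u \<gamma> \<noteq> \<zero>\<^bsub>sections \<F> (U \<gamma>)\<^esub>} \<subseteq> S"
  shows "L u = finsum (sections \<F> A) (\<lambda>\<gamma>. ext0 (U \<gamma>) (u \<gamma>)) S"
  unfolding ext_sum_def
proof (rule FA.M.add.finprod_mono_neutral_cong_left[OF S(1,3)])
  fix \<gamma> assume "\<gamma> \<in> S - {\<gamma> \<in> \<Gamma>. u \<gamma> \<noteq> \<zero>\<^bsub>sections \<F> (U \<gamma>)\<^esub>}"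
  then show "ext0 (U \<gamma>) (u \<gamma>) = \<zero>\<^bsub>sections \<F> A\<^esub>"
    using S(2) ext_zero_of_zero by auto
next
  show "(\<lambda>\<gamma>. ext0 (U \<gamma>) (u \<gamma>)) \<in> S \<rightarrow> carrier (sections \<F> A)"
    using S(2) ext_zero_Fc direct_sumD(1)[OF u] Fc_A_in_sections by blast
qed simp

text \<open>\<open>ext_sum\<close> is formed in the group of all sections, so the sum has to be
  shown to be compactly supported and compatible with scalars.\<close>

lemma finsum_Fc:
  assumes "finite S" "\<And>\<gamma>. \<gamma> \<in> S \<Longrightarrow> w \<gamma> \<in> carrier (FcV A)"
  shows "finsum (sections \<F> A) w S \<in> carrier (FcV A)"
    and "c \<odot>\<^bsub>FcV A\<^esub> finsum (sections \<F> A) w S = finsum (sections \<F> A) (\<lambda>\<gamma>. c \<odot>\<^bsub>FcV A\<^esub> w \<gamma>) S"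
proof -
  have "finsum (sections \<F> A) w S \<in> carrier (FcV A) \<and>
    c \<odot>\<^bsub>FcV A\<^esub> finsum (sections \<F> A) w S = finsum (sections \<F> A) (\<lambda>\<gamma>. c \<odot>\<^bsub>FcV A\<^esub> w \<gamma>) S"
    using assms
  proof (induction S rule: finite_induct)
    case empty
    then show ?case using FcA.M.zero_closed FcA.smult_r_null[of c] by simp
  next
    case (insert x S)
    have x: "w x \<in> carrier (FcV A)" and S: "\<And>\<gamma>. \<gamma> \<in> S \<Longrightarrow> w \<gamma> \<in> carrier (FcV A)"
      using insert.prems by auto
    have sm: "c \<odot>\<^bsub>FcV A\<^esub> w \<gamma> \<in> carrier (FcV A)" if "\<gamma> \<in> insert x S" for \<gamma>
      using FcA.smult_closed[of c "w \<gamma>"] insert.prems that by simp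
    have 1: "finsum (sections \<F> A) w (insert x S) = w x \<oplus>\<^bsub>sections \<F> A\<^esub> finsum (sections \<F> A) w S"
      by (rule FA.M.finsum_insert[OF insert.hyps]) (use x S Fc_A_in_sections in auto)
    have 2: "finsum (sections \<F> A) (\<lambda>\<gamma>. c \<odot>\<^bsub>FcV A\<^esub> w \<gamma>) (insert x S)
        = c \<odot>\<^bsub>FcV A\<^esub> w x \<oplus>\<^bsub>sections \<F> A\<^esub> finsum (sections \<F> A) (\<lambda>\<gamma>. c \<odot>\<^bsub>FcV A\<^esub> w \<gamma>) S"
    proof (rule FA.M.finsum_insert[OF insert.hyps])
      show "(\<lambda>\<gamma>. c \<odot>\<^bsub>FcV A\<^esub> w \<gamma>) \<in> S \<rightarrow> carrier (sections \<F> A)"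
        "c \<odot>\<^bsub>FcV A\<^esub> w x \<in> carrier (sections \<F> A)"
        using sm Fc_A_in_sections by blast+
    qed
    have IH: "finsum (sections \<F> A) w S \<in> carrier (FcV A)"
      "c \<odot>\<^bsub>FcV A\<^esub> finsum (sections \<F> A) w S = finsum (sections \<F> A) (\<lambda>\<gamma>. c \<odot>\<^bsub>FcV A\<^esub> w \<gamma>) S"
      using insert.IH[OF S] by auto
    show ?case
      unfolding 1 2 IH(2)[symmetric]
      using FcA.M.a_closed[OF x IH(1)] FcA.smult_r_distr[of c, OF _ x IH(1)] by (simp del: Fc_simps(3))
  qed
  then show "finsum (sections \<F> A) w S \<in> carrier (FcV A)"
    "c \<odot>\<^bsub>FcV A\<^esub> finsum (sections \<F> A) w S = finsum (sections \<F> A) (\<lambda>\<gamma>. c \<odot>\<^bsub>FcV A\<^esub> w \<gamma>) S"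
    by auto
qed

lemma linear_ext_sum: "linear_between DS (FcV A) L"
  unfolding linear_between_def
proof (intro conjI funcsetI ballI allI)
  fix u assume u: "u \<in> carrier DS"
  let ?S = "{\<gamma> \<in> \<Gamma>. u \<gamma> \<noteq> \<zero>\<^bsub>sections \<F> (U \<gamma>)\<^esub>}"
  have fin: "finite ?S" and sub: "?S \<subseteq> \<Gamma>" using direct_sumD(2)[OF u] by auto
  note Lu = ext_sum_eq[OF u fin sub order.refl]
  have e: "ext0 (U \<gamma>) (u \<gamma>) \<in> carrier (FcV A)" if "\<gamma> \<in> \<Gamma>" for \<gamma>
    using ext_zero_Fc[OF that direct_sumD(1)[OF u that]] .
  show "L u \<in> carrier (FcV A)"
    unfolding Lu by (rule finsum_Fc(1)[OF fin]) (use e in blast)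
  { fix v assume v: "v \<in> carrier DS"
    \<comment> \<open>One index set that contains both supports, and hence that of the sum.\<close>
    let ?T = "?S \<union> {\<gamma> \<in> \<Gamma>. v \<gamma> \<noteq> \<zero>\<^bsub>sections \<F> (U \<gamma>)\<^esub>}"
    have T: "finite ?T" "?T \<subseteq> \<Gamma>" using fin direct_sumD(2)[OF v] by auto
    have uv: "u \<oplus>\<^bsub>DS\<^esub> v \<in> carrier DS"
      using abelian_monoid.a_closed[OF abelian_group.axioms(1)[OF module.axioms(2)[OF module_DS]] u v] .
    have "{\<gamma> \<in> \<Gamma>. (u \<oplus>\<^bsub>DS\<^esub> v) \<gamma> \<noteq> \<zero>\<^bsub>sections \<F> (U \<gamma>)\<^esub>} \<subseteq> ?T"
    proof
      fix \<gamma> assume \<gamma>: "\<gamma> \<in> {\<gamma> \<in> \<Gamma>. (u \<oplus>\<^bsub>DS\<^esub> v) \<gamma> \<noteq> \<zero>\<^bsub>sections \<F> (U \<gamma>)\<^esub>}"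
      then interpret Fg: module "sections \<O> (U \<gamma>)" "sections \<F> (U \<gamma>)" by (intro F.module_sections U) simp
      show "\<gamma> \<in> ?T" using \<gamma> by (auto simp: direct_sum_simps(3))
    qed
    note Luv = ext_sum_eq[OF uv T this]
    note Lu' = ext_sum_eq[OF u T Un_upper1] and Lv' = ext_sum_eq[OF v T Un_upper2]
    have e': "ext0 (U \<gamma>) (v \<gamma>) \<in> carrier (FcV A)" if "\<gamma> \<in> \<Gamma>" for \<gamma>
      using ext_zero_Fc[OF that direct_sumD(1)[OF v that]] .
    have "finsum (sections \<F> A) (\<lambda>\<gamma>. ext0 (U \<gamma>) ((u \<oplus>\<^bsub>DS\<^esub> v) \<gamma>)) ?T
        = finsum (sections \<F> A) (\<lambda>\<gamma>. ext0 (U \<gamma>) (u \<gamma>) \<oplus>\<^bsub>sections \<F> A\<^esub> ext0 (U \<gamma>) (v \<gamma>)) ?T"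
    proof (rule FA.M.finsum_cong'[OF refl])
      show "(\<lambda>\<gamma>. ext0 (U \<gamma>) (u \<gamma>) \<oplus>\<^bsub>sections \<F> A\<^esub> ext0 (U \<gamma>) (v \<gamma>)) \<in> ?T \<rightarrow> carrier (sections \<F> A)"
        using e e' Fc_A_in_sections T(2) by (intro funcsetI FA.M.a_closed) blast+
      fix \<gamma> assume "\<gamma> \<in> ?T"
      then have \<gamma>: "\<gamma> \<in> \<Gamma>" using T(2) by blast
      show "ext0 (U \<gamma>) ((u \<oplus>\<^bsub>DS\<^esub> v) \<gamma>) = ext0 (U \<gamma>) (u \<gamma>) \<oplus>\<^bsub>sections \<F> A\<^esub> ext0 (U \<gamma>) (v \<gamma>)"
        using linear_between_add[OF linear_ext_zero[OF U[OF \<gamma>]] direct_sumD(1)[OF u \<gamma>] direct_sumD(1)[OF v \<gamma>]] \<gamma>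
        by (simp add: direct_sum_simps(3))
    qed
    also have "\<dots> = L u \<oplus>\<^bsub>sections \<F> A\<^esub> L v"
      unfolding Lu' Lv' using e e' Fc_A_in_sections T(2)
      by (intro FA.M.finsum_addf funcsetI) blast+
    finally show "L (u \<oplus>\<^bsub>DS\<^esub> v) = L u \<oplus>\<^bsub>FcV A\<^esub> L v"
      unfolding Luv Fc_simps(1) . }
  fix c
  have cu: "c \<odot>\<^bsub>DS\<^esub> u \<in> carrier DS"
    using module.smult_closed[OF module_DS, of c u] u by simp
  have "{\<gamma> \<in> \<Gamma>. (c \<odot>\<^bsub>DS\<^esub> u) \<gamma> \<noteq> \<zero>\<^bsub>sections \<F> (U \<gamma>)\<^esub>} \<subseteq> ?S"
  proof
    fix \<gamma> assume \<gamma>: "\<gamma> \<in> {\<gamma> \<in> \<Gamma>. (c \<odot>\<^bsub>DS\<^esub> u) \<gamma> \<noteq> \<zero>\<^bsub>sections \<F> (U \<gamma>)\<^esub>}"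
    then have "\<gamma> \<in> \<Gamma>" by simp
    then have "c \<odot>\<^bsub>FcV (U \<gamma>)\<^esub> \<zero>\<^bsub>sections \<F> (U \<gamma>)\<^esub> = \<zero>\<^bsub>sections \<F> (U \<gamma>)\<^esub>"
      using module.smult_r_null[OF module_Fc[OF U], of \<gamma> c] by simp
    with \<gamma> show "\<gamma> \<in> ?S" by (auto simp: direct_sum_simps(4) simp del: Fc_simps(3))
  qed
  note Lcu = ext_sum_eq[OF cu fin sub this]
  have "finsum (sections \<F> A) (\<lambda>\<gamma>. ext0 (U \<gamma>) ((c \<odot>\<^bsub>DS\<^esub> u) \<gamma>)) ?S
      = finsum (sections \<F> A) (\<lambda>\<gamma>. c \<odot>\<^bsub>FcV A\<^esub> ext0 (U \<gamma>) (u \<gamma>)) ?S"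
  proof (rule FA.M.finsum_cong'[OF refl])
    show "(\<lambda>\<gamma>. c \<odot>\<^bsub>FcV A\<^esub> ext0 (U \<gamma>) (u \<gamma>)) \<in> ?S \<rightarrow> carrier (sections \<F> A)"
    proof (rule funcsetI)
      fix \<gamma> assume "\<gamma> \<in> ?S"
      then show "c \<odot>\<^bsub>FcV A\<^esub> ext0 (U \<gamma>) (u \<gamma>) \<in> carrier (sections \<F> A)"
        using FcA.smult_closed[of c, OF _ e, of \<gamma>] Fc_A_in_sections by simp
    qed
    fix \<gamma> assume "\<gamma> \<in> ?S"
    then have \<gamma>: "\<gamma> \<in> \<Gamma>" by blast
    show "ext0 (U \<gamma>) ((c \<odot>\<^bsub>DS\<^esub> u) \<gamma>) = c \<odot>\<^bsub>FcV A\<^esub> ext0 (U \<gamma>) (u \<gamma>)"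
      using linear_between_smult[OF linear_ext_zero[OF U[OF \<gamma>]] direct_sumD(1)[OF u \<gamma>], of c] \<gamma>
      by (simp add: direct_sum_simps(4) del: Fc_simps(3))
  qed
  also have "\<dots> = c \<odot>\<^bsub>FcV A\<^esub> L u"
    unfolding Lu by (rule finsum_Fc(2)[OF fin, symmetric]) (use e in blast)
  finally show "L (c \<odot>\<^bsub>DS\<^esub> u) = c \<odot>\<^bsub>FcV A\<^esub> L u"
    unfolding Lcu .
qed

lemma incl_closed: "\<gamma> \<in> \<Gamma> \<Longrightarrow> v \<in> carrier (FcV (U \<gamma>)) \<Longrightarrow> incl \<gamma> v \<in> carrier DS"
  by (rule direct_sum_incl_closed[of \<Gamma> "\<lambda>\<gamma>. FcV (U \<gamma>)"]) (rule module_Fc[OF U])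

lemma ext_sum_incl:
  assumes \<gamma>: "\<gamma> \<in> \<Gamma>" and v: "v \<in> carrier (FcV (U \<gamma>))"
  shows "L (incl \<gamma> v) = ext0 (U \<gamma>) v"
proof -
  have "L (incl \<gamma> v) = finsum (sections \<F> A) (\<lambda>\<delta>. ext0 (U \<delta>) (incl \<gamma> v \<delta>)) {\<gamma>}"
    by (rule ext_sum_eq[OF incl_closed[OF \<gamma> v]]) (use \<gamma> in \<open>auto simp: direct_sum_incl_def\<close>)
  also have "\<dots> = ext0 (U \<gamma>) (incl \<gamma> v \<gamma>)"
  proof -
    have "incl \<gamma> v \<gamma> = v" using \<gamma> by (simp add: direct_sum_incl_def)
    then show ?thesis
      using FA.M.finsum_insert[of "{}" \<gamma> "\<lambda>\<delta>. ext0 (U \<delta>) (incl \<gamma> v \<delta>)"] Fc_A_in_sections[OF ext_zero_Fc[OF \<gamma> v]]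
      by simp
  qed
  finally show ?thesis using \<gamma> by (simp add: direct_sum_incl_def)
qed

lemma direct_sum_maps:
  assumes "(S, j) \<in> {(FcT (U \<gamma>), incl \<gamma>) | \<gamma>. \<gamma> \<in> \<Gamma>}"
  shows "j ` topspace S \<subseteq> carrier DS"
  using assms incl_closed lc_topspace[OF lc_Fc_topology[OF U]] by auto

lemma lc_DT: "lc_topology DS DT"
  unfolding direct_sum_topology_def by (rule lc_final[OF module_DS direct_sum_maps])

lemma continuous_map_incl: "\<gamma> \<in> \<Gamma> \<Longrightarrow> continuous_map (FcT (U \<gamma>)) DT (incl \<gamma>)"
  unfolding direct_sum_topology_def
  by (rule continuous_map_into_final_lc[OF module_DS direct_sum_maps]) auto

text \<open>On each summand \<open>L\<close> is extension by zero, so the universal property of the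
  direct sum topology applies.\<close>

lemma continuous_map_ext_sum: "continuous_map DT (FcT A) L"
  unfolding direct_sum_topology_def
proof (rule continuous_map_from_final_lc[OF module_DS FcA.module_axioms linear_ext_sum
      lc_Fc_topology[OF openin_topspace] direct_sum_maps])
  fix S j assume "(S, j) \<in> {(FcT (U \<gamma>), incl \<gamma>) | \<gamma>. \<gamma> \<in> \<Gamma>}"
  then obtain \<gamma> where \<gamma>: "\<gamma> \<in> \<Gamma>" and S: "S = FcT (U \<gamma>)" "j = incl \<gamma>" by blast
  show "continuous_map S (FcT A) (L \<circ> j)"
    unfolding S
    by (rule continuous_map_eq[OF continuous_map_Fc_ext_zero[OF U[OF \<gamma>]]])
      (use lc_topspace[OF lc_Fc_topology[OF U[OF \<gamma>]]] ext_sum_incl[OF \<gamma>] in auto)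
qed

text \<open>Breaks multiplication by \<open>f\<close> into restriction to \<open>U \<gamma>\<close>,
  \<open>incl \<gamma>\<close> and \<open>L\<close>. Surjectivity uses the resulting element of the
  direct sum, openness the continuity of each link.\<close>

lemma act_factors:
  assumes \<gamma>: "\<gamma> \<in> \<Gamma>" and f: "f \<in> carrier (sections \<O> A)" and C: "compactin M C" "C \<subseteq> U \<gamma>"
    and f0: "restr \<O> A (A - C) f = \<zero>\<^bsub>sections \<O> (A - C)\<^esub>" and u: "u \<in> carrier (sections \<F> A)"
  shows "act A f A u \<in> supp_in A C"
    and "restr \<F> A (U \<gamma>) (act A f A u) \<in> carrier (FcV (U \<gamma>))"
    and "L (incl \<gamma> (restr \<F> A (U \<gamma>) (act A f A u))) = act A f A u"
proof -
  show 1: "act A f A u \<in> supp_in A C"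
    by (rule act_supp_in_vanishing[OF openin_topspace openin_topspace order.refl C(1) f f0 u])
  note r = restr_supp_in[OF U[OF \<gamma>] C 1]
  show 2: "restr \<F> A (U \<gamma>) (act A f A u) \<in> carrier (FcV (U \<gamma>))"
    unfolding mem_Fc using C r(1) by blast
  show "L (incl \<gamma> (restr \<F> A (U \<gamma>) (act A f A u))) = act A f A u"
    unfolding ext_sum_incl[OF \<gamma> 2] by (rule r(2))
qed

lemma act_Fc:
  "f \<in> carrier (sections \<O> A) \<Longrightarrow> u \<in> carrier (FcV A) \<Longrightarrow> act A f A u \<in> carrier (FcV A)"
  unfolding mem_Fc using act_supp_in[OF openin_topspace _ openin_topspace order.refl] by blast

lemma act_zero_A:
  assumes "u \<in> carrier (sections \<F> A)"
  shows "act A \<zero>\<^bsub>sections \<O> A\<^esub> A u = \<zero>\<^bsub>sections \<F> A\<^esub>"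
  by (rule act_zero[OF openin_topspace _ assms]) (simp add: restr_zero)

text \<open>In the ideal property \<open>f\<close> is arbitrary and only \<open>g\<close> belongs to
  \<open>G\<close>. Applying \<open>f\<close> first works because it preserves the compactly
  supported sections and acts continuously on them, whereas its effect on the image of
  \<open>L\<close> is not known beforehand.\<close>

lemma act_mult_swap:
  assumes f: "f \<in> carrier (sections \<O> A)" and g: "g \<in> carrier (sections \<O> A)" and u: "u \<in> carrier (sections \<F> A)"
  shows "act A (f \<otimes>\<^bsub>sections \<O> A\<^esub> g) A u = act A g A (act A f A u)"
  unfolding act_mult[OF openin_topspace openin_topspace order.refl f g u]
  by (rule act_commute[OF openin_topspace openin_topspace openin_topspace order.refl order.refl f g u])

lemmas act_add_A = act_add[OF openin_topspace openin_topspace order.refl]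

lemma ext_sum_surj: "L ` carrier DS = carrier (FcV A)"
proof (intro equalityI subsetI)
  fix w assume "w \<in> L ` carrier DS"
  then show "w \<in> carrier (FcV A)" using linear_between_closed[OF linear_ext_sum] by blast
next
  interpret DS: module complex_ring DS by (rule module_DS)
  fix w assume "w \<in> carrier (FcV A)"
  then obtain K where K: "compactin M K" "K \<subseteq> A" and wK: "w \<in> supp_in A K"
    unfolding mem_Fc by blast
  define G where "G = {f \<in> carrier (sections \<O> A). \<forall>u\<in>carrier (FcV A). act A f A u \<in> L ` carrier DS}"
  obtain f W where "f \<in> G" and W: "openin M W" "K \<subseteq> W" "restr \<O> A W f = \<one>\<^bsub>sections \<O> W\<^esub>"
  proof (rule finite_cover_bump[of \<Gamma> U K G])
    fix f C \<gamma>
    assume *: "\<gamma> \<in> \<Gamma>" "compactin M C" "C \<subseteq> U \<gamma>" "f \<in> carrier (sections \<O> A)"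
      "restr \<O> A (A - C) f = \<zero>\<^bsub>sections \<O> (A - C)\<^esub>"
    have "act A f A u \<in> L ` carrier DS" if "u \<in> carrier (FcV A)" for u
      using act_factors(3)[OF *(1,4,2,3,5) Fc_A_in_sections[OF that], symmetric]
        incl_closed[OF *(1) act_factors(2)[OF *(1,4,2,3,5) Fc_A_in_sections[OF that]]]
      by (rule image_eqI)
    then show "f \<in> G" unfolding G_def using *(4) by blast
  next
    fix f g assume f: "f \<in> G" and g: "g \<in> G"
    then have fg: "f \<in> carrier (sections \<O> A)" "g \<in> carrier (sections \<O> A)" unfolding G_def by auto
    have "act A (f \<oplus>\<^bsub>sections \<O> A\<^esub> g) A u \<in> L ` carrier DS" if u: "u \<in> carrier (FcV A)" for u
    proof -
      obtain x y where x: "x \<in> carrier DS" "act A f A u = L x" and y: "y \<in> carrier DS" "act A g A u = L y"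
        using f g u unfolding G_def by blast
      have "act A (f \<oplus>\<^bsub>sections \<O> A\<^esub> g) A u = L (x \<oplus>\<^bsub>DS\<^esub> y)"
        using linear_between_add[OF linear_ext_sum x(1) y(1)] act_add_A[OF fg Fc_A_in_sections[OF u]] x(2) y(2)
        by simp
      then show ?thesis using DS.M.a_closed[OF x(1) y(1)] by (rule image_eqI)
    qed
    then show "f \<oplus>\<^bsub>sections \<O> A\<^esub> g \<in> G"
      unfolding G_def using fg cring_sections[OF openin_topspace] by (simp add: cring.cring_simprules(1))
  next
    fix f g assume f: "f \<in> carrier (sections \<O> A)" and "g \<in> G"
    then have g: "g \<in> carrier (sections \<O> A)" "\<And>u. u \<in> carrier (FcV A) \<Longrightarrow> act A g A u \<in> L ` carrier DS"
      unfolding G_def by auto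
    have "act A (f \<otimes>\<^bsub>sections \<O> A\<^esub> g) A u \<in> L ` carrier DS" if u: "u \<in> carrier (FcV A)" for u
      unfolding act_mult_swap[OF f g(1) Fc_A_in_sections[OF u]] by (rule g(2)[OF act_Fc[OF f u]])
    then show "f \<otimes>\<^bsub>sections \<O> A\<^esub> g \<in> G"
      unfolding G_def using f g cring_sections[OF openin_topspace] by (simp add: cring.cring_simprules(5))
  next
    have "act A \<zero>\<^bsub>sections \<O> A\<^esub> A u \<in> L ` carrier DS" if u: "u \<in> carrier (FcV A)" for u
    proof -
      have "act A \<zero>\<^bsub>sections \<O> A\<^esub> A u = L \<zero>\<^bsub>DS\<^esub>"
        using linear_between_zero[OF module_DS FcA.module_axioms linear_ext_sum]
          act_zero_A[OF Fc_A_in_sections[OF u]] by simp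
      then show ?thesis using DS.M.zero_closed by (rule image_eqI)
    qed
    then show "\<zero>\<^bsub>sections \<O> A\<^esub> \<in> G"
      unfolding G_def using cring_sections[OF openin_topspace] by (simp add: cring.cring_simprules(2))
  qed (use U K cover in \<open>auto simp: G_def\<close>)
  have f: "f \<in> carrier (sections \<O> A)" "act A f A w \<in> L ` carrier DS"
    using \<open>f \<in> G\<close> \<open>w \<in> carrier (FcV A)\<close> unfolding G_def by auto
  have "act A f A w = w"
    by (rule act_eq_self[OF openin_topspace openin_topspace order.refl K(1) wK f(1) W(1,2) openin_subset[OF W(1)] W(3)])
  then show "w \<in> L ` carrier DS" using f(2) by simp
qed

lemma open_map_ext_sum: "open_map DT (FcT A) L"
proof -
  \<comment> \<open>\<open>T\<close> is the quotient topology on the target, available because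
    \<open>L\<close> is already known to be onto.\<close>
  obtain T where T: "lc_topology (FcV A) T" and LT: "continuous_map DT T L" and op: "open_map DT T L"
    by (rule lc_image_topology[OF module_DS FcA.module_axioms linear_ext_sum ext_sum_surj lc_DT])
  have top: "topspace T = carrier (FcV A)" by (rule lc_topspace[OF T])
  define G where "G = {f \<in> carrier (sections \<O> A). \<forall>K. compactin M K \<longrightarrow> continuous_map (FK A K) T (act A f A)}"
  \<comment> \<open>This is exactly the condition for \<open>T\<close> to take part in the supremum
    that defines \<open>FcT A\<close>.\<close>
  have id: "continuous_map (FK A K) T (\<lambda>u. u)" if K: "compactin M K" "K \<subseteq> A" for K
  proof -
    obtain f W where "f \<in> G" and W: "openin M W" "K \<subseteq> W" "restr \<O> A W f = \<one>\<^bsub>sections \<O> W\<^esub>"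
    proof (rule finite_cover_bump[of \<Gamma> U K G])
      fix f C \<gamma>
      assume *: "\<gamma> \<in> \<Gamma>" "compactin M C" "C \<subseteq> U \<gamma>" "f \<in> carrier (sections \<O> A)"
        "restr \<O> A (A - C) f = \<zero>\<^bsub>sections \<O> (A - C)\<^esub>"
      note fac = act_factors[OF *(1,4,2,3,5) supp_in_carrier]
      have "continuous_map (FK A K) T (act A f A)" if K: "compactin M K" for K
      proof -
        have "continuous_map (FK A K) (smooth A) (act A f A)"
          using continuous_map_act[OF *(4) K] by (simp add: continuous_map_in_subtopology)
        \<comment> \<open>After multiplication the support lies in \<open>C\<close>. Both subspaces
          carry the topology of \<open>smooth A\<close>, so only the range has to be
          checked.\<close>
        then have 1: "continuous_map (FK A K) (FK A C) (act A f A)"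
          using fac(1) by (auto simp: continuous_map_in_subtopology topspace_FK)
        note 2 = continuous_map_compose[OF 1 continuous_map_restr[OF U[OF *(1)] *(2,3)]]
        note 3 = continuous_map_compose[OF 2 continuous_map_FK_Fc[OF U[OF *(1)] *(2,3)]]
        \<comment> \<open>The whole chain: multiply by \<open>f\<close>, restrict to
          \<open>U \<gamma>\<close>, enter the compactly supported sections there, include in the
          direct sum, apply \<open>L\<close>. The result is again multiplication by
          \<open>f\<close>.\<close>
        note 4 = continuous_map_compose[OF continuous_map_compose[OF 3 continuous_map_incl[OF *(1)]] LT]
        show ?thesis
          by (rule continuous_map_eq[OF 4]) (use fac(3) in \<open>auto simp: topspace_FK\<close>)
      qed
      then show "f \<in> G" unfolding G_def using *(4) by blast
    next
      fix f g assume f: "f \<in> G" and g: "g \<in> G"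
      then have fg: "f \<in> carrier (sections \<O> A)" "g \<in> carrier (sections \<O> A)" unfolding G_def by auto
      have "continuous_map (FK A K) T (act A (f \<oplus>\<^bsub>sections \<O> A\<^esub> g) A)" if K: "compactin M K" for K
      proof -
        have "continuous_map (FK A K) T (\<lambda>u. act A f A u \<oplus>\<^bsub>FcV A\<^esub> act A g A u)"
          using f g K unfolding G_def by (intro lc_continuous_add[OF T]) auto
        then show ?thesis
          by (rule continuous_map_eq) (use act_add_A[OF fg supp_in_carrier] in \<open>auto simp: topspace_FK\<close>)
      qed
      then show "f \<oplus>\<^bsub>sections \<O> A\<^esub> g \<in> G"
        unfolding G_def using fg cring_sections[OF openin_topspace] by (simp add: cring.cring_simprules(1))
    next
      fix f g assume f: "f \<in> carrier (sections \<O> A)" and "g \<in> G"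
      then have g: "g \<in> carrier (sections \<O> A)" "\<And>K. compactin M K \<Longrightarrow> continuous_map (FK A K) T (act A g A)"
        unfolding G_def by auto
      have "continuous_map (FK A K) T (act A (f \<otimes>\<^bsub>sections \<O> A\<^esub> g) A)" if K: "compactin M K" for K
        by (rule continuous_map_eq[OF continuous_map_compose[OF continuous_map_act[OF f K] g(2)[OF K]]])
          (use act_mult_swap[OF f g(1) supp_in_carrier] in \<open>auto simp: topspace_FK\<close>)
      then show "f \<otimes>\<^bsub>sections \<O> A\<^esub> g \<in> G"
        unfolding G_def using f g cring_sections[OF openin_topspace] by (simp add: cring.cring_simprules(5))
    next
      have "continuous_map (FK A K) T (act A \<zero>\<^bsub>sections \<O> A\<^esub> A)" for K
      proof -
        have "continuous_map (FK A K) T (\<lambda>u. \<zero>\<^bsub>sections \<F> A\<^esub>)"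
          using top FcA.M.zero_closed by simp
        then show ?thesis
          by (rule continuous_map_eq) (use act_zero_A[OF supp_in_carrier] in \<open>auto simp: topspace_FK\<close>)
      qed
      then show "\<zero>\<^bsub>sections \<O> A\<^esub> \<in> G"
        unfolding G_def using cring_sections[OF openin_topspace] by (simp add: cring.cring_simprules(2))
    qed (use U K cover in \<open>auto simp: G_def\<close>)
    then have f: "f \<in> carrier (sections \<O> A)" "continuous_map (FK A K) T (act A f A)"
      unfolding G_def using K by auto
    have "act A f A u = u" if "u \<in> supp_in A K" for u
      by (rule act_eq_self[OF openin_topspace openin_topspace order.refl K(1) that f(1) W(1,2) openin_subset[OF W(1)] W(3)])
    then show ?thesis
      using f(2) by (intro continuous_map_eq[OF f(2)]) (simp add: topspace_FK)
  qed
  \<comment> \<open>By \<open>id\<close> the topology \<open>T\<close> is one of those whose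
    supremum is \<open>FcT A\<close>, so images that are open for \<open>T\<close> are open there as
    well.\<close>
  have "openin (FcT A) Z" if "openin T Z" for Z
    unfolding Fc_topology_def
    by (rule continuous_map_final_lc_finer[OF T _ that]) (use id in auto)
  then show ?thesis
    using op unfolding open_map_def by blast
qed

end

end

theorem proposition4p7:
  fixes M :: "'a topology"
    and \<O> :: "('a, complex, 'r) sheaf_data"
    and \<F> :: "('a, 'r, 'f) sheaf_data"
    and \<Gamma> :: "'i set"
    and U :: "'i \<Rightarrow> 'a set"
  assumes "formal_manifold M \<O>"
    and "module_sheaf M \<O> \<F>"
    and "\<And>\<gamma>. \<gamma> \<in> \<Gamma> \<Longrightarrow> openin M (U \<gamma>)"
    and "(\<Union>\<gamma>\<in>\<Gamma>. U \<gamma>) = topspace M"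
  defines "DS \<equiv> direct_sum \<Gamma> (\<lambda>\<gamma>. Fc M \<O> \<F> (U \<gamma>))"
    and "DT \<equiv> direct_sum_topology \<Gamma> (\<lambda>\<gamma>. Fc M \<O> \<F> (U \<gamma>)) (\<lambda>\<gamma>. Fc_topology M \<O> \<F> (U \<gamma>))"
  shows "linear_between DS (Fc M \<O> \<F> (topspace M)) (ext_sum M \<F> \<Gamma> U)
       \<and> continuous_map DT (Fc_topology M \<O> \<F> (topspace M)) (ext_sum M \<F> \<Gamma> U)
       \<and> open_map DT (Fc_topology M \<O> \<F> (topspace M)) (ext_sum M \<F> \<Gamma> U)
       \<and> ext_sum M \<F> \<Gamma> U ` carrier DS = carrier (Fc M \<O> \<F> (topspace M))"
proof -
  interpret formal_module_sheaf M \<O> \<F>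
    by (rule formal_module_sheaf.intro[OF assms(1,2)])
  show ?thesis
    unfolding DS_def DT_def
    by (intro conjI linear_ext_sum[OF assms(3,4)] continuous_map_ext_sum[OF assms(3,4)]
        open_map_ext_sum[OF assms(3,4)] ext_sum_surj[OF assms(3,4)])
qed

end
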